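(* Let $K\ge1$ be a constant and let $\gamma^{\ast}=\sup_{F\in\mathcal S_H(K)}\frac{|F_{zz}(0)|}{2}$. Suppose $f=h+\overline g\in\mathcal S_H(K)$ with $h(z)=z+\sum_{n=2}^\infty a_nz^n$ and $g(z)=\sum_{n=1}^\infty b_nz^n$. Then for every $p\in(1/\gamma^{\ast},\infty)$, $$M_p(r,f)=O\left(\frac{1}{(1-r)^{\gamma^{\ast}-\frac1p}}\right),$$ and there exists a constant $C(K)$, depending only on $K$, such that $$|a_n|\le C(K)\,n^{\gamma^{\ast}-1}\qquad\text{for } n\in\{2,3,\ldots\}.$$ In particular, when $K=1$, the exponent $\gamma^{\ast}-1$ reduces to $1$ (that is, $\gamma^\ast-1=1$).
   Context: $\mathbb D=\{z\in\mathbb C:|z|<1\}$. $\mathcal S_H$ is the family of sense-preserving univalent (injective) harmonic mappings $f=h+\overline g$ in $\mathbb D$, with $h,g$ analytic in $\mathbb D$, normalized by $h(0)=g(0)=h'(0)-1=0$. (Sense-preserving: $J_f=|h'|^2-|g'|^2>0$ in $\mathbb D$.) Put $f_z=h'$, $f_{\overline z}=\overline{g'}$, $\Lambda_f=|f_z|+|f_{\overline z}|$; $f_{zz}=h''$. $\mathcal S_H(K)$ is the set of $f\in\mathcal S_H$ that are harmonic $K$-quasiregular, i.e. $\Lambda_f^2\le KJ_f$ in $\mathbb D$. $M_p(r,f)=\left(\frac1{2\pi}\int_0^{2\pi}|f(re^{i\theta})|^p\,d\theta\right)^{1/p}$ for $r\in[0,1)$. For nonnegative functions $\chi_1,\chi_2$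 on $[0,1)$, $\chi_1(r)=O(\chi_2(r))$ means: there exist $C>0$ and $r_0\in(0,1)$ with $\chi_1(r)\le C\chi_2(r)$ for all $r\in(r_0,1)$. *)

theory Defs
  imports "HOL-Complex_Analysis.Complex_Analysis" "HOL-Library.Landau_Symbols"
begin

abbreviation unit_disc :: "complex set" where
  "unit_disc \<equiv> ball 0 1"

text \<open>
  A harmonic mapping \<open>f = h + cnj g\<close> of the unit disc with \<open>g 0 = 0\<close> is represented by
  the pair \<open>(h, g)\<close>, which it determines uniquely on the disc. In this representation
  \<open>f_z = h'\<close>, \<open>f_zbar = cnj (g')\<close> and \<open>f_zz = h''\<close>.
\<close>

type_synonym harmonic_pair = "(complex \<Rightarrow> complex) \<times> (complex \<Rightarrow> complex)"

definition harmonic_map :: "harmonic_pair \<Rightarrow> complex \<Rightarrow> complex" where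
  "harmonic_map = (\<lambda>(h, g) z. h z + cnj (g z))"

definition f_z :: "harmonic_pair \<Rightarrow> complex \<Rightarrow> complex" where
  "f_z = (\<lambda>(h, g). deriv h)"

definition f_zbar :: "harmonic_pair \<Rightarrow> complex \<Rightarrow> complex" where
  "f_zbar = (\<lambda>(h, g) z. cnj (deriv g z))"

definition f_zz :: "harmonic_pair \<Rightarrow> complex \<Rightarrow> complex" where
  "f_zz = (\<lambda>(h, g). deriv (deriv h))"

definition Jac :: "harmonic_pair \<Rightarrow> complex \<Rightarrow> real" where
  "Jac f z = (norm (f_z f z))\<^sup>2 - (norm (f_zbar f z))\<^sup>2"

definition Lam :: "harmonic_pair \<Rightarrow> complex \<Rightarrow> real" where
  "Lam f z = norm (f_z f z) + norm (f_zbar f z)"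

definition S_H :: "harmonic_pair set" where
  "S_H = {(h, g). h holomorphic_on unit_disc \<and> g holomorphic_on unit_disc \<and>
                  h 0 = 0 \<and> g 0 = 0 \<and> deriv h 0 = 1 \<and>
                  inj_on (harmonic_map (h, g)) unit_disc \<and>
                  (\<forall>z\<in>unit_disc. 0 < Jac (h, g) z)}"

definition S_H_qr :: "real \<Rightarrow> harmonic_pair set" where
  "S_H_qr K = {f \<in> S_H. \<forall>z\<in>unit_disc. (Lam f z)\<^sup>2 \<le> K * Jac f z}"

text \<open>
  The supremum is taken in the reals: for \<open>K \<ge> 1\<close> the class contains the identity, and
  \<open>norm (f_zz F 0)\<close> is bounded even on all of \<open>S_H\<close> (compactness theorem of Clunie and
  Sheil-Small), so this is the genuine least upper bound.
\<close>

definition gamma_star :: "real \<Rightarrow> real" where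
  "gamma_star K = (SUP F\<in>S_H_qr K. norm (f_zz F 0) / 2)"

definition M_p :: "real \<Rightarrow> real \<Rightarrow> (complex \<Rightarrow> complex) \<Rightarrow> real" where
  "M_p p r f =
     (1 / (2 * pi) * integral {0..2 * pi}
        (\<lambda>\<theta>. norm (f (of_real r * exp (\<i> * of_real \<theta>))) powr p)) powr (1 / p)"

end

theory Submission
  imports Defs
begin

text \<open>
  Write \<gamma> for \<open>gamma_star K\<close>, D for the unit disc and \<Lambda> for \<open>|h'| + |g'|\<close>.

  The class is invariant under the Koebe transforms
  \<open>F(z) = (f((z + \<zeta>) / (1 + cnj \<zeta> z)) - f(\<zeta>)) / ((1 - |\<zeta>|^2) h'(\<zeta>))\<close>.
  The bound 2 \<gamma> for the second derivative at 0 of every member is therefore a differential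
  inequality for \<open>log |h'|\<close> along radii, and two integrations bound \<open>|h'|\<close> by a multiple of
  \<open>(1 - |z|)^(-\<gamma>-1)\<close> and \<open>|f|\<close> by a multiple of \<open>(1 - |z|)^(-\<gamma>)\<close>
  (\<open>S_H_qr_linear_invariance\<close>, \<open>S_H_qr_distortion\<close>, \<open>S_H_qr_growth\<close>).

  The supremum is finite. This is what makes \<gamma> an upper bound at all, and it is shown by the
  length-area method (\<open>courant_lebesgue\<close>): a quasiconformal map with bounded image oscillates
  little on small discs. Let d be the distance from 0 to a nearest omitted value \<open>w0\<close>. Applied to a
  bounded Moebius image of a square root of \<open>f - w0\<close>, the method gives \<open>|f| \<le> 26 d\<close> on a disc that
  depends on K only; applied to the inverse of f, it shows that f takes the value \<open>\<kappa> d\<close> close to 0.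
  Since \<open>h'\<close> has no zeros and \<open>h'(0) = 1\<close>, the Borel-Caratheodory inequality for \<open>log h'\<close> yields
  \<open>\<kappa> d \<le> (C d)^(2/5)\<close>. So d is bounded, and then \<open>h''(0)\<close> is, by Cauchy's estimate.

  The growth bound alone would give the exponent \<gamma> for the means; the gain 1/p is an area
  argument. As f is injective and \<open>\<Lambda>^2\<close> is at most K times the Jacobian, the integral of
  \<open>|f|^(p-2) \<Lambda>^2\<close> over an annulus in the disc of radius r is at most K times the integral of
  \<open>|w|^(p-2)\<close> over the disc of radius \<open>M = max |f|\<close>, a multiple of \<open>M^p\<close>. Let \<open>I(r)\<close> be the integral of
  \<open>|f|^p\<close> over the circle of radius r, and \<open>\<beta> = p \<gamma> - 1\<close>. By Cauchy-Schwarz on the radial segments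
  from \<open>2r - 1\<close> to r, \<open>I(r) \<le> 2^(\<beta>/2) I(2r - 1) + C (1 - r)^(-\<beta>)\<close>. The passage from \<open>2r - 1\<close> to r halves
  the distance to the unit circle, which multiplies \<open>(1 - r)^(-\<beta>)\<close> by \<open>2^\<beta>\<close>, more than the factor
  \<open>2^(\<beta>/2)\<close> of the recursion, so \<open>I(r)\<close> is at most a multiple of \<open>(1 - r)^(-\<beta>)\<close>
  (\<open>integral_mean_step\<close>, \<open>S_H_qr_integral_mean\<close>).

  The Koebe function belongs to the class for every K, so \<open>\<gamma> \<ge> 2\<close> and p = 1 is
  admissible. Cauchy's formula on the circle of radius \<open>1 - 1/n\<close>, to which the conjugate of g does
  not contribute, turns the mean of order 1 into the coefficient bound.

  For K = 1 the function g vanishes and the class is that of the normalized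
  univalent functions, so \<open>\<gamma> = 2\<close> is Bieberbach's inequality. It follows from the area theorem for
  the odd function \<open>1 / sqrt (f(z^2))\<close>, proved with the same area computation in polar coordinates.
\<close>

\<comment> \<open>The symbol \<open>$\<close> denotes components of vectors here, not coefficients of power series.\<close>
unbundle no fps_syntax

section \<open>Change of variables in polar coordinates\<close>

text \<open>
  The derivative of f is recorded by its two Wirtinger derivatives A and B: the Jacobian determinant
  is \<open>|A|^2 - |B|^2\<close>, the operator norm is \<open>|A| + |B|\<close>, and composition with holomorphic maps and
  inversion act on them by simple formulas.
\<close>

definition C1_wirtinger :: "(complex \<Rightarrow> complex) \<Rightarrow> (complex \<Rightarrow> complex) \<Rightarrow> (complex \<Rightarrow> complex) \<Rightarrow> complex set \<Rightarrow> bool" where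
  "C1_wirtinger f A B U \<longleftrightarrow> open U \<and> continuous_on U A \<and> continuous_on U B \<and>
     (\<forall>z\<in>U. (f has_derivative (\<lambda>v. A z * v + B z * cnj v)) (at z))"

lemma C1_wirtinger_cont: "C1_wirtinger f A B U \<Longrightarrow> continuous_on U f"
  unfolding C1_wirtinger_def
  by (metis continuous_at_imp_continuous_on has_derivative_continuous)

text \<open>
  The substitution rule for multiple integrals is used on \<open>real^2\<close>; these two maps identify that
  space isometrically with the complex plane.
\<close>

definition to_vec :: "complex \<Rightarrow> real^2" where "to_vec z = (\<chi> i. if i = 1 then Re z else Im z)"
definition of_vec :: "real^2 \<Rightarrow> complex" where "of_vec v = Complex (v$1) (v$2)"

lemma of_to_vec [simp]: "of_vec (to_vec z) = z"
  by (simp add: of_vec_def to_vec_def complex_eq_iff)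

lemma to_of_vec [simp]: "to_vec (of_vec v) = v"
  by (simp add: of_vec_def to_vec_def vec_eq_iff forall_2)

lemma to_vec_nth [simp]: "to_vec z $ 1 = Re z" "to_vec z $ 2 = Im z"
  by (simp_all add: to_vec_def)

lemma to_vec_ball: "to_vec ` ball c r = ball (to_vec c) r"
proof -
  have d: "dist (to_vec x) (to_vec y) = dist x y" for x y
    by (simp add: dist_norm norm_vec_def L2_set_def sum_2 cmod_def)
  have "y \<in> to_vec ` ball c r" if "y \<in> ball (to_vec c) r" for y
    using that d[of c "of_vec y"] by (intro image_eqI[of _ _ "of_vec y"]) auto
  with d show ?thesis by auto
qed

lemma bounded_linear_to_vec: "bounded_linear to_vec"
proof (rule bounded_linear_intro[where K=1])
  show "norm (to_vec x) \<le> norm x * 1" for x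
    by (simp add: norm_vec_def L2_set_def sum_2 cmod_def)
qed (simp_all add: to_vec_def vec_eq_iff)

text \<open>
  Fubini's theorem, transported to \<open>real^2\<close> along the measure preserving bijection with
  \<open>real \<times> real\<close>.
\<close>

lemma integral_rectangle_vec:
  fixes g :: "real \<Rightarrow> real \<Rightarrow> real"
  assumes "continuous_on (cbox (a,c) (b,d)) (\<lambda>(x,y). g x y)"
  shows "((\<lambda>v::real^2. g (v$1) (v$2)) has_integral
           integral {a..b} (\<lambda>x. integral {c..d} (\<lambda>y. g x y))) (cbox (vector [a,c]) (vector [b,d]))"
proof -
  let ?g = "\<lambda>v::real^2. (v$1, v$2)"
  let ?h = "\<lambda>p. vector [fst p, snd p] :: real^2"
  have gh [simp]: "?g (?h p) = p" "?h (?g v) = v" for p v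
    by (auto simp: vec_eq_iff forall_2)
  have img1: "?g ` cbox u v = cbox (u$1,u$2) (v$1,v$2)" for u v :: "real^2"
  proof (intro equalityI subsetI)
    fix p assume "p \<in> cbox (u$1,u$2) (v$1,v$2)"
    then show "p \<in> ?g ` cbox u v"
      by (intro image_eqI[where x="?h p"]) (auto simp: mem_box_cart forall_2 cbox_Pair_eq)
  qed (auto simp: mem_box_cart forall_2 cbox_Pair_eq)
  have img2: "?h ` cbox (u1,u2) (v1,v2) = cbox (vector [u1,u2]) (vector [v1,v2])" for u1 u2 v1 v2 :: real
  proof (intro equalityI subsetI)
    fix p :: "real^2" assume "p \<in> cbox (vector [u1,u2]) (vector [v1,v2])"
    then show "p \<in> ?h ` cbox (u1,u2) (v1,v2)"
      by (intro image_eqI[where x="?g p"]) (auto simp: mem_box_cart forall_2 vec_eq_iff cbox_Pair_eq)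
  qed (auto simp: mem_box_cart forall_2 cbox_Pair_eq)
  have cont: "measure lborel (?g ` cbox u v) = 1 * measure lborel (cbox u v)" for u v :: "real^2"
  proof (cases "u$1 \<le> v$1 \<and> u$2 \<le> v$2")
    case True
    then have "cbox u v \<noteq> {}" by (simp add: interval_ne_empty_cart forall_2)
    with True show ?thesis
      unfolding img1 by (simp add: content_Pair content_cbox_cart UNIV_2 content_real)
  next
    case False
    then have "cbox u v = {}" using interval_ne_empty_cart(1)[of u v] by (auto simp: forall_2)
    then show ?thesis by simp
  qed
  have int: "((\<lambda>(x,y). g x y) has_integral integral {a..b} (\<lambda>x. integral {c..d} (\<lambda>y. g x y))) (cbox (a,c) (b,d))"
    using integral_prod_continuous[OF assms] integrable_continuous[OF assms]
    by (simp add: has_integral_iff)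
  have "((\<lambda>x. (\<lambda>(x,y). g x y) (?g x)) has_integral (1/1) *\<^sub>R integral {a..b} (\<lambda>x. integral {c..d} (\<lambda>y. g x y))) (?h ` cbox (a,c) (b,d))"
  proof (rule has_integral_twiddle[OF _ _ _ _ _ _ cont int])
    show "\<exists>w z. ?h ` cbox u v = cbox w z" for u v :: "real \<times> real"
      using img2[of "fst u" "snd u" "fst v" "snd v"] by auto
    show "\<exists>w z. ?g ` cbox u v = cbox w z" for u v using img1 by blast
    show "continuous (at x) ?g" for x :: "real^2" by (intro continuous_intros)
  qed (auto simp: vec_eq_iff forall_2)
  then show ?thesis by (simp add: img2)
qed

abbreviation polar :: "complex \<Rightarrow> real \<Rightarrow> real \<Rightarrow> complex" where
  "polar c \<rho> \<theta> \<equiv> c + of_real \<rho> * cis \<theta>"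

lemma polar_inj: "inj_on (\<lambda>(\<rho>,\<theta>). polar c \<rho> \<theta>) ({0<..} \<times> {0<..<2*pi})"
proof (rule inj_onI, clarsimp)
  fix r s t u assume *: "of_real r * cis t = of_real s * cis u" "0<r" "0<s" "0<t" "t<2*pi" "0<u" "u<2*pi"
  then have "norm (of_real r * cis t) = norm (of_real s * cis u)" by simp
  then have rs: "r = s" using *(2,3) by (simp only: norm_mult norm_of_real norm_cis)
  with * have "cis t = cis u" by simp
  then have "exp (\<i> * t) = exp (\<i> * u)" by (simp add: cis_conv_exp)
  then obtain n :: int where "\<i> * t = \<i> * u + of_int (2 * n) * of_real pi * \<i>"
    unfolding exp_eq by auto
  then have "t = u + of_int (2*n) * pi" by (auto simp: complex_eq_iff)
  then have "of_int n * (2*pi) = t - u" by simp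
  moreover have "\<bar>t - u\<bar> < 2*pi" using * by auto
  ultimately have "\<bar>of_int n\<bar> * (2*pi) < 1 * (2*pi)" by (metis abs_mult abs_of_nonneg pi_ge_zero mult_1 zero_le_mult_iff zero_le_numeral)
  then have "\<bar>of_int n::real\<bar> < 1" using pi_gt_zero by (simp only: mult_less_cancel_right)
  then have "n = 0" by linarith
  then show "r = s \<and> t = u" using \<open>t = u + of_int (2*n) * pi\<close> rs by simp
qed

text \<open>
  The angle stays strictly between 0 and \<open>2 pi\<close>, so that polar coordinates are injective; the
  radius that is cut out is a null set.
\<close>

definition slit_annulus :: "complex \<Rightarrow> real \<Rightarrow> real \<Rightarrow> complex set" where
  "slit_annulus c a b = (\<lambda>(\<rho>,\<theta>). polar c \<rho> \<theta>) ` ({a<..<b} \<times> {0<..<2*pi})"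

lemma dist_polar: "dist c (polar c r t) = \<bar>r\<bar>"
  by (simp add: dist_norm norm_mult)

text \<open>
  The map \<open>(\<rho>, \<theta>) \<mapsto> f (c + \<rho> cis \<theta>)\<close> on an open rectangle has Jacobian determinant
  \<open>\<rho> (|A|^2 - |B|^2)\<close>, so a single substitution accounts for the polar coordinates and for f.
\<close>

lemma polar_change_of_variables:
  fixes w :: "complex \<Rightarrow> real"
  assumes ab: "0 < a" "a < b" and f: "C1_wirtinger f A B U"
    and sub: "\<And>z. a \<le> dist c z \<Longrightarrow> dist c z \<le> b \<Longrightarrow> z \<in> U"
    and inj: "inj_on f {z. a < dist c z \<and> dist c z < b}"
    and w: "continuous_on (f ` {z. a \<le> dist c z \<and> dist c z \<le> b}) w"
  shows "(\<lambda>v. w (of_vec v)) absolutely_integrable_on (to_vec ` f ` slit_annulus c a b)"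
    and "integral (to_vec ` f ` slit_annulus c a b) (\<lambda>v. w (of_vec v)) =
      integral {a..b} (\<lambda>\<rho>. integral {0..2*pi} (\<lambda>\<theta>. \<rho> *
         \<bar>(norm (A (polar c \<rho> \<theta>)))^2 - (norm (B (polar c \<rho> \<theta>)))^2\<bar> *
         w (f (polar c \<rho> \<theta>))))"
proof -
  let ?P = "\<lambda>x::real^2. c + of_real (x$1) * cis (x$2)"
  let ?g = "\<lambda>x. to_vec (f (?P x))"
  let ?C = "cbox (vector [a,0]) (vector [b,2*pi]) :: (real^2) set"
  let ?S = "box (vector [a,0]) (vector [b,2*pi]) :: (real^2) set"
  let ?dP = "\<lambda>(x::real^2) (h::real^2). of_real (h$1) * cis (x$2) + of_real (x$1) * (of_real (h$2) * (\<i> * cis (x$2)))"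
  let ?g' = "\<lambda>x h. to_vec (A (?P x) * ?dP x h + B (?P x) * cnj (?dP x h))"
  let ?J = "\<lambda>z. \<bar>(norm (A z))^2 - (norm (B z))^2\<bar>"
  let ?G = "\<lambda>\<rho> \<theta>. \<rho> * ?J (polar c \<rho> \<theta>) * w (f (polar c \<rho> \<theta>))"
  have opU: "open U" and contA: "continuous_on U A" and contB: "continuous_on U B"
    and derf: "\<And>z. z \<in> U \<Longrightarrow> (f has_derivative (\<lambda>v. A z * v + B z * cnj v)) (at z)"
    using f by (auto simp: C1_wirtinger_def)
  have memC: "x \<in> ?C \<longleftrightarrow> a \<le> x$1 \<and> x$1 \<le> b \<and> 0 \<le> x$2 \<and> x$2 \<le> 2*pi" for x :: "real^2"
    by (auto simp: mem_box_cart forall_2)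
  have memS: "x \<in> ?S \<longleftrightarrow> a < x$1 \<and> x$1 < b \<and> 0 < x$2 \<and> x$2 < 2*pi" for x :: "real^2"
    by (auto simp: mem_box_cart forall_2)
  have PU: "?P x \<in> U" if "x \<in> ?C" for x
    using that ab by (intro sub) (auto simp: memC dist_polar)
  have image: "?g ` ?S = to_vec ` f ` slit_annulus c a b"
  proof -
    have "?P ` ?S = slit_annulus c a b"
      unfolding slit_annulus_def
    proof (intro equalityI subsetI)
      fix z assume "z \<in> (\<lambda>(\<rho>,\<theta>). polar c \<rho> \<theta>) ` ({a<..<b} \<times> {0<..<2*pi})"
      then obtain r t where "z = polar c r t" "a<r" "r<b" "0<t" "t<2*pi" by auto
      then show "z \<in> ?P ` ?S"
        by (intro image_eqI[where x="vector [r,t]"]) (auto simp: memS)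
    qed (auto simp: memS)
    then show ?thesis by (metis (no_types, lifting) image_cong image_image)
  qed
  have derP: "(?P has_derivative ?dP x) (at x)" for x
  proof -
    have *: "((\<lambda>x::real^2. cis (x$2)) has_derivative (\<lambda>h. of_real (h$2) * (\<i> * cis (x$2)))) (at x)"
    proof -
      have "((\<lambda>x::real^2. \<i> * of_real (x$2)) has_derivative (\<lambda>h. \<i> * of_real (h$2))) (at x)"
        by (intro has_derivative_mult_right has_derivative_of_real bounded_linear_imp_has_derivative bounded_linear_vec_nth)
      from has_derivative_compose[OF this DERIV_exp[THEN has_field_derivative_imp_has_derivative]]
      show ?thesis by (simp add: cis_conv_exp mult_ac)
    qed
    show ?thesis
      by (auto intro!: derivative_eq_intros * bounded_linear_imp_has_derivative bounded_linear_vec_nth simp: fun_eq_iff algebra_simps scaleR_conv_of_real)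
  qed
  have derg: "(?g has_derivative ?g' x) (at x within ?S)" if "x \<in> ?S" for x
  proof -
    have xU: "?P x \<in> U" using that PU box_subset_cbox by blast
    have "((\<lambda>y. f (?P y)) has_derivative (\<lambda>h. A (?P x) * ?dP x h + B (?P x) * cnj (?dP x h))) (at x)"
      using has_derivative_compose[OF derP derf[OF xU]] by simp
    then have "(?g has_derivative ?g' x) (at x)"
      by (rule bounded_linear.has_derivative[OF bounded_linear_to_vec])
    then show ?thesis by (rule has_derivative_at_withinI)
  qed
  have injg: "inj_on ?g ?S"
  proof (rule inj_onI)
    fix x y assume x: "x \<in> ?S" and y: "y \<in> ?S" and "?g x = ?g y"
    then have fe: "f (?P x) = f (?P y)" by (metis of_to_vec)
    have "?P x = ?P y"
      using inj_onD[OF inj fe] x y ab by (auto simp: memS dist_polar)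
    then have "(x$1, x$2) = (y$1,y$2)"
      using inj_onD[OF polar_inj[of c], of "(x$1,x$2)" "(y$1,y$2)"] x y ab
      by (auto simp: memS)
    then show "x = y" by (auto simp: vec_eq_iff forall_2)
  qed
  have det: "\<bar>det (matrix (?g' x))\<bar> = x$1 * ?J (?P x)" if "x \<in> ?S" for x
  proof -
    have ax: "(axis 1 1 :: real^2) $ 1 = 1" "(axis 1 1 :: real^2) $ 2 = 0" "(axis 2 1 :: real^2) $ 1 = 0" "(axis 2 1 :: real^2) $ 2 = 1"
      by (auto simp: axis_def)
    let ?A = "A (?P x)" and ?B = "B (?P x)" and ?c = "cos (x$2)" and ?s = "sin (x$2)"
    have "det (matrix (?g' x)) = x$1 * ((Re ?A)\<^sup>2 + (Im ?A)\<^sup>2 - ((Re ?B)\<^sup>2 + (Im ?B)\<^sup>2)) * (?c\<^sup>2 + ?s\<^sup>2)"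
      unfolding det_2 matrix_def
      by (simp add: ax del: sin_cos_squared_add sin_cos_squared_add2 sin_cos_squared_add3)
         (simp add: algebra_simps power2_eq_square del: sin_cos_squared_add sin_cos_squared_add2 sin_cos_squared_add3)
    then have "det (matrix (?g' x)) = x$1 * ((norm ?A)\<^sup>2 - (norm ?B)\<^sup>2)"
      by (simp add: cmod_power2)
    then show ?thesis using that ab by (simp add: memS abs_mult)
  qed
  have contf: "continuous_on U f" by (rule C1_wirtinger_cont[OF f])
  have contG: "continuous_on (cbox (a,0) (b,2*pi)) (\<lambda>(x,y). ?G x y)"
  proof -
    let ?X = "cbox (a,0) (b,2*pi)"
    have cP: "continuous_on ?X (\<lambda>p. c + of_real (fst p) * cis (snd p))"
      unfolding cis_conv_exp by (intro continuous_intros)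
    have im: "(\<lambda>p. c + of_real (fst p) * cis (snd p)) ` ?X \<subseteq> {z. a \<le> dist c z \<and> dist c z \<le> b}"
      using ab by (auto simp: dist_polar)
    have imU: "(\<lambda>p. c + of_real (fst p) * cis (snd p)) ` ?X \<subseteq> U"
      using im sub by blast
    have "continuous_on ?X (\<lambda>p. f (c + of_real (fst p) * cis (snd p)))"
      by (rule continuous_on_compose2[OF contf cP imU])
    then have cw: "continuous_on ?X (\<lambda>p. w (f (c + of_real (fst p) * cis (snd p))))"
      using continuous_on_compose2[OF w, of ?X "\<lambda>p. f (c + of_real (fst p) * cis (snd p))"] im by blast
    show ?thesis
      unfolding case_prod_beta
      by (intro continuous_intros cw continuous_on_compose2[OF contA cP imU] continuous_on_compose2[OF contB cP imU])
  qed
  let ?V = "integral {a..b} (\<lambda>\<rho>. integral {0..2*pi} (\<lambda>\<theta>. ?G \<rho> \<theta>))"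
  have hi: "((\<lambda>v::real^2. ?G (v$1) (v$2)) has_integral ?V) ?C"
    by (rule integral_rectangle_vec[OF contG])
  have contGv: "continuous_on ?C (\<lambda>v::real^2. ?G (v$1) (v$2))"
  proof -
    have "continuous_on ?C (\<lambda>v::real^2. (v$1,v$2))" by (intro continuous_intros)
    moreover have "(\<lambda>v::real^2. (v$1,v$2)) ` ?C \<subseteq> cbox (a,0) (b,2*pi)" by (auto simp: memC)
    ultimately show ?thesis using continuous_on_compose2[OF contG] by fastforce
  qed
  have ai: "(\<lambda>v::real^2. ?G (v$1) (v$2)) absolutely_integrable_on ?C"
    by (rule absolutely_integrable_continuous[OF contGv])
  have ng: "negligible (?C - ?S)" by (simp add: negligible_frontier_interval)
  have aiS: "(\<lambda>v::real^2. ?G (v$1) (v$2)) absolutely_integrable_on ?S"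
    using ai by (rule set_integrable_subset) (auto simp: box_subset_cbox)
  have hiS: "integral ?S (\<lambda>v::real^2. ?G (v$1) (v$2)) = ?V"
    using hi by (simp add: has_integral_iff integral_open_interval)
  \<comment> \<open>The substitution rule is stated for vector-valued integrands, so w is read as a map into \<open>real^1\<close>.\<close>
  let ?l = "vec :: real \<Rightarrow> real^1"
  let ?D = "\<lambda>x. \<bar>det (matrix (?g' x))\<bar> *\<^sub>R ?l (w (of_vec (?g x)))"
  have Deq: "?D x = ?l (?G (x$1) (x$2))" if "x \<in> ?S" for x
    using det[OF that] by (simp add: vec_eq_iff)
  have bl: "bounded_linear ?l" by (rule linear_conv_bounded_linear[THEN iffD1]) (auto intro!: linearI simp: vec_eq_iff)
  have "(\<lambda>x::real^2. ?l (?G (x$1) (x$2))) absolutely_integrable_on ?S"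
    using absolutely_integrable_linear[OF aiS bl] by (simp add: o_def)
  then have Dai: "?D absolutely_integrable_on ?S"
    by (rule set_integrable_cong[THEN iffD2, rotated -1]) (use Deq in auto)
  have Dint: "integral ?S ?D = ?l ?V"
  proof -
    have "integral ?S ?D = integral ?S (\<lambda>x::real^2. ?l (?G (x$1) (x$2)))"
      by (rule integral_cong) (use Deq in auto)
    also have "\<dots> = ?l (integral ?S (\<lambda>x::real^2. ?G (x$1) (x$2)))"
      using integral_linear[OF set_lebesgue_integral_eq_integral(1)[OF aiS] bl] by (simp add: o_def)
    finally show ?thesis using hiS by simp
  qed
  have S: "?S \<in> sets lebesgue" by simp
  have main: "(\<lambda>v. ?l (w (of_vec v))) absolutely_integrable_on ?g ` ?S \<and> integral (?g ` ?S) (\<lambda>v. ?l (w (of_vec v))) = ?l ?V"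
    using has_absolute_integral_change_of_variables[OF S derg injg, of "\<lambda>v. ?l (w (of_vec v))" "?l ?V"] Dai Dint
    by blast
  have bl1: "bounded_linear (\<lambda>v::real^1. v$1)" by (rule bounded_linear_vec_nth)
  show "(\<lambda>v. w (of_vec v)) absolutely_integrable_on (to_vec ` f ` slit_annulus c a b)"
    using absolutely_integrable_linear[OF conjunct1[OF main] bl1] by (simp add: o_def image)
  show "integral (to_vec ` f ` slit_annulus c a b) (\<lambda>v. w (of_vec v)) = ?V"
    using integral_linear[OF set_lebesgue_integral_eq_integral(1)[OF conjunct1[OF main]] bl1] conjunct2[OF main] by (simp add: o_def image)
qed

text \<open>
  The integral of the Jacobian is the area of the image, because f is injective.
\<close>

lemma polar_area_le:
  assumes ab: "0 < a" "a < b" and f: "C1_wirtinger f A B U"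
    and sub: "\<And>z. a \<le> dist c z \<Longrightarrow> dist c z \<le> b \<Longrightarrow> z \<in> U"
    and inj: "inj_on f {z. a < dist c z \<and> dist c z < b}"
    and M: "\<And>z. a < dist c z \<Longrightarrow> dist c z < b \<Longrightarrow> f z \<in> ball w0 M"
  shows "integral {a..b} (\<lambda>\<rho>. integral {0..2*pi} (\<lambda>\<theta>. \<rho> *
         \<bar>(norm (A (polar c \<rho> \<theta>)))^2 - (norm (B (polar c \<rho> \<theta>)))^2\<bar>))
         \<le> pi * M\<^sup>2"
proof -
  let ?E = "to_vec ` f ` slit_annulus c a b"
  note dist_polar[of c]
  then have slit: "a < dist c z" "dist c z < b" if "z \<in> slit_annulus c a b" for z
    using that ab by (auto simp: slit_annulus_def)
  have EM: "?E \<subseteq> ball (to_vec w0) M"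
    using M slit unfolding to_vec_ball[symmetric] by blast
  obtain t where "a < t" "t < b" using dense[OF ab(2)] by blast
  with ab have "a < dist c (c + of_real t)" "dist c (c + of_real t) < b" by (auto simp: dist_norm)
  from M[OF this] have "M > 0" by (metis mem_ball zero_le_dist le_less_trans)
  note 1 = polar_change_of_variables[OF ab f sub inj, where w="\<lambda>_. 1", simplified]
  have "integral ?E (\<lambda>v. 1::real) \<le> integral (ball (to_vec w0) M) (\<lambda>v. 1)"
  proof (rule integral_subset_le[OF EM])
    show "(\<lambda>v. 1::real) integrable_on ?E"
      using 1(1) set_lebesgue_integral_eq_integral(1) by blast
    show "(\<lambda>v. 1::real) integrable_on ball (to_vec w0) M"
      by (intro integrable_on_const) (simp add: lmeasurable_ball)
  qed auto
  also have "\<dots> = pi * M\<^sup>2"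
    using \<open>M > 0\<close> by (simp add: lmeasure_integral[symmetric] lmeasurable_ball measure_completion content_ball unit_ball_vol_2)
  finally show ?thesis using 1(2) by simp
qed

text \<open>
  Polar coordinates for the identity map; the inner radius \<open>a\<close> keeps the density continuous when
  \<open>p < 2\<close>.
\<close>

lemma integral_powr_disc:
  fixes p :: real
  assumes "0 < a" "a < b" "p > 0"
  shows "(\<lambda>v. norm (of_vec v) powr (p - 2)) absolutely_integrable_on (to_vec ` slit_annulus 0 a b)"
    and "integral (to_vec ` slit_annulus 0 a b) (\<lambda>v. norm (of_vec v) powr (p - 2)) \<le> 2 * pi * b powr p / p"
proof -
  have C: "C1_wirtinger (\<lambda>z. z) (\<lambda>z. 1) (\<lambda>z. 0) UNIV"
    by (auto simp: C1_wirtinger_def intro!: derivative_eq_intros)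
  have cont: "continuous_on ((\<lambda>z. z) ` {z. a \<le> dist 0 z \<and> dist 0 z \<le> b}) (\<lambda>z::complex. norm z powr (p - 2))"
    using assms by (intro continuous_intros) auto
  note 1 = polar_change_of_variables[OF assms(1,2) C _ _ cont, simplified]
  show "(\<lambda>v. norm (of_vec v) powr (p - 2)) absolutely_integrable_on (to_vec ` slit_annulus 0 a b)"
    using 1(1) .
  have "((\<lambda>\<rho>. \<rho> powr (p - 1)) has_integral (b powr p / p - a powr p / p)) {a..b}"
  proof (rule fundamental_theorem_of_calculus)
    show "((\<lambda>\<rho>. \<rho> powr p / p) has_vector_derivative x powr (p - 1)) (at x within {a..b})" if "x \<in> {a..b}" for x
      using that assms
      by (auto intro!: derivative_eq_intros simp: has_real_derivative_iff_has_vector_derivative[symmetric])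
  qed (use assms in auto)
  then have "((\<lambda>\<rho>. 2 * pi * (\<rho> powr (p - 1))) has_integral 2 * pi * (b powr p / p - a powr p / p)) {a..b}"
    by (rule has_integral_mult_right)
  moreover have "2 * pi * \<rho> powr (p - 1) = 2 * pi * \<rho> * \<bar>\<rho>\<bar> powr (p - 2)" if "\<rho> \<in> {a..b}" for \<rho>
  proof -
    have "\<rho> powr (p - 1) = \<rho> powr (1 + (p - 2))" by simp
    also have "\<dots> = \<rho> * \<rho> powr (p - 2)" using that assms by (subst powr_add) auto
    finally show ?thesis using that assms by simp
  qed
  ultimately have "((\<lambda>\<rho>. 2 * pi * \<rho> * \<bar>\<rho>\<bar> powr (p - 2)) has_integral 2 * pi * (b powr p / p - a powr p / p)) {a..b}"
    by (rule has_integral_eq[rotated])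
  then have "integral {a..b} (\<lambda>\<rho>. 2 * pi * \<rho> * \<bar>\<rho>\<bar> powr (p - 2)) = 2 * pi * (b powr p / p - a powr p / p)"
    by (rule integral_unique)
  also have "\<dots> \<le> 2 * pi * b powr p / p"
    using assms by (simp add: field_simps)
  finally show "integral (to_vec ` slit_annulus 0 a b) (\<lambda>v. norm (of_vec v) powr (p - 2)) \<le> 2 * pi * b powr p / p"
    using 1(2) by (simp add: norm_mult mult_ac)
qed

text \<open>
  Up to points of the real axis, a null set, the slit annulus is the whole annulus.
\<close>

lemma punctured_disc_minus_slit:
  assumes "0 \<le> m" "m < norm w" "norm w < M" "Im w \<noteq> 0"
  shows "w \<in> slit_annulus 0 m M"
proof -
  have "w = 0 + of_real (norm w) * cis (Arg2pi w)"
    by (simp add: cis_conv_exp Arg2pi_eq[symmetric])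
  moreover have "Arg2pi w \<noteq> 0" using assms(4) Arg2pi_eq_0[of w] by (auto simp: complex_is_Real_iff)
  ultimately show ?thesis
    using assms Arg2pi_ge_0[of w] Arg2pi_lt_2pi[of w]
    unfolding slit_annulus_def
    by (intro image_eqI[where x="(norm w, Arg2pi w)"]) auto
qed

text \<open>
  The image plane carries the density \<open>|w|^(p-2)\<close>, which is integrable at 0 for every positive p and
  gives the disc of radius M the mass \<open>2 pi M^p / p\<close>.
\<close>

lemma polar_weighted_area_le:
  fixes p :: real
  assumes ab: "0 < a" "a < b" and f: "C1_wirtinger f A B U"
    and sub: "\<And>z. a \<le> dist c z \<Longrightarrow> dist c z \<le> b \<Longrightarrow> z \<in> U"
    and inj: "inj_on f {z. a < dist c z \<and> dist c z < b}"
    and nz: "\<And>z. a \<le> dist c z \<Longrightarrow> dist c z \<le> b \<Longrightarrow> f z \<noteq> 0"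
    and M: "\<And>z. a \<le> dist c z \<Longrightarrow> dist c z \<le> b \<Longrightarrow> norm (f z) < M"
    and p: "p > 0"
  shows "integral {a..b} (\<lambda>\<rho>. integral {0..2*pi} (\<lambda>\<theta>. \<rho> *
         \<bar>(norm (A (polar c \<rho> \<theta>)))^2 - (norm (B (polar c \<rho> \<theta>)))^2\<bar> *
         norm (f (polar c \<rho> \<theta>)) powr (p - 2)))
         \<le> 2 * pi * M powr p / p"
proof -
  let ?X = "{z. a \<le> dist c z \<and> dist c z \<le> b}"
  have X: "?X = cball c b - ball c a" by auto
  have "compact ?X" unfolding X by (rule compact_diff) auto
  moreover have cf: "continuous_on ?X f"
    by (rule continuous_on_subset[OF C1_wirtinger_cont[OF f]]) (use sub in auto)
  moreover have c: "c + of_real a \<in> ?X" using ab by (auto simp: dist_norm)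
  then have "?X \<noteq> {}" by blast
  moreover have "continuous_on ?X (\<lambda>z. norm (f z))" using cf by (rule continuous_on_norm)
  ultimately have "\<exists>z0\<in>?X. \<forall>z\<in>?X. norm (f z0) \<le> norm (f z)"
    by (intro continuous_attains_inf)
  then obtain z0 where z0: "z0 \<in> ?X" "\<And>z. z \<in> ?X \<Longrightarrow> norm (f z0) \<le> norm (f z)"
    by metis
  define m where "m = norm (f z0) / 2"
  have m0: "0 < m" using nz z0(1) by (auto simp: m_def)
  have m: "m < norm (f z)" if "z \<in> ?X" for z
    using z0(2)[OF that] m0 unfolding m_def by linarith
  have mM: "m < M" using m[OF c] M[of "c + of_real a"] c by simp
  let ?w = "\<lambda>w. norm w powr (p - 2)"
  have cont: "continuous_on (f ` ?X) ?w"
    using nz by (intro continuous_intros) auto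
  note 1 = polar_change_of_variables[OF ab f sub inj cont]
  note 2 = integral_powr_disc[OF m0 mM p]
  let ?E = "to_vec ` f ` slit_annulus c a b" and ?N = "{v::real^2. v$2 = 0}"
  have negN: "negligible ?N" by (rule negligible_standard_hyperplane_cart)
  note dist_polar[of c]
  then have slit: "z \<in> ?X" if "z \<in> slit_annulus c a b" for z
    using that ab by (auto simp: slit_annulus_def)
  have "integral ?E (\<lambda>v. ?w (of_vec v)) = integral (?E - ?N) (\<lambda>v. ?w (of_vec v))"
  proof (rule integral_spike_set)
    show "negligible {x \<in> ?E - (?E - ?N). ?w (of_vec x) \<noteq> 0}" by (rule negligible_subset[OF negN]) auto
    show "negligible {x \<in> ?E - ?N - ?E. ?w (of_vec x) \<noteq> 0}" by (rule negligible_subset[OF negN]) auto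
  qed
  also have "\<dots> \<le> integral (to_vec ` slit_annulus 0 m M) (\<lambda>v. ?w (of_vec v))"
  proof (rule integral_subset_le)
    show "?E - ?N \<subseteq> to_vec ` slit_annulus 0 m M"
    proof
      fix v assume "v \<in> ?E - ?N"
      then obtain z where z: "z \<in> slit_annulus c a b" and v: "v = to_vec (f z)" and nz: "Im (f z) \<noteq> 0"
        by auto
      have "f z \<in> slit_annulus 0 m M"
        using slit[OF z] m[of z] M[of z] m0 nz by (intro punctured_disc_minus_slit) auto
      then show "v \<in> to_vec ` slit_annulus 0 m M" unfolding v by (rule imageI)
    qed
    show "(\<lambda>v. ?w (of_vec v)) integrable_on ?E - ?N"
      using set_lebesgue_integral_eq_integral(1)[OF 1(1)]
    proof (rule integrable_spike_set)
      show "negligible {x \<in> ?E - (?E - ?N). ?w (of_vec x) \<noteq> 0}" by (rule negligible_subset[OF negN]) auto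
      show "negligible {x \<in> ?E - ?N - ?E. ?w (of_vec x) \<noteq> 0}" by (rule negligible_subset[OF negN]) auto
    qed
    show "(\<lambda>v. ?w (of_vec v)) integrable_on to_vec ` slit_annulus 0 m M"
      using set_lebesgue_integral_eq_integral(1)[OF 2(1)] .
  qed auto
  also note 2(2)
  finally show ?thesis by (simp only: 1(2))
qed

section \<open>Quasiconformal maps and the length-area method\<close>

text \<open>
  The Cauchy-Schwarz inequality against the constant 1, from the nonnegativity of the variance.
\<close>

lemma integral_square_le:
  fixes u :: "real \<Rightarrow> real"
  assumes "a < b" and u: "continuous_on {a..b} u"
  shows "(integral {a..b} u)\<^sup>2 \<le> (b - a) * integral {a..b} (\<lambda>t. (u t)\<^sup>2)"
proof -
  define m where "m = integral {a..b} u / (b - a)"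
  have u1: "u integrable_on {a..b}" using u by (rule integrable_continuous_interval)
  have u2: "(\<lambda>t. (u t)\<^sup>2) integrable_on {a..b}" by (intro integrable_continuous_interval continuous_intros u)
  have "0 \<le> integral {a..b} (\<lambda>t. (u t - m)\<^sup>2)"
    by (rule integral_nonneg) (auto intro!: integrable_continuous_interval continuous_intros u)
  also have "(\<lambda>t. (u t - m)\<^sup>2) = (\<lambda>t. (u t)\<^sup>2 - 2 * m * u t + m\<^sup>2)"
    by (auto simp: power2_eq_square algebra_simps)
  also have "integral {a..b} (\<lambda>t. (u t)\<^sup>2 - 2 * m * u t + m\<^sup>2) =
     integral {a..b} (\<lambda>t. (u t)\<^sup>2) - 2 * m * integral {a..b} u + (b - a) * m\<^sup>2"
  proof -
    have 1: "(\<lambda>t. 2 * m * u t) integrable_on {a..b}" using u1 by (rule integrable_on_mult_right)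
    show ?thesis
      using integral_add[OF integrable_diff[OF u2 1] integrable_const_ivl[of "m\<^sup>2" a b]] integral_diff[OF u2 1] \<open>a < b\<close>
      by simp
  qed
  also have "\<dots> = integral {a..b} (\<lambda>t. (u t)\<^sup>2) - (integral {a..b} u)\<^sup>2 / (b - a)"
  proof -
    have mD: "(b - a) * m = integral {a..b} u" using \<open>a < b\<close> by (simp add: m_def)
    have "(b - a) * m\<^sup>2 = m * integral {a..b} u" by (simp add: mD[symmetric] power2_eq_square)
    moreover have "(integral {a..b} u)\<^sup>2 / (b - a) = m * integral {a..b} u" by (simp add: m_def power2_eq_square)
    ultimately show ?thesis by simp
  qed
  finally show ?thesis using \<open>a < b\<close> by (simp add: field_simps)
qed

text \<open>
  A tangent vector is stretched at most by the operator norm \<open>|A| + |B|\<close>.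
\<close>

lemma C1_wirtinger_path_le:
  assumes f: "C1_wirtinger f A B U" and ab: "a \<le> b"
    and U: "\<And>t. t \<in> {a..b} \<Longrightarrow> \<gamma> t \<in> U"
    and \<gamma>: "\<And>t. t \<in> {a..b} \<Longrightarrow> (\<gamma> has_vector_derivative \<gamma>' t) (at t within {a..b})"
    and \<gamma>': "continuous_on {a..b} \<gamma>'"
  shows "norm (f (\<gamma> b) - f (\<gamma> a)) \<le> integral {a..b} (\<lambda>t. (norm (A (\<gamma> t)) + norm (B (\<gamma> t))) * norm (\<gamma>' t))"
proof -
  let ?d = "\<lambda>t. A (\<gamma> t) * \<gamma>' t + B (\<gamma> t) * cnj (\<gamma>' t)"
  have cA: "continuous_on U A" and cB: "continuous_on U B"
    and derf: "\<And>z. z \<in> U \<Longrightarrow> (f has_derivative (\<lambda>v. A z * v + B z * cnj v)) (at z)"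
    using f by (auto simp: C1_wirtinger_def)
  have c\<gamma>: "continuous_on {a..b} \<gamma>"
    using \<gamma> by (meson continuous_on_eq_continuous_within has_vector_derivative_continuous)
  have im: "\<gamma> ` {a..b} \<subseteq> U" using U by auto
  note cs = continuous_on_compose2[OF cA c\<gamma> im] continuous_on_compose2[OF cB c\<gamma> im]
  have "((\<lambda>t. f (\<gamma> t)) has_vector_derivative ?d t) (at t within {a..b})" if "t \<in> {a..b}" for t
    using has_derivative_compose[OF \<gamma>[OF that, unfolded has_vector_derivative_def] derf[OF U[OF that]]]
    by (simp add: has_vector_derivative_def algebra_simps scaleR_conv_of_real)
  then have "(?d has_integral (f (\<gamma> b) - f (\<gamma> a))) {a..b}"
    by (intro fundamental_theorem_of_calculus ab)
  then have "norm (f (\<gamma> b) - f (\<gamma> a)) = norm (integral {a..b} ?d)" by (simp add: integral_unique)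
  also have "\<dots> \<le> integral {a..b} (\<lambda>t. (norm (A (\<gamma> t)) + norm (B (\<gamma> t))) * norm (\<gamma>' t))"
  proof (rule integral_norm_bound_integral)
    show "?d integrable_on {a..b}"
      by (intro integrable_continuous_interval continuous_intros cs \<gamma>')
    show "(\<lambda>t. (norm (A (\<gamma> t)) + norm (B (\<gamma> t))) * norm (\<gamma>' t)) integrable_on {a..b}"
      by (intro integrable_continuous_interval continuous_intros cs \<gamma>')
    show "norm (?d t) \<le> (norm (A (\<gamma> t)) + norm (B (\<gamma> t))) * norm (\<gamma>' t)" for t
      using norm_triangle_ineq[of "A (\<gamma> t) * \<gamma>' t" "B (\<gamma> t) * cnj (\<gamma>' t)"]
      by (simp add: norm_mult algebra_simps)
  qed
  finally show ?thesis .
qed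

lemma continuous_on_polar:
  assumes "continuous_on {z. a \<le> dist c z \<and> dist c z \<le> b} H" "0 \<le> a"
  shows "continuous_on ({a..b} \<times> T) (\<lambda>(\<rho>,\<theta>). H (polar c \<rho> \<theta>))"
proof -
  note dist_polar[of c]
  then have im: "(\<lambda>p. c + of_real (fst p) * cis (snd p)) ` ({a..b} \<times> T) \<subseteq> {z. a \<le> dist c z \<and> dist c z \<le> b}"
    using assms(2) by auto
  have "continuous_on ({a..b} \<times> T) (\<lambda>p. c + of_real (fst p) * cis (snd p))"
    unfolding cis_conv_exp by (intro continuous_intros)
  from continuous_on_compose2[OF assms(1) this im] show ?thesis by (simp add: case_prod_beta)
qed

lemma continuous_on_circle:
  assumes H: "continuous_on {z. a \<le> dist c z \<and> dist c z \<le> b} H" and a: "0 \<le> a" and \<rho>: "\<rho> \<in> {a..b}"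
  shows "continuous_on T (\<lambda>\<theta>. H (polar c \<rho> \<theta>))"
proof -
  have "continuous_on T (\<lambda>\<theta>. (\<rho>, \<theta>))" by (intro continuous_on_Pair continuous_on_const continuous_on_id)
  moreover have "(\<lambda>\<theta>. (\<rho>, \<theta>)) ` T \<subseteq> {a..b} \<times> T" using \<rho> by auto
  ultimately show ?thesis using continuous_on_compose2[OF continuous_on_polar[OF H a, of T]] by fastforce
qed

lemma continuous_on_circle_integral:
  fixes H :: "complex \<Rightarrow> real"
  assumes H: "continuous_on {z. a \<le> dist c z \<and> dist c z \<le> b} H" and a: "0 \<le> a"
  shows "continuous_on {a..b} (\<lambda>\<rho>. integral {0..2*pi} (\<lambda>\<theta>. H (polar c \<rho> \<theta>)))"
  using integral_continuous_on_param[of "{a..b}" 0 "2*pi" "\<lambda>\<rho> \<theta>. H (polar c \<rho> \<theta>)"]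
    continuous_on_polar[OF H a, of "{0..2*pi}"] by (simp add: cbox_interval)

lemma polar_integral_mono:
  fixes F G :: "complex \<Rightarrow> real"
  assumes F: "continuous_on {z. a \<le> dist c z \<and> dist c z \<le> b} F"
    and G: "continuous_on {z. a \<le> dist c z \<and> dist c z \<le> b} G" and a: "0 \<le> a"
    and le: "\<And>z. a \<le> dist c z \<Longrightarrow> dist c z \<le> b \<Longrightarrow> F z \<le> G z"
  shows "integral {a..b} (\<lambda>\<rho>. \<rho> * integral {0..2*pi} (\<lambda>\<theta>. F (polar c \<rho> \<theta>))) \<le>
         integral {a..b} (\<lambda>\<rho>. \<rho> * integral {0..2*pi} (\<lambda>\<theta>. G (polar c \<rho> \<theta>)))"
proof (rule integral_le)
  fix \<rho> assume \<rho>: "\<rho> \<in> {a..b}"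
  note dist_polar[of c]
  then show "\<rho> * integral {0..2*pi} (\<lambda>\<theta>. F (polar c \<rho> \<theta>)) \<le> \<rho> * integral {0..2*pi} (\<lambda>\<theta>. G (polar c \<rho> \<theta>))"
    using \<rho> a
    by (intro mult_left_mono integral_le integrable_continuous_interval continuous_on_circle[OF F a \<rho>] continuous_on_circle[OF G a \<rho>] le) auto
qed (intro integrable_continuous_interval continuous_intros continuous_on_circle_integral F G a)+

lemma integral_mult_left_commute:
  fixes g :: "real \<Rightarrow> real"
  shows "integral S (\<lambda>x. x * (K * g x)) = K * integral S (\<lambda>x. x * g x)"
  using integral_mult_right[of S K "\<lambda>x. x * g x"] by (simp only: mult.left_commute)

text \<open>
  The inequality \<open>|B| < |A|\<close> says that f preserves the orientation; the last condition bounds the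
  square of the operator norm of the derivative by K times the Jacobian.
\<close>

definition qc_map :: "real \<Rightarrow> (complex \<Rightarrow> complex) \<Rightarrow> (complex \<Rightarrow> complex) \<Rightarrow> (complex \<Rightarrow> complex) \<Rightarrow> complex set \<Rightarrow> bool" where
  "qc_map K f A B U \<longleftrightarrow> C1_wirtinger f A B U \<and> inj_on f U \<and>
     (\<forall>z\<in>U. norm (B z) < norm (A z) \<and>
        (norm (A z) + norm (B z))^2 \<le> K * ((norm (A z))^2 - (norm (B z))^2))"

lemma qc_map_stretching_le:
  assumes f: "qc_map K f A B U" and z: "z \<in> U" and K: "K \<ge> 0"
  shows "(norm (A z) + norm (B z))^2 \<le> K * \<bar>(norm (A z))^2 - (norm (B z))^2\<bar>"
proof -
  have "(norm (A z) + norm (B z))^2 \<le> K * ((norm (A z))^2 - (norm (B z))^2)"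
    using f z unfolding qc_map_def by blast
  also have "\<dots> \<le> K * \<bar>(norm (A z))^2 - (norm (B z))^2\<bar>" using K by (intro mult_left_mono) auto
  finally show ?thesis .
qed

lemma qc_map_polar_area_le:
  assumes ab: "0 < a" "a < b" and f: "qc_map K f A B U"
    and sub: "\<And>z. a \<le> dist c z \<Longrightarrow> dist c z \<le> b \<Longrightarrow> z \<in> U"
    and M: "\<And>z. a < dist c z \<Longrightarrow> dist c z < b \<Longrightarrow> f z \<in> ball w0 M" and K: "K \<ge> 0"
  shows "integral {a..b} (\<lambda>\<rho>. \<rho> * integral {0..2*pi} (\<lambda>\<theta>.
         (norm (A (polar c \<rho> \<theta>)) + norm (B (polar c \<rho> \<theta>)))^2)) \<le> K * (pi * M\<^sup>2)"
proof -
  let ?X = "{z. a \<le> dist c z \<and> dist c z \<le> b}"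
  let ?J = "\<lambda>z. \<bar>(norm (A z))^2 - (norm (B z))^2\<bar>"
  have C: "C1_wirtinger f A B U" and inj: "inj_on f U" using f by (auto simp: qc_map_def)
  note qc = qc_map_stretching_le[OF f _ K]
  have XU: "?X \<subseteq> U" using sub by auto
  have cA: "continuous_on ?X A" and cB: "continuous_on ?X B"
    using C XU unfolding C1_wirtinger_def by (meson continuous_on_subset)+
  have "integral {a..b} (\<lambda>\<rho>. \<rho> * integral {0..2*pi} (\<lambda>\<theta>.
         (norm (A (polar c \<rho> \<theta>)) + norm (B (polar c \<rho> \<theta>)))^2)) \<le>
       integral {a..b} (\<lambda>\<rho>. \<rho> * integral {0..2*pi} (\<lambda>\<theta>. K * ?J (polar c \<rho> \<theta>)))"
    using ab sub by (intro polar_integral_mono continuous_intros cA cB qc) auto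
  also have "\<dots> = K * integral {a..b} (\<lambda>\<rho>. integral {0..2*pi} (\<lambda>\<theta>. \<rho> * ?J (polar c \<rho> \<theta>)))"
    by (simp add: integral_mult_left_commute mult.assoc)
  also have "\<dots> \<le> K * (pi * M\<^sup>2)"
  proof (intro mult_left_mono polar_area_le[where U=U and ?w0.0=w0] ab C sub M K)
    show "inj_on f {z. a < dist c z \<and> dist c z < b}"
      by (rule inj_on_subset[OF inj]) (use sub in auto)
  qed (use C M in auto)
  finally show ?thesis .
qed

lemma qc_map_polar_weighted_area_le:
  fixes p :: real
  assumes ab: "0 < a" "a < b" and f: "qc_map K f A B U"
    and sub: "\<And>z. a \<le> dist c z \<Longrightarrow> dist c z \<le> b \<Longrightarrow> z \<in> U"
    and nz: "\<And>z. a \<le> dist c z \<Longrightarrow> dist c z \<le> b \<Longrightarrow> f z \<noteq> 0"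
    and M: "\<And>z. a \<le> dist c z \<Longrightarrow> dist c z \<le> b \<Longrightarrow> norm (f z) < M"
    and p: "p > 0" and K: "K \<ge> 0"
  shows "integral {a..b} (\<lambda>\<rho>. \<rho> * integral {0..2*pi} (\<lambda>\<theta>.
         (norm (A (polar c \<rho> \<theta>)) + norm (B (polar c \<rho> \<theta>)))^2 *
         norm (f (polar c \<rho> \<theta>)) powr (p - 2))) \<le> K * (2 * pi * M powr p / p)"
proof -
  let ?X = "{z. a \<le> dist c z \<and> dist c z \<le> b}"
  let ?J = "\<lambda>z. \<bar>(norm (A z))^2 - (norm (B z))^2\<bar>"
  have C: "C1_wirtinger f A B U" and inj: "inj_on f U" using f by (auto simp: qc_map_def)
  note qc = qc_map_stretching_le[OF f _ K]
  have XU: "?X \<subseteq> U" using sub by auto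
  have cA: "continuous_on ?X A" and cB: "continuous_on ?X B"
    using C XU unfolding C1_wirtinger_def by (meson continuous_on_subset)+
  have cf: "continuous_on ?X f" by (rule continuous_on_subset[OF C1_wirtinger_cont[OF C] XU])
  have cw: "continuous_on ?X (\<lambda>z. norm (f z) powr (p - 2))"
    using nz by (intro continuous_intros cf) auto
  have "integral {a..b} (\<lambda>\<rho>. \<rho> * integral {0..2*pi} (\<lambda>\<theta>.
         (norm (A (polar c \<rho> \<theta>)) + norm (B (polar c \<rho> \<theta>)))^2 *
         norm (f (polar c \<rho> \<theta>)) powr (p - 2))) \<le>
       integral {a..b} (\<lambda>\<rho>. \<rho> * integral {0..2*pi} (\<lambda>\<theta>. K * ?J (polar c \<rho> \<theta>) *
         norm (f (polar c \<rho> \<theta>)) powr (p - 2)))"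
    using ab sub by (intro polar_integral_mono continuous_intros cA cB cw mult_right_mono qc) auto
  also have "\<dots> = K * integral {a..b} (\<lambda>\<rho>. integral {0..2*pi} (\<lambda>\<theta>. \<rho> * ?J (polar c \<rho> \<theta>) *
         norm (f (polar c \<rho> \<theta>)) powr (p - 2)))"
    by (simp add: integral_mult_left_commute mult.assoc)
  also have "\<dots> \<le> K * (2 * pi * M powr p / p)"
  proof (intro mult_left_mono polar_weighted_area_le[where U=U] ab C sub nz M p K)
    show "inj_on f {z. a < dist c z \<and> dist c z < b}"
      by (rule inj_on_subset[OF inj]) (use sub in auto)
  qed
  finally show ?thesis .
qed

text \<open>
  By invariance of domain f is open on the ball, so the image of an interior point is never farthest
  from w.
\<close>

lemma inj_maximum_principle:
  fixes f :: "complex \<Rightarrow> complex"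
  assumes cf: "continuous_on (cball c r) f" and inj: "inj_on f (ball c r)"
    and bd: "\<And>z. dist c z = r \<Longrightarrow> dist w (f z) \<le> \<eta>" and z: "z \<in> cball c r"
  shows "dist w (f z) \<le> \<eta>"
proof -
  have "\<exists>z0\<in>cball c r. \<forall>z\<in>cball c r. dist w (f z) \<le> dist w (f z0)"
    using ex_in_conv[THEN iffD1, OF exI, OF z] by (intro continuous_attains_sup continuous_intros cf compact_cball)
  then obtain z0 where z0: "z0 \<in> cball c r" "\<And>z. z\<in>cball c r \<Longrightarrow> dist w (f z) \<le> dist w (f z0)"
    by metis
  have "z0 \<notin> ball c r"
  proof
    assume b: "z0 \<in> ball c r"
    have "open (f ` ball c r)"
      by (intro invariance_of_domain inj continuous_on_subset[OF cf]) auto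
    then obtain e where e: "e > 0" "ball (f z0) e \<subseteq> f ` ball c r"
      using b by (metis image_eqI openE)
    define d where "d = (if f z0 = w then 1 else sgn (f z0 - w))"
    have d: "norm d = 1" by (auto simp: d_def norm_sgn)
    have "f z0 + of_real (e/2) * d \<in> ball (f z0) e" using e d by (simp add: dist_norm norm_mult)
    then obtain y where y: "y \<in> ball c r" "f y = f z0 + of_real (e/2) * d" using e by (metis imageE subsetD)
    define n where "n = norm (f z0 - w)"
    have dd: "f z0 - w = of_real n * d" by (auto simp: d_def sgn_eq n_def)
    have "f y - w = (f z0 - w) + of_real (e/2) * d" using y by simp
    then have "f y - w = of_real (n + e/2) * d" unfolding dd by (simp add: algebra_simps)
    moreover have "0 \<le> n" by (simp add: n_def)
    ultimately have "dist w (f y) = norm (f z0 - w) + e/2"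
      unfolding n_def[symmetric]
      using d e by (simp add: norm_minus_commute[of w] dist_norm norm_mult del: of_real_add)
    with z0(2)[of y] y e show False by (simp add: dist_norm norm_minus_commute)
  qed
  with z0(1) have "dist w (f z0) \<le> \<eta>" by (intro bd) auto
  with z0(2)[OF z] show ?thesis by linarith
qed

text \<open>
  The length-area method. The area of the image bounds the integral of \<open>\<rho> G(\<rho>)\<close>, where \<open>G(\<rho>)\<close> is the
  integral of the squared stretching over the circle of radius \<rho>. Hence \<open>\<rho>^2 G(\<rho>)\<close> is small on some
  circle with radius between r and R. By Cauchy-Schwarz the image of this circle is short, and the
  maximum principle transfers its small diameter to the disc inside.
\<close>

lemma courant_lebesgue:
  assumes f: "qc_map K f A B U" and K: "K \<ge> 0" and U: "cball c R \<subseteq> U" and rR: "0 < r" "r < R"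
    and M: "\<And>z. z \<in> ball c R \<Longrightarrow> f z \<in> ball w0 M" and z: "dist c z \<le> r"
  shows "(dist (f c) (f z))\<^sup>2 \<le> 8 * pi\<^sup>2 * K * M\<^sup>2 / ln (R / r)"
proof -
  let ?X = "{z. r \<le> dist c z \<and> dist c z \<le> R}"
  let ?L = "\<lambda>z. norm (A z) + norm (B z)"
  define G where "G \<rho> = integral {0..2*pi} (\<lambda>\<theta>. (?L (polar c \<rho> \<theta>))\<^sup>2)" for \<rho>
  have C: "C1_wirtinger f A B U" and inj: "inj_on f U" using f by (auto simp: qc_map_def)
  have XU: "?X \<subseteq> U" using U by auto
  have cA: "continuous_on ?X A" and cB: "continuous_on ?X B"
    using C XU unfolding C1_wirtinger_def by (meson continuous_on_subset)+
  have cL: "continuous_on ?X ?L" by (intro continuous_intros cA cB)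
  have cG: "continuous_on {r..R} G"
    unfolding G_def using rR by (intro continuous_on_circle_integral continuous_intros cL) auto
  have area: "integral {r..R} (\<lambda>\<rho>. \<rho> * G \<rho>) \<le> K * (pi * M\<^sup>2)"
    unfolding G_def using rR U M by (intro qc_map_polar_area_le[OF _ _ f]) (auto intro: K)
  \<comment> \<open>The minimum m of \<open>t^2 G(t)\<close> satisfies \<open>m / t \<le> t G(t)\<close>, so \<open>m log (R / r)\<close> is at most the integral of \<open>t G(t)\<close>.\<close>
  have "\<exists>\<rho>\<in>{r..R}. \<forall>t\<in>{r..R}. \<rho>\<^sup>2 * G \<rho> \<le> t\<^sup>2 * G t"
    using rR by (intro continuous_attains_inf continuous_intros cG) auto
  then obtain \<rho> where \<rho>: "\<rho> \<in> {r..R}" and min: "\<And>t. t \<in> {r..R} \<Longrightarrow> \<rho>\<^sup>2 * G \<rho> \<le> t\<^sup>2 * G t" by metis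
  define m where "m = \<rho>\<^sup>2 * G \<rho>"
  have lnp: "ln (R / r) > 0" using rR by simp
  have "((\<lambda>t. m * (1 / t)) has_integral m * (ln R - ln r)) {r..R}"
  proof (intro has_integral_mult_right fundamental_theorem_of_calculus)
    show "(ln has_vector_derivative 1 / t) (at t within {r..R})" if "t \<in> {r..R}" for t
      using that rR by (auto intro!: derivative_eq_intros simp: has_real_derivative_iff_has_vector_derivative[symmetric])
  qed (use rR in auto)
  then have mi: "((\<lambda>t. m * (1 / t)) has_integral m * ln (R / r)) {r..R}"
    using rR by (simp add: ln_div)
  have "m * ln (R / r) \<le> integral {r..R} (\<lambda>\<rho>. \<rho> * G \<rho>)"
    unfolding integral_unique[OF mi, symmetric]
  proof (rule integral_le)
    show "(\<lambda>t. m * (1 / t)) integrable_on {r..R}" using mi by blast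
    show "(\<lambda>\<rho>. \<rho> * G \<rho>) integrable_on {r..R}"
      by (intro integrable_continuous_interval continuous_intros cG)
    show "m * (1 / t) \<le> t * G t" if "t \<in> {r..R}" for t
      using min[OF that] that rR by (simp add: m_def field_simps power2_eq_square)
  qed
  with area have m: "m * ln (R / r) \<le> K * (pi * M\<^sup>2)" by linarith
  define I where "I = integral {0..2*pi} (\<lambda>\<theta>. ?L (polar c \<rho> \<theta>) * \<rho>)"
  have ccirc: "continuous_on T (\<lambda>\<theta>. ?L (polar c \<rho> \<theta>))" for T
    using continuous_on_circle[OF cL _ \<rho>] rR by simp
  have I2: "I\<^sup>2 \<le> 2 * pi * m"
  proof -
    have "I\<^sup>2 \<le> (2*pi - 0) * integral {0..2*pi} (\<lambda>\<theta>. (?L (polar c \<rho> \<theta>) * \<rho>)\<^sup>2)"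
      unfolding I_def by (intro integral_square_le continuous_intros ccirc) auto
    also have "\<dots> = 2 * pi * m"
      unfolding m_def G_def by (simp add: power_mult_distrib mult_ac)
    finally show ?thesis .
  qed
  have I0: "0 \<le> I" unfolding I_def using \<rho> rR
    by (intro integral_nonneg integrable_continuous_interval continuous_intros ccirc) auto
  have osc: "dist (f (c + of_real \<rho>)) (f y) \<le> I" if y: "dist c y = \<rho>" for y
  proof -
    have "y - c = of_real (norm (y - c)) * cis (Arg2pi (y - c))" by (simp add: cis_conv_exp Arg2pi_eq[symmetric])
    moreover have "norm (y - c) = \<rho>" using y by (simp add: dist_norm norm_minus_commute)
    ultimately have yeq: "y = c + of_real \<rho> * cis (Arg2pi (y - c))" by (simp add: algebra_simps)
    define t where "t = Arg2pi (y - c)"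
    have t: "0 \<le> t" "t \<le> 2 * pi" using Arg2pi_ge_0 Arg2pi_lt_2pi less_imp_le unfolding t_def by blast+
    let ?\<gamma> = "\<lambda>\<theta>. polar c \<rho> \<theta>" and ?\<gamma>' = "\<lambda>\<theta>. of_real \<rho> * (\<i> * cis \<theta>)"
    have "norm (f (?\<gamma> t) - f (?\<gamma> 0)) \<le> integral {0..t} (\<lambda>\<theta>. ?L (?\<gamma> \<theta>) * norm (?\<gamma>' \<theta>))"
    proof (rule C1_wirtinger_path_le[OF C t(1)])
      show "?\<gamma> s \<in> U" for s using U \<rho> rR dist_polar[of c \<rho> s] by (intro subsetD[OF U]) auto
      show "(?\<gamma> has_vector_derivative ?\<gamma>' s) (at s within {0..t})" for s
        unfolding has_vector_derivative_def
        by (auto intro!: derivative_eq_intros simp: scaleR_conv_of_real algebra_simps)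
      show "continuous_on {0..t} ?\<gamma>'" unfolding cis_conv_exp by (intro continuous_intros)
    qed
    also have "\<dots> = integral {0..t} (\<lambda>\<theta>. ?L (?\<gamma> \<theta>) * \<rho>)"
      using \<rho> rR by (simp add: norm_mult)
    also have "\<dots> \<le> I" unfolding I_def
      using t \<rho> rR by (intro integral_subset_le integrable_continuous_interval continuous_intros ccirc) auto
    finally show ?thesis using yeq by (simp add: dist_norm norm_minus_commute t_def[symmetric])
  qed
  \<comment> \<open>The disc is compared with the point \<open>f (c + \<rho>)\<close>; passing to the centre c costs the factor 2.\<close>
  have disc: "dist (f (c + of_real \<rho>)) (f y) \<le> I" if "y \<in> cball c \<rho>" for y
  proof (rule inj_maximum_principle[OF _ _ _ that])
    have "cball c \<rho> \<subseteq> U" using U \<rho> by auto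
    then show "continuous_on (cball c \<rho>) f" "inj_on f (ball c \<rho>)"
      using C1_wirtinger_cont[OF C] inj ball_subset_cball by (meson continuous_on_subset inj_on_subset subset_trans)+
  qed (use osc in auto)
  have "dist (f c) (f z) \<le> 2 * I"
    using disc[of z] disc[of c] z \<rho> rR dist_triangle3[of "f c" "f z" "f (c + of_real \<rho>)"] by auto
  then have "(dist (f c) (f z))\<^sup>2 \<le> (2 * I)\<^sup>2" by (intro power_mono) auto
  also have "\<dots> \<le> 8 * pi * m" using I2 by (simp add: power_mult_distrib)
  also have "m \<le> K * (pi * M\<^sup>2) / ln (R / r)" using m lnp by (simp add: field_simps)
  finally show ?thesis by (simp add: power2_eq_square mult_ac)
qed

section \<open>Composition and inversion of quasiconformal maps\<close>

lemma C1_wirtinger_holomorphic_compose: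
  assumes f: "C1_wirtinger f A B U" and hol: "\<psi> holomorphic_on V" and V: "open V" "f ` U \<subseteq> V"
  shows "C1_wirtinger (\<lambda>z. \<psi> (f z)) (\<lambda>z. deriv \<psi> (f z) * A z) (\<lambda>z. deriv \<psi> (f z) * B z) U"
proof -
  have cd: "continuous_on U (\<lambda>z. deriv \<psi> (f z))"
    using continuous_on_compose2[OF holomorphic_on_imp_continuous_on[OF holomorphic_deriv[OF hol V(1)]] C1_wirtinger_cont[OF f] V(2)] .
  have "((\<lambda>z. \<psi> (f z)) has_derivative (\<lambda>v. deriv \<psi> (f z) * A z * v + deriv \<psi> (f z) * B z * cnj v)) (at z)"
    if z: "z \<in> U" for z
  proof -
    have 1: "(f has_derivative (\<lambda>v. A z * v + B z * cnj v)) (at z)" using f z by (auto simp: C1_wirtinger_def)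
    have "(\<psi> has_field_derivative deriv \<psi> (f z)) (at (f z))"
      using hol V z by (intro holomorphic_derivI) auto
    from has_derivative_compose[OF 1 this[THEN has_field_derivative_imp_has_derivative]]
    show ?thesis by (simp add: algebra_simps)
  qed
  then show ?thesis using f cd unfolding C1_wirtinger_def by (auto intro!: continuous_intros)
qed

lemma qc_map_holomorphic_compose:
  assumes f: "qc_map K f A B U" and hol: "\<psi> holomorphic_on V" and V: "open V" "f ` U \<subseteq> V" and inj: "inj_on \<psi> V"
  shows "qc_map K (\<lambda>z. \<psi> (f z)) (\<lambda>z. deriv \<psi> (f z) * A z) (\<lambda>z. deriv \<psi> (f z) * B z) U"
  unfolding qc_map_def
proof (intro conjI ballI)
  show "C1_wirtinger (\<lambda>z. \<psi> (f z)) (\<lambda>z. deriv \<psi> (f z) * A z) (\<lambda>z. deriv \<psi> (f z) * B z) U"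
    by (rule C1_wirtinger_holomorphic_compose[OF _ hol V]) (use f in \<open>simp add: qc_map_def\<close>)
  show "inj_on (\<lambda>z. \<psi> (f z)) U"
    using comp_inj_on[OF _ inj_on_subset[OF inj V(2)]] f by (simp add: qc_map_def o_def)
  fix z assume z: "z \<in> U"
  let ?D = "norm (deriv \<psi> (f z))"
  have "deriv \<psi> (f z) \<noteq> 0"
    using holomorphic_injective_imp_regular[OF hol V(1) inj] z V by auto
  then have D: "?D > 0" by simp
  have q: "norm (B z) < norm (A z)" "(norm (A z) + norm (B z))^2 \<le> K * ((norm (A z))^2 - (norm (B z))^2)"
    using f z by (auto simp: qc_map_def)
  show "norm (deriv \<psi> (f z) * B z) < norm (deriv \<psi> (f z) * A z)"
    using D q by (simp add: norm_mult)
  have "?D\<^sup>2 * (norm (A z) + norm (B z))^2 \<le> ?D\<^sup>2 * (K * ((norm (A z))^2 - (norm (B z))^2))"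
    by (intro mult_left_mono q) auto
  then show "(norm (deriv \<psi> (f z) * A z) + norm (deriv \<psi> (f z) * B z))\<^sup>2
     \<le> K * ((norm (deriv \<psi> (f z) * A z))\<^sup>2 - (norm (deriv \<psi> (f z) * B z))\<^sup>2)"
    by (simp add: norm_mult power2_eq_square algebra_simps)
qed

lemma qc_map_open_image: "qc_map K f A B U \<Longrightarrow> open (f ` U)"
  unfolding qc_map_def by (intro invariance_of_domain) (blast intro: C1_wirtinger_cont, auto simp: C1_wirtinger_def)

lemma wirtinger_inverse_identity:
  fixes j :: real
  assumes "of_real j = a * cnj a - b * cnj b" "j \<noteq> 0"
  shows "a * (cnj a / of_real j * v + - b / of_real j * cnj v) + b * cnj (cnj a / of_real j * v + - b / of_real j * cnj v) = v"
proof -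
  have "a * (cnj a / of_real j * v + - b / of_real j * cnj v) + b * cnj (cnj a / of_real j * v + - b / of_real j * cnj v)
      = (a * cnj a - b * cnj b) / of_real j * v"
    by (simp add: diff_divide_distrib ring_distribs mult_ac)
  also have "\<dots> = v" unfolding assms(1)[symmetric] using assms(2) by simp
  finally show ?thesis .
qed

text \<open>
  The equation \<open>w = A v + B (cnj v)\<close> has the solution \<open>v = (cnj A w - B (cnj w)) / J\<close>, where J is the
  Jacobian. The derivative of the inverse thus has operator norm \<open>(|A| + |B|) / J\<close> and Jacobian
  \<open>1 / J\<close>, so K is unchanged.
\<close>

lemma qc_map_inverse:
  assumes f: "qc_map K f A B U" and g: "\<And>z. z \<in> U \<Longrightarrow> g (f z) = z"
  defines "J \<equiv> \<lambda>z. (norm (A z))^2 - (norm (B z))^2"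
  shows "qc_map K g (\<lambda>w. cnj (A (g w)) / of_real (J (g w))) (\<lambda>w. - B (g w) / of_real (J (g w))) (f ` U)"
proof -
  have C: "C1_wirtinger f A B U" and inj: "inj_on f U" and U: "open U"
    and cA: "continuous_on U A" and cB: "continuous_on U B"
    using f by (auto simp: qc_map_def C1_wirtinger_def)
  have cf: "continuous_on U f" by (rule C1_wirtinger_cont[OF C])
  have gU: "g ` (f ` U) \<subseteq> U" using g by auto
  have op: "open (f ` U)" by (rule qc_map_open_image[OF f])
  have cg: "continuous_on (f ` U) g"
    unfolding continuous_on_open_vimage[OF op]
  proof (intro allI impI)
    fix T :: "complex set" assume T: "open T"
    have "open (f ` (U \<inter> T))"
      using U T by (intro invariance_of_domain continuous_on_subset[OF cf] inj_on_subset[OF inj]) auto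
    moreover have "g -` T \<inter> f ` U = f ` (U \<inter> T)" using g by auto
    ultimately show "open (g -` T \<inter> f ` U)" by simp
  qed
  have J: "J z > 0" if "z \<in> U" for z
    using f that unfolding J_def qc_map_def by (simp add: power_strict_mono)
  have cJ: "continuous_on U J" unfolding J_def by (intro continuous_intros cA cB)
  note cc = continuous_on_compose2[OF cA cg gU] continuous_on_compose2[OF cB cg gU] continuous_on_compose2[OF cJ cg gU]
  have nz: "of_real (J (g w)) \<noteq> (0::complex)" if "w \<in> f ` U" for w using J gU that by force
  have der: "(g has_derivative (\<lambda>v. cnj (A z) / of_real (J z) * v + - B z / of_real (J z) * cnj v)) (at (f z))"
    if z: "z \<in> U" for z
  proof (rule has_derivative_inverse_strong[OF U z cf g])
    show "(f has_derivative (\<lambda>v. A z * v + B z * cnj v)) (at z)" using C z by (auto simp: C1_wirtinger_def)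
    have Jz: "of_real (J z) = A z * cnj (A z) - B z * cnj (B z)"
      unfolding J_def of_real_diff complex_norm_square ..
    then show "(\<lambda>v. A z * v + B z * cnj v) \<circ> (\<lambda>v. cnj (A z) / of_real (J z) * v + - B z / of_real (J z) * cnj v) = id"
      unfolding fun_eq_iff o_def id_def
      using wirtinger_inverse_identity[OF Jz] J[OF z] by simp
  qed
  have inj': "inj_on g (f ` U)" using g by (auto simp: inj_on_def)
  show ?thesis
    unfolding qc_map_def C1_wirtinger_def
  proof (intro conjI ballI op inj')
    show "continuous_on (f ` U) (\<lambda>w. cnj (A (g w)) / of_real (J (g w)))"
      "continuous_on (f ` U) (\<lambda>w. - B (g w) / of_real (J (g w)))"
      using nz by (auto intro!: continuous_intros cc)
    fix w assume "w \<in> f ` U"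
    then obtain z where z: "z \<in> U" "w = f z" by auto
    show "(g has_derivative (\<lambda>v. cnj (A (g w)) / of_real (J (g w)) * v + - B (g w) / of_real (J (g w)) * cnj v)) (at w)"
      using der[OF z(1)] z g by simp
    have q: "norm (B z) < norm (A z)" "(norm (A z) + norm (B z))^2 \<le> K * J z"
      using f z by (auto simp: qc_map_def J_def)
    show "norm (- B (g w) / of_real (J (g w))) < norm (cnj (A (g w)) / of_real (J (g w)))"
      using q J[OF z(1)] z g by (simp add: norm_divide divide_strict_right_mono)
    have "(norm (A z) / J z + norm (B z) / J z)\<^sup>2 = (norm (A z) + norm (B z))^2 / (J z)\<^sup>2"
      by (simp add: add_divide_distrib[symmetric] power_divide)
    also have "\<dots> \<le> K * J z / (J z)\<^sup>2" using q by (intro divide_right_mono) auto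
    also have "\<dots> = K * ((norm (A z) / J z)\<^sup>2 - (norm (B z) / J z)\<^sup>2)"
      by (simp add: power_divide diff_divide_distrib[symmetric] J_def)
    finally show "(norm (cnj (A (g w)) / of_real (J (g w))) + norm (- B (g w) / of_real (J (g w))))\<^sup>2
      \<le> K * ((norm (cnj (A (g w)) / of_real (J (g w))))\<^sup>2 - (norm (- B (g w) / of_real (J (g w))))\<^sup>2)"
      using z g J[OF z(1)] by (simp add: norm_divide)
  qed
qed

section \<open>Boundedness of the second coefficient\<close>

text \<open>
  The map \<open>w \<mapsto> w / (2m - w)\<close> fixes 0 and sends the half-plane \<open>Re w < m\<close> into the unit disc, so the
  Schwarz lemma applies to its composition with P.
\<close>

lemma borel_caratheodory:
  assumes hol: "P holomorphic_on ball 0 R" and P0: "P 0 = 0" and Re: "\<And>z. norm z < R \<Longrightarrow> Re (P z) < m"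
    and z: "norm z < R"
  shows "norm (P z) \<le> 2 * m * norm z / (R - norm z)"
proof -
  have R: "R > 0" using z norm_ge_zero[of z] by linarith
  have m: "m > 0" using Re[of 0] P0 R by simp
  define \<phi> where "\<phi> \<xi> = P (of_real R * \<xi>) / (2 * of_real m - P (of_real R * \<xi>))" for \<xi>
  have lt: "norm (P y) < norm (2 * of_real m - P y)" if "norm y < R" for y
  proof (rule power2_less_imp_less)
    have "(norm (2 * of_real m - P y))\<^sup>2 - (norm (P y))\<^sup>2 = 4 * m * (m - Re (P y))"
      unfolding cmod_power2 by (simp add: power2_eq_square algebra_simps)
    moreover have "4 * m * (m - Re (P y)) > 0" using Re[OF that] m by simp
    ultimately show "(norm (P y))\<^sup>2 < (norm (2 * of_real m - P y))\<^sup>2" by linarith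
  qed auto
  have in_ball: "norm (of_real R * \<xi>) < R" if "norm \<xi> < 1" for \<xi> :: complex
    using that R by (simp add: norm_mult)
  have nz: "2 * of_real m - P (of_real R * \<xi>) \<noteq> 0" if "norm \<xi> < 1" for \<xi>
    using lt[OF in_ball[OF that]] by force
  have "(\<lambda>\<xi>. P (of_real R * \<xi>)) holomorphic_on ball 0 1"
    using in_ball by (intro holomorphic_on_compose_gen[OF _ hol, unfolded o_def] holomorphic_intros) auto
  then have hol\<phi>: "\<phi> holomorphic_on ball 0 1"
    unfolding \<phi>_def using nz by (intro holomorphic_intros) auto
  define \<xi> where "\<xi> = z / of_real R"
  have \<xi>: "norm \<xi> < 1" "of_real R * \<xi> = z" "norm \<xi> = norm z / R" using z R by (auto simp: \<xi>_def norm_divide)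
  have "norm (\<phi> \<xi>) \<le> norm \<xi>"
  proof (rule Schwarz_Lemma(1)[OF hol\<phi> _ _ \<xi>(1)])
    show "\<phi> 0 = 0" by (simp add: \<phi>_def P0)
    fix y :: complex assume y: "norm y < 1"
    show "norm (\<phi> y) < 1" unfolding \<phi>_def norm_divide using lt[OF in_ball[OF y]] nz[OF y] by simp
  qed
  then have "norm (P z) \<le> norm \<xi> * norm (2 * of_real m - P z)"
    using nz[OF \<xi>(1)] unfolding \<phi>_def norm_divide \<xi>(2) by (simp add: field_simps)
  also have "\<dots> \<le> norm \<xi> * (2 * m + norm (P z))"
    using norm_triangle_ineq4[of "2 * of_real m" "P z"] m by (intro mult_left_mono) (auto simp: norm_mult)
  finally have "norm (P z) * (1 - norm \<xi>) \<le> 2 * m * norm \<xi>" by (simp add: algebra_simps)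
  then have "R * (norm (P z) * (1 - norm \<xi>)) \<le> R * (2 * m * norm \<xi>)"
    using R by (intro mult_left_mono) auto
  moreover have "norm z = R * norm \<xi>" using R \<xi>(3) by simp
  ultimately have "norm (P z) * (R - norm z) \<le> 2 * m * norm z"
    by (simp add: algebra_simps)
  then show ?thesis using z by (simp add: field_simps)
qed

text \<open>
  A Koebe type upper bound. On the simply connected image there is a branch s of \<open>sqrt (w - w0)\<close>; put
  \<open>s0 = s 0\<close>. On \<open>ball 0 d\<close> it stays in the half-plane \<open>Re (s / s0) > 0\<close>, while a value close to \<open>-s0\<close>
  would have to be taken in \<open>ball 0 d\<close>. So s omits the disc around \<open>-s0\<close> of radius \<open>sqrt d / 3\<close>, and
  \<open>1 / (s + s0)\<close> is bounded. By the length-area estimate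
  \<open>1 / (s + s0)\<close>, composed with f, stays close to its value \<open>1 / (2 s0)\<close> near the origin; there it is
  bounded away from 0, which bounds s and f.
\<close>

lemma qc_map_growth_upper:
  assumes f: "qc_map K f A B (ball 0 1)" and K: "K > 0" and f0: "f 0 = 0"
    and d: "norm w0 = d" "d > 0" and sub: "ball 0 d \<subseteq> f ` ball 0 1" and w0: "w0 \<notin> f ` ball 0 1"
    and z: "norm z \<le> exp (- (2048 * pi\<^sup>2 * K)) / 2"
  shows "norm (f z) \<le> 26 * d"
proof -
  let ?D = "ball (0::complex) 1"
  let ?\<Omega> = "f ` ?D"
  define \<rho> where "\<rho> = exp (- (2048 * pi\<^sup>2 * K)) / 2"
  have \<rho>: "0 < \<rho>" "\<rho> < 1/2" using K by (auto simp: \<rho>_def)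
  have C: "C1_wirtinger f A B ?D" and inj: "inj_on f ?D" using f by (auto simp: qc_map_def)
  have op: "open ?\<Omega>" by (rule qc_map_open_image[OF f])
  have "?D homeomorphic ?\<Omega>"
    using invariance_of_domain_homeomorphic[of ?D f] C1_wirtinger_cont[OF C] inj by simp
  then have "simply_connected ?\<Omega>"
    using homeomorphic_simply_connected convex_imp_simply_connected[OF convex_ball] by blast
  then have "\<forall>f. f holomorphic_on ?\<Omega> \<and> (\<forall>z \<in> ?\<Omega>. f z \<noteq> 0) \<longrightarrow> (\<exists>g. g holomorphic_on ?\<Omega> \<and> (\<forall>z \<in> ?\<Omega>.  f z = (g z)\<^sup>2))"
    using simply_connected_eq_holomorphic_sqrt[OF op] by blast
  moreover have "(\<lambda>w. w - w0) holomorphic_on ?\<Omega>" "\<forall>w\<in>?\<Omega>. w - w0 \<noteq> 0"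
    using w0 by (auto intro!: holomorphic_intros)
  ultimately obtain s where s: "s holomorphic_on ?\<Omega>" and s2: "\<And>w. w \<in> ?\<Omega> \<Longrightarrow> w - w0 = (s w)\<^sup>2"
    by blast
  define s0 where "s0 = s 0"
  have 0: "0 \<in> ?\<Omega>" using f0 by (metis centre_in_ball image_eqI zero_less_one)
  have s02: "s0\<^sup>2 = - w0" using s2[OF 0] by (simp add: s0_def)
  then have "(norm s0)\<^sup>2 = d" using d by (metis norm_minus_cancel norm_power)
  then have ns0: "norm s0 = sqrt d" by (metis norm_ge_zero real_sqrt_abs abs_of_nonneg)
  have sd: "sqrt d > 0" "(sqrt d)\<^sup>2 = d" using d by auto
  have s00: "s0 \<noteq> 0" using ns0 sd by auto
  \<comment> \<open>On \<open>ball 0 d\<close> the quotient \<open>(s / s0)^2 = 1 - w / w0\<close> has positive real part, so \<open>Re (s / s0)\<close> has no zero and keeps its sign at 0.\<close>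
  have Repos: "Re (s w / s0) > 0" if w: "w \<in> ball 0 d" for w
  proof (rule ccontr)
    assume neg: "\<not> Re (s w / s0) > 0"
    have cont: "continuous_on (ball 0 d) (\<lambda>w. Re (s w / s0))"
      using continuous_on_subset[OF holomorphic_on_imp_continuous_on[OF s] sub] s00
      by (intro continuous_intros) auto
    have "connected ((\<lambda>w. Re (s w / s0)) ` ball 0 d)"
      using connected_continuous_image[OF cont] by simp
    moreover have "Re (s w / s0) \<in> (\<lambda>w. Re (s w / s0)) ` ball 0 d" "1 \<in> (\<lambda>w. Re (s w / s0)) ` ball 0 d"
      using w s00 d by (auto simp: s0_def intro!: image_eqI[where x=0])
    ultimately have "0 \<in> (\<lambda>w. Re (s w / s0)) ` ball 0 d"
      using neg connectedD_interval[of "(\<lambda>w. Re (s w / s0)) ` ball 0 d" "Re (s w / s0)" 1 0] by auto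
    then obtain v where v: "v \<in> ball 0 d" "Re (s v / s0) = 0" by auto
    have "(s v / s0)\<^sup>2 = 1 + v / s0\<^sup>2"
    proof -
      have "w0 \<noteq> 0" using d by auto
      have "(s v / s0)\<^sup>2 = (v - w0) / (- w0)"
        using s2[of v] v sub by (auto simp: power_divide s02)
      also have "\<dots> = 1 + v / (- w0)" using \<open>w0 \<noteq> 0\<close> by (simp add: field_simps)
      finally show ?thesis by (simp only: s02)
    qed
    moreover have "Re (t\<^sup>2) \<le> 0" if "Re t = 0" for t using that by (simp add: power2_eq_square)
    from this[OF v(2)] have "Re ((s v / s0)\<^sup>2) \<le> 0" .
    ultimately have "1 + Re (v / s0\<^sup>2) \<le> 0" by simp
    moreover have "\<bar>Re (v / s0\<^sup>2)\<bar> \<le> norm (v / s0\<^sup>2)" by (rule abs_Re_le_cmod)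
    moreover have "norm (v / s0\<^sup>2) < 1" using v d by (simp add: norm_divide s02)
    ultimately show False by linarith
  qed
  have omit: "norm (s w + s0) \<ge> sqrt d / 3" if w: "w \<in> ?\<Omega>" for w
  proof (rule ccontr)
    \<comment> \<open>A value of s this close to \<open>-s0\<close> belongs to a w with \<open>|w| = |s + s0| |s - s0| \<le> (1/3) (7/3) d < d\<close>, where \<open>Re (s / s0)\<close> is positive.\<close>
    assume "\<not> ?thesis"
    then have lt: "norm (s w + s0) < sqrt d / 3" by simp
    have "norm (s w - s0) \<le> norm (s w + s0) + norm (2 * s0)"
      using norm_triangle_ineq4[of "s w + s0" "2 * s0"] by simp
    then have le: "norm (s w - s0) \<le> 7/3 * sqrt d" using lt ns0 by (simp add: norm_mult)
    have "w = (s w + s0) * (s w - s0)"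
      using s2[OF w] s02 by (simp add: power2_eq_square algebra_simps)
    then have "norm w = norm (s w + s0) * norm (s w - s0)" by (metis norm_mult)
    also have "\<dots> \<le> sqrt d / 3 * (7/3 * sqrt d)" using lt le d by (intro mult_mono) auto
    also have "\<dots> = 7/9 * d" using sd by (simp add: power2_eq_square)
    also have "\<dots> < d" using d by simp
    finally have "Re (s w / s0) > 0" by (intro Repos) simp
    moreover have "Re (s w / s0 + 1) \<le> norm (s w / s0 + 1)" by (rule complex_Re_le_cmod)
    moreover have lt': "norm (s w + s0) < sqrt d" using lt sd(1) by linarith
    moreover have "s w / s0 + 1 = (s w + s0) / s0" using s00 by (simp add: field_simps)
    then have "norm (s w / s0 + 1) < 1" using lt' ns0 sd by (simp add: norm_divide)
    ultimately show False by simp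
  qed
  define \<psi> where "\<psi> w = 1 / (s w + s0)" for w
  have nz: "s w + s0 \<noteq> 0" if "w \<in> ?\<Omega>" for w using omit[OF that] sd by auto
  have hol\<psi>: "\<psi> holomorphic_on ?\<Omega>" unfolding \<psi>_def using nz by (intro holomorphic_intros s) auto
  have inj\<psi>: "inj_on \<psi> ?\<Omega>"
  proof (rule inj_onI)
    fix u v assume u: "u \<in> ?\<Omega>" and v: "v \<in> ?\<Omega>" and "\<psi> u = \<psi> v"
    then have "s u = s v" using nz[OF u] nz[OF v] by (simp add: \<psi>_def field_simps)
    then show "u = v" using s2[OF u] s2[OF v] by (metis diff_add_cancel)
  qed
  have qcQ: "qc_map K (\<lambda>z. \<psi> (f z)) (\<lambda>z. deriv \<psi> (f z) * A z) (\<lambda>z. deriv \<psi> (f z) * B z) ?D"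
    by (rule qc_map_holomorphic_compose[OF f hol\<psi> op _ inj\<psi>]) simp
  have n\<psi>: "norm (\<psi> w) < 4 / sqrt d" if w: "w \<in> ?\<Omega>" for w
  proof -
    have "norm (\<psi> w) = 1 / norm (s w + s0)" by (simp add: \<psi>_def norm_divide)
    also have "\<dots> \<le> 1 / (sqrt d / 3)" using omit[OF w] sd by (intro frac_le) auto
    also have "\<dots> < 4 / sqrt d" using sd by (simp add: field_simps)
    finally show ?thesis .
  qed
  have zr: "norm z \<le> \<rho>" using z by (simp only: \<rho>_def)
  then have zD: "z \<in> ?D" using \<rho>(2) by simp
  have "(dist (\<psi> (f 0)) (\<psi> (f z)))\<^sup>2 \<le> 8 * pi\<^sup>2 * K * (4 / sqrt d)\<^sup>2 / ln ((1/2) / \<rho>)"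
  proof (rule courant_lebesgue[OF qcQ])
    show "\<psi> (f y) \<in> ball 0 (4 / sqrt d)" if "y \<in> ball 0 (1/2)" for y using n\<psi>[of "f y"] that by auto
    show "dist 0 z \<le> \<rho>" using zr by simp
  qed (use K \<rho> in auto)
  also have "ln ((1/2) / \<rho>) = 2048 * pi\<^sup>2 * K"
  proof -
    have "(1/2) / \<rho> = exp (2048 * pi\<^sup>2 * K)" by (simp add: \<rho>_def exp_minus field_simps)
    then show ?thesis by (simp only: ln_exp)
  qed
  \<comment> \<open>The constant 2048 makes the oscillation at most half of the modulus \<open>1 / (2 sqrt d)\<close> at the origin.\<close>
  also have "8 * pi\<^sup>2 * K * (4 / sqrt d)\<^sup>2 / (2048 * pi\<^sup>2 * K) = (1 / (4 * sqrt d))\<^sup>2"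
    using K d sd by (simp add: power_divide power_mult_distrib)
  finally have "dist (\<psi> (f 0)) (\<psi> (f z)) \<le> 1 / (4 * sqrt d)"
    by (rule power2_le_imp_le) (use sd in auto)
  moreover have "norm (\<psi> (f 0)) = 1 / (2 * sqrt d)"
    using ns0 by (simp add: f0 \<psi>_def s0_def[symmetric] norm_divide norm_mult flip: mult_2)
  moreover have "norm (\<psi> (f 0)) \<le> dist (\<psi> (f 0)) (\<psi> (f z)) + norm (\<psi> (f z))"
    using norm_triangle_sub[of "\<psi> (f 0)" "\<psi> (f z)"] by (simp add: dist_norm)
  ultimately have "norm (\<psi> (f z)) \<ge> 1 / (4 * sqrt d)" by (simp add: field_simps)
  moreover have "norm (\<psi> (f z)) = 1 / norm (s (f z) + s0)" by (simp add: \<psi>_def norm_divide)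
  moreover have "norm (s (f z) + s0) > 0" using nz zD by auto
  ultimately have "norm (s (f z) + s0) \<le> 4 * sqrt d" using sd by (simp add: field_simps)
  then have "norm (s (f z)) \<le> 5 * sqrt d"
    using norm_triangle_ineq4[of "s (f z) + s0" s0] ns0 by simp
  then have "(norm (s (f z)))\<^sup>2 \<le> (5 * sqrt d)\<^sup>2" by (intro power_mono) auto
  moreover have "f z = (s (f z))\<^sup>2 + w0" using s2[of "f z"] zD by (simp add: algebra_simps)
  then have "norm (f z) \<le> (norm (s (f z)))\<^sup>2 + d" using d(1) by (metis norm_power norm_triangle_ineq)
  ultimately show ?thesis using sd by (simp add: power_mult_distrib)
qed

text \<open>
  The length-area estimate for the inverse map, whose values lie in the unit disc.
\<close>

lemma qc_map_preimage_near_0: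
  assumes f: "qc_map K f A B U" and K: "K > 0" and f0: "f 0 = 0" "0 \<in> U" and U: "U \<subseteq> ball 0 1"
    and d: "d > 0" "ball 0 d \<subseteq> f ` U" and e: "\<epsilon> > 0" and w: "norm w \<le> d / 2 * exp (- (8 * pi\<^sup>2 * K / \<epsilon>\<^sup>2))"
  shows "\<exists>z\<in>U. f z = w \<and> norm z \<le> \<epsilon>"
proof -
  define g where "g = inv_into U f"
  have inj: "inj_on f U" using f by (auto simp: qc_map_def)
  have g: "g (f z) = z" if "z \<in> U" for z using inj that by (simp add: g_def)
  define X where "X = 8 * pi\<^sup>2 * K / \<epsilon>\<^sup>2"
  have X: "X > 0" using K e by (simp add: X_def)
  define r where "r = d / 2 * exp (- X)"
  have r: "0 < r" "r < d / 2" using X d by (auto simp: r_def)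
  have wr: "norm w \<le> r" using w by (simp add: r_def X_def)
  have "(dist (g 0) (g w))\<^sup>2 \<le> 8 * pi\<^sup>2 * K * 1\<^sup>2 / ln ((d/2) / r)"
  proof (rule courant_lebesgue[OF qc_map_inverse[OF f g]])
    show "cball 0 (d/2) \<subseteq> f ` U" using d by (intro subset_trans[OF _ d(2)]) auto
    show "g y \<in> ball 0 1" if "y \<in> ball 0 (d/2)" for y
    proof -
      have "y \<in> ball 0 d" using that d(1) by simp
      then obtain z where "z \<in> U" "y = f z" using d by blast
      then show ?thesis using g U by auto
    qed
  qed (use K r wr in auto)
  also have "ln ((d/2) / r) = X" using d by (simp add: r_def ln_div ln_mult)
  also have "8 * pi\<^sup>2 * K * 1\<^sup>2 / X = \<epsilon>\<^sup>2" using K e by (simp add: X_def)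
  also have "g 0 = 0" using g[OF f0(2)] f0 by simp
  finally have "norm (g w) \<le> \<epsilon>" using e by (simp add: power2_le_iff_abs_le)
  moreover have "w \<in> f ` U" using wr r d by (intro subsetD[OF d(2)]) auto
  ultimately show ?thesis using g by auto
qed

text \<open>
  Otherwise the preceding estimate, applied on arbitrarily large discs, would find the preimage of
  \<open>f (1/2)\<close> within distance 1/4 of the origin.
\<close>

lemma qc_map_image_neq_UNIV:
  assumes f: "qc_map K f A B (ball 0 1)" and K: "K > 0" and f0: "f 0 = 0"
  shows "f ` ball 0 1 \<noteq> UNIV"
proof
  assume U: "f ` ball 0 1 = UNIV"
  define X where "X = 8 * pi\<^sup>2 * K / (1/4)\<^sup>2"
  define d where "d = 2 * exp X * (norm (f (1/2)) + 1)"
  have d: "d > 0" unfolding d_def by (intro mult_pos_pos add_nonneg_pos) auto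
  have "d / 2 * exp (- X) = norm (f (1/2)) + 1" by (simp add: d_def exp_minus)
  then have "\<exists>z\<in>ball 0 1. f z = f (1/2) \<and> norm z \<le> 1/4"
    using d U f0 K by (intro qc_map_preimage_near_0[OF f, of d]) (auto simp: X_def)
  then obtain z where z: "z \<in> ball 0 1" "f z = f (1/2)" "norm z \<le> 1/4" by blast
  have inj: "inj_on f (ball 0 1)" using f by (simp add: qc_map_def)
  have "z = 1/2" by (rule inj_onD[OF inj z(2,1)]) simp
  then have "norm (1/2::complex) \<le> 1/4" using z(3) by metis
  then show False by (simp add: norm_divide)
qed

lemma S_H_qr_qc_map:
  assumes "(h, g) \<in> S_H_qr K"
  shows "qc_map K (harmonic_map (h, g)) (deriv h) (\<lambda>z. cnj (deriv g z)) (ball 0 1)"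
proof -
  have hol: "h holomorphic_on ball 0 1" "g holomorphic_on ball 0 1" and inj: "inj_on (harmonic_map (h, g)) (ball 0 1)"
    and J: "\<And>z. z \<in> ball 0 1 \<Longrightarrow> 0 < Jac (h,g) z" and L: "\<And>z. z \<in> ball 0 1 \<Longrightarrow> (Lam (h,g) z)\<^sup>2 \<le> K * Jac (h,g) z"
    using assms by (auto simp: S_H_qr_def S_H_def)
  have der: "(harmonic_map (h, g) has_derivative (\<lambda>v. deriv h z * v + cnj (deriv g z) * cnj v)) (at z)" if "z \<in> ball 0 1" for z
  proof -
    have "(h has_derivative (\<lambda>v. deriv h z * v)) (at z)" "(g has_derivative (\<lambda>v. deriv g z * v)) (at z)"
      using hol that by (auto intro!: has_field_derivative_imp_has_derivative holomorphic_derivI)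
    then have "((\<lambda>z. h z + cnj (g z)) has_derivative (\<lambda>v. deriv h z * v + cnj (deriv g z * v))) (at z)"
      by (intro has_derivative_add has_derivative_cnj)
    then show ?thesis by (simp add: harmonic_map_def)
  qed
  have c: "continuous_on (ball 0 1) (deriv h)" "continuous_on (ball 0 1) (\<lambda>z. cnj (deriv g z))"
    using hol by (intro continuous_on_cnj holomorphic_on_imp_continuous_on holomorphic_deriv; simp)+
  have "norm (deriv g z) < norm (deriv h z)" if "z \<in> ball 0 1" for z
    using J[OF that] by (auto simp: Jac_def f_z_def f_zbar_def intro: power2_less_imp_less)
  then show ?thesis
    using c der inj L by (auto simp: qc_map_def C1_wirtinger_def Lam_def Jac_def f_z_def f_zbar_def)
qed

lemma C1_wirtinger_lipschitz:
  assumes f: "C1_wirtinger f A B U" and S: "convex S" "S \<subseteq> U"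
    and L: "\<And>z. z \<in> S \<Longrightarrow> norm (A z) + norm (B z) \<le> L" and xy: "x \<in> S" "y \<in> S"
  shows "norm (f x - f y) \<le> L * norm (x - y)"
proof (rule differentiable_bound[OF S(1) _ _ xy])
  fix z assume z: "z \<in> S"
  show "(f has_derivative (\<lambda>v. A z * v + B z * cnj v)) (at z within S)"
    using f z S by (auto simp: C1_wirtinger_def intro: has_derivative_at_withinI)
  show "onorm (\<lambda>v. A z * v + B z * cnj v) \<le> L"
  proof (rule onorm_le)
    fix v
    have "norm (A z * v + B z * cnj v) \<le> (norm (A z) + norm (B z)) * norm v"
      using norm_triangle_ineq[of "A z * v" "B z * cnj v"] by (simp add: norm_mult algebra_simps)
    also have "\<dots> \<le> L * norm v" using L[OF z] by (intro mult_right_mono) auto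
    finally show "norm (A z * v + B z * cnj v) \<le> L * norm v" .
  qed
qed

lemma norm_deriv_le:
  assumes "f holomorphic_on S" "cball z r \<subseteq> S" "r > 0" "\<And>x. dist z x = r \<Longrightarrow> norm (f x) \<le> M"
  shows "norm (deriv f z) \<le> M / r"
  using Cauchy_inequality[of f z r M 1] assms
  by (simp add: dist_norm holomorphic_on_subset[OF _ subset_trans[OF ball_subset_cball]]
       holomorphic_on_imp_continuous_on[OF holomorphic_on_subset])

text \<open>
  Everything is measured against the distance d from 0 to the boundary of the image. Upper bounds for f
  on a fixed disc are of order d; since \<open>h'\<close> has no zeros and \<open>h'(0) = 1\<close>, on a smaller disc they
  improve to order \<open>d^(2/5)\<close>. But f must reach the modulus \<open>\<kappa> d\<close> on that smaller disc, so d cannot be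
  large.
\<close>

lemma S_H_qr_second_coeff_bounded:
  assumes K: "K \<ge> 1"
  shows "\<exists>M. \<forall>F\<in>S_H_qr K. norm (f_zz F 0) / 2 \<le> M"
proof -
  define \<rho> where "\<rho> = exp (- (2048 * pi\<^sup>2 * K)) / 2"
  have \<rho>: "0 < \<rho>" "\<rho> < 1/2" using K by (auto simp: \<rho>_def)
  define C where "C = 600 / \<rho>"
  define \<epsilon> where "\<epsilon> = \<rho> / 24"
  define \<kappa> where "\<kappa> = exp (- (8 * pi\<^sup>2 * K / \<epsilon>\<^sup>2)) / 2"
  have pos: "C > 0" "\<epsilon> > 0" "\<kappa> > 0" using \<rho> by (auto simp: C_def \<epsilon>_def \<kappa>_def)
  \<comment> \<open>The solution of \<open>log \<kappa> + log d = 2/5 (log C + log d)\<close> for d.\<close>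
  define D0 where "D0 = exp ((2/5 * ln C - ln \<kappa>) * 5/3)"
  have "norm (deriv (deriv h) 0) \<le> C * D0 / (\<rho> / 8)" if F: "(h, g) \<in> S_H_qr K" for h g
  proof -
    let ?f = "harmonic_map (h, g)" and ?D = "ball (0::complex) 1"
    have qc: "qc_map K ?f (deriv h) (\<lambda>z. cnj (deriv g z)) ?D" by (rule S_H_qr_qc_map[OF F])
    have hol: "h holomorphic_on ?D" "g holomorphic_on ?D" and h0: "h 0 = 0" "g 0 = 0" "deriv h 0 = 1"
      using F by (auto simp: S_H_qr_def S_H_def)
    have f0: "?f 0 = 0" by (simp add: harmonic_map_def h0)
    let ?\<Omega> = "?f ` ?D"
    have op: "open ?\<Omega>" by (rule qc_map_open_image[OF qc])
    have ne: "- ?\<Omega> \<noteq> {}" using qc_map_image_neq_UNIV[OF qc _ f0] K by auto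
    obtain w0 where w0: "w0 \<in> - ?\<Omega>" "infdist 0 (- ?\<Omega>) = dist 0 w0"
      using infdist_attains_inf[OF _ ne, of 0] op by (auto simp: closed_def)
    define d where "d = norm w0"
    have "0 \<in> ?\<Omega>" using f0 by (metis centre_in_ball image_eqI zero_less_one)
    then have d: "d > 0" using w0(1) by (auto simp: d_def)
    have sub: "ball 0 d \<subseteq> ?\<Omega>"
    proof
      fix y :: complex assume y: "y \<in> ball 0 d"
      show "y \<in> ?\<Omega>"
      proof (rule ccontr)
        assume "y \<notin> ?\<Omega>"
        then have "infdist 0 (- ?\<Omega>) \<le> dist 0 y" by (intro infdist_le) simp
        with y w0(2) show False by (simp add: d_def)
      qed
    qed
    have f26: "norm (?f z) \<le> 26 * d" if "norm z \<le> \<rho>" for z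
      using qc_map_growth_upper[OF qc _ f0 d_def[symmetric] d sub] K w0(1) that by (simp add: \<rho>_def)
    have inD: "ball 0 \<rho> \<subseteq> ?D" using \<rho> by auto
    have BC: "norm (P z) \<le> 54 * d"
      if P: "P holomorphic_on ball 0 \<rho>" "P 0 = 0" "\<And>z. norm z \<le> \<rho> \<Longrightarrow> Re (P z) \<le> norm (?f z)" and z: "norm z \<le> \<rho> / 2" for P z
    proof -
      have z': "norm z < \<rho>" using z \<rho> by linarith
      have "norm (P z) \<le> 2 * (27 * d) * norm z / (\<rho> - norm z)"
      proof (rule borel_caratheodory[OF P(1,2) _ z'])
        fix y :: complex assume y: "norm y < \<rho>"
        show "Re (P y) < 27 * d" using P(3)[of y] f26[of y] y d by linarith
      qed
      also have "\<dots> \<le> 54 * d"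
      proof -
        have "54 * d * norm z \<le> 54 * d * (\<rho> - norm z)" using z d by (intro mult_left_mono) auto
        then show ?thesis using z' by (simp add: divide_le_eq)
      qed
      finally show ?thesis .
    qed
    have hb: "norm (h z) \<le> 54 * d" if z: "norm z \<le> \<rho> / 2" for z
    proof -
      \<comment> \<open>\<open>Re (h + g) = Re f\<close> and \<open>Im (h - g) = Im f\<close>, so both combinations have one-sided bounds.\<close>
      have 1: "norm (h z + g z) \<le> 54 * d"
      proof (rule BC[OF _ _ _ z])
        show "Re (h y + g y) \<le> norm (?f y)" for y
          using complex_Re_le_cmod[of "?f y"] by (simp add: harmonic_map_def)
      qed (use h0 hol inD in \<open>auto intro!: holomorphic_intros intro: holomorphic_on_subset\<close>)
      have 2: "norm (- \<i> * (h z - g z)) \<le> 54 * d"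
      proof (rule BC[OF _ _ _ z])
        show "Re (- \<i> * (h y - g y)) \<le> norm (?f y)" for y
          using abs_Im_le_cmod[of "?f y"] by (simp add: harmonic_map_def)
      qed (use h0 hol inD in \<open>auto intro!: holomorphic_intros intro: holomorphic_on_subset\<close>)
      have "norm (2 * h z) \<le> norm (h z + g z) + norm (h z - g z)"
        using norm_triangle_ineq[of "h z + g z" "h z - g z"] by simp
      also have "norm (h z - g z) \<le> 54 * d" using 2 by (simp add: norm_mult)
      finally show ?thesis using 1 by (simp add: norm_mult)
    qed
    have h'b: "norm (deriv h z) < C * d" if z: "norm z \<le> \<rho> / 4" for z
    proof -
      have "norm (deriv h z) \<le> 54 * d / (\<rho> / 4)"
      proof (rule norm_deriv_le[OF hol(1)])
        have t: "norm x \<le> \<rho> / 2" if "dist z x \<le> \<rho> / 4" for x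
          using z that norm_triangle_ineq[of z "x - z"] by (simp add: dist_norm norm_minus_commute)
        show "cball z (\<rho> / 4) \<subseteq> ?D" using t \<rho> by (force simp: dist_norm)
        show "norm (h x) \<le> 54 * d" if "dist z x = \<rho> / 4" for x using t[of x] that by (intro hb) auto
      qed (use \<rho> in auto)
      also have "\<dots> < C * d" using \<rho> d by (simp add: C_def field_simps)
      finally show ?thesis .
    qed
    have Cd: "1 < C * d" using h'b[of 0] h0 \<rho> by simp
    define m where "m = ln (C * d)"
    have em: "exp m = C * d" using Cd by (simp add: m_def)
    have m: "m > 0" using Cd by (simp add: m_def)
    have D4: "ball 0 (\<rho> / 4) \<subseteq> ?D" using \<rho> by auto
    have hol': "deriv h holomorphic_on ?D" using hol by (intro holomorphic_deriv) auto
    have nz: "deriv h z \<noteq> 0" if "z \<in> ?D" for z using qc that by (force simp: qc_map_def)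
    obtain L where L: "L holomorphic_on ball 0 (\<rho> / 4)" "\<And>z. z \<in> ball 0 (\<rho> / 4) \<Longrightarrow> exp (L z) = deriv h z"
      using holomorphic_logarithm_exists[of "ball 0 (\<rho> / 4)" "deriv h" 0] holomorphic_on_subset[OF hol' D4] nz D4 \<rho> by auto
    have "exp (L 0) = 1" using L(2)[of 0] \<rho> h0 by simp
    then have eL: "exp (L z - L 0) = deriv h z" if "z \<in> ball 0 (\<rho> / 4)" for z
      using L(2)[OF that] by (simp add: exp_diff)
    \<comment> \<open>At one sixth of the radius the Borel-Caratheodory factor is \<open>2 (1/6) / (5/6) = 2/5\<close>; what matters is that it is less than 1.\<close>
    have nh': "norm (deriv h z) \<le> exp (2/5 * m)" if z: "norm z \<le> \<epsilon>" for z
    proof -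
      have z4: "norm z < \<rho> / 4" using z \<rho> by (simp add: \<epsilon>_def)
      have "norm (L z - L 0) \<le> 2 * m * norm z / (\<rho> / 4 - norm z)"
      proof (rule borel_caratheodory[OF _ _ _ z4])
        show "(\<lambda>z. L z - L 0) holomorphic_on ball 0 (\<rho> / 4)" by (intro holomorphic_intros L)
        fix y :: complex assume y: "norm y < \<rho> / 4"
        have "exp (Re (L y - L 0)) = norm (deriv h y)" using eL[of y] y by (metis norm_exp_eq_Re mem_ball_0)
        also have "\<dots> < exp m" unfolding em using y by (intro h'b) auto
        finally show "Re (L y - L 0) < m" by simp
      qed simp
      also have "\<dots> \<le> 2/5 * m"
      proof -
        have "5 * norm z \<le> \<rho> / 4 - norm z" using z by (simp add: \<epsilon>_def)
        then have "2/5 * m * (5 * norm z) \<le> 2/5 * m * (\<rho> / 4 - norm z)" using m by (intro mult_left_mono) auto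
        then show ?thesis using z4 by (simp add: divide_le_eq)
      qed
      finally have "Re (L z - L 0) \<le> 2/5 * m" using complex_Re_le_cmod order_trans by blast
      moreover have "norm (deriv h z) = exp (Re (L z - L 0))" using eL[of z] z4 by (metis norm_exp_eq_Re mem_ball_0)
      ultimately show ?thesis by simp
    qed
    have fb: "norm (?f z) \<le> exp (2/5 * m)" if z: "norm z \<le> \<epsilon>" for z
    proof -
      have "norm (?f z - ?f 0) \<le> (2 * exp (2/5 * m)) * norm (z - 0)"
      proof (rule C1_wirtinger_lipschitz[where U="?D" and S="cball 0 \<epsilon>"])
        show "C1_wirtinger ?f (deriv h) (\<lambda>z. cnj (deriv g z)) ?D" using qc by (simp add: qc_map_def)
        show sub\<epsilon>: "cball 0 \<epsilon> \<subseteq> ?D" using \<rho> by (auto simp: \<epsilon>_def)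
        show "norm (deriv h y) + norm (cnj (deriv g y)) \<le> 2 * exp (2/5 * m)" if y: "y \<in> cball 0 \<epsilon>" for y
        proof -
          have "norm (cnj (deriv g y)) < norm (deriv h y)" using qc y sub\<epsilon> unfolding qc_map_def by blast
          then show ?thesis using nh'[of y] y by simp
        qed
      qed (use z pos in auto)
      also have "\<dots> \<le> exp (2/5 * m)" using z \<rho> by (simp add: \<epsilon>_def)
      finally show ?thesis using f0 by simp
    qed
    have "\<exists>z\<in>?D. ?f z = of_real (\<kappa> * d) \<and> norm z \<le> \<epsilon>"
    proof (rule qc_map_preimage_near_0[OF qc _ f0 _ _ d sub pos(2)])
      show "norm (complex_of_real (\<kappa> * d)) \<le> d / 2 * exp (- (8 * pi\<^sup>2 * K / \<epsilon>\<^sup>2))"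
        using d by (simp add: \<kappa>_def norm_mult)
    qed (use K in auto)
    then have "\<kappa> * d \<le> exp (2/5 * m)" using fb pos d by (metis abs_of_pos mult_pos_pos norm_of_real)
    then have "ln (\<kappa> * d) \<le> ln (exp (2/5 * m))" using pos d by (subst ln_le_cancel_iff) auto
    then have "ln \<kappa> + ln d \<le> 2/5 * (ln C + ln d)" using pos d by (simp add: m_def ln_mult)
    then have "ln d \<le> (2/5 * ln C - ln \<kappa>) * 5/3" by (simp add: field_simps)
    then have dD0: "d \<le> D0" using d unfolding D0_def by (metis exp_le_cancel_iff exp_ln)
    have "norm (deriv (deriv h) 0) \<le> C * d / (\<rho> / 8)"
    proof (rule norm_deriv_le[OF hol'])
      show "cball 0 (\<rho> / 8) \<subseteq> ?D" using \<rho> by auto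
      show "norm (deriv h x) \<le> C * d" if "dist 0 x = \<rho> / 8" for x
        using that \<rho> by (intro less_imp_le h'b) auto
    qed (use \<rho> in auto)
    also have "\<dots> \<le> C * D0 / (\<rho> / 8)"
      using dD0 pos \<rho> by (intro divide_right_mono mult_left_mono) auto
    finally show ?thesis .
  qed
  then show ?thesis
    by (intro exI[of _ "C * D0 / (\<rho> / 8) / 2"]) (auto simp: f_zz_def mult_ac)
qed

section \<open>Linear invariance, distortion and growth\<close>

text \<open>
  A supremum of reals is an upper bound only for a bounded family, whence the appeal to the
  boundedness of the second coefficient.
\<close>

lemma f_zz_le_gamma_star:
  assumes "K \<ge> 1" "F \<in> S_H_qr K"
  shows "norm (f_zz F 0) \<le> 2 * gamma_star K"
proof -
  obtain M where "\<And>F. F \<in> S_H_qr K \<Longrightarrow> norm (f_zz F 0) / 2 \<le> M"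
    using S_H_qr_second_coeff_bounded[OF assms(1)] by blast
  then have "bdd_above ((\<lambda>F. norm (f_zz F 0) / 2) ` S_H_qr K)" by (rule bdd_aboveI2)
  from cSUP_upper[OF assms(2) this] show ?thesis by (simp add: gamma_star_def)
qed

lemma norm_mult_less_1: "norm a < 1 \<Longrightarrow> norm b < 1 \<Longrightarrow> norm (a * b) < 1" for a b :: complex
  using mult_strict_mono[of "norm a" 1 "norm b" 1] by (simp add: norm_mult)

text \<open>
  A univalent function is a harmonic map with g = 0, whose dilatation quotient is 1; the Koebe function
  is the one with the largest second coefficient.
\<close>

lemma koebe_in_S_H_qr:
  assumes K: "K \<ge> 1"
  shows "(\<lambda>z. z / (1 - z)\<^sup>2, \<lambda>z. 0) \<in> S_H_qr K" and "f_zz (\<lambda>z. z / (1 - z)\<^sup>2, \<lambda>z. 0) 0 = 4"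
proof -
  let ?k = "\<lambda>z::complex. z / (1 - z)\<^sup>2"
  have n1: "z \<noteq> 1" "1 - z \<noteq> 0" "1 + z \<noteq> 0" if "z \<in> ball 0 1" for z :: complex
    using that by (auto simp: add_eq_0_iff)
  have d1: "(?k has_field_derivative (1 + z) / (1 - z)^3) (at z)" if "z \<in> ball 0 1" for z
  proof -
    have "(?k has_field_derivative (1 * (1 - z)\<^sup>2 - z * (2 * (1 - z) * (0 - 1))) / ((1 - z)\<^sup>2 * (1 - z)\<^sup>2)) (at z)"
      using n1[OF that] by (auto intro!: derivative_eq_intros)
    moreover have "1 * (1 - z)\<^sup>2 - z * (2 * (1 - z) * (0 - 1)) = (1 + z) * (1 - z)"
      by (simp add: power2_eq_square algebra_simps)
    moreover have "(1 - z)\<^sup>2 * (1 - z)\<^sup>2 = (1 - z)^3 * (1 - z)"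
      by (simp add: power2_eq_square power3_eq_cube mult_ac)
    ultimately show ?thesis using n1[OF that] by simp
  qed
  have d1': "deriv ?k z = (1 + z) / (1 - z)^3" if "z \<in> ball 0 1" for z
    using d1[OF that] by (rule DERIV_imp_deriv)
  have "((\<lambda>z. (1 + z) / (1 - z)^3) has_field_derivative 4) (at (0::complex))"
    by (auto intro!: derivative_eq_intros)
  then have "(deriv ?k has_field_derivative 4) (at 0)"
    by (rule has_field_derivative_transform_within_open[where S="ball 0 1"]) (auto simp: d1')
  then show "f_zz (?k, \<lambda>z. 0) 0 = 4" by (simp add: f_zz_def DERIV_imp_deriv)
  have hol: "?k holomorphic_on ball 0 1" using n1 by (intro holomorphic_intros) auto
  have inj: "inj_on (harmonic_map (?k, \<lambda>z. 0)) (ball 0 1)"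
  proof (rule inj_onI)
    fix z w :: complex assume z: "z \<in> ball 0 1" and w: "w \<in> ball 0 1" and "harmonic_map (?k, \<lambda>z. 0) z = harmonic_map (?k, \<lambda>z. 0) w"
    then have "z * (1 - w)\<^sup>2 = w * (1 - z)\<^sup>2" using n1[OF z] n1[OF w] by (simp add: harmonic_map_def frac_eq_eq)
    then have "(z - w) * (1 - z * w) = 0" by (simp add: power2_eq_square algebra_simps)
    moreover have "norm (z * w) < 1" using z w by (intro norm_mult_less_1) auto
    then have "1 - z * w \<noteq> 0" by auto
    ultimately show "z = w" by simp
  qed
  have J: "Jac (?k, \<lambda>z. 0) z = (norm (deriv ?k z))\<^sup>2" "Lam (?k, \<lambda>z. 0) z = norm (deriv ?k z)" for z
    by (simp_all add: Jac_def Lam_def f_z_def f_zbar_def)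
  have "deriv ?k z \<noteq> 0" if "z \<in> ball 0 1" for z using n1[OF that] by (simp add: d1'[OF that])
  moreover have "(norm (deriv ?k z))\<^sup>2 \<le> K * (norm (deriv ?k z))\<^sup>2" for z
    using mult_right_mono[OF K, of "(norm (deriv ?k z))\<^sup>2"] by simp
  ultimately show "(?k, \<lambda>z. 0) \<in> S_H_qr K"
    unfolding S_H_qr_def S_H_def using hol inj K by (simp add: J d1')
qed

lemma gamma_star_ge_2:
  assumes "K \<ge> 1" shows "gamma_star K \<ge> 2"
  using f_zz_le_gamma_star[OF assms koebe_in_S_H_qr(1)[OF assms]] koebe_in_S_H_qr(2)[OF assms] by simp

lemma disc_automorphism:
  fixes \<zeta> :: complex
  assumes \<zeta>: "norm \<zeta> < 1"
  defines "\<phi> \<equiv> \<lambda>z. (z + \<zeta>) / (1 + cnj \<zeta> * z)"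
  shows "norm z < 1 \<Longrightarrow> norm (\<phi> z) < 1" "inj_on \<phi> (ball 0 1)" "norm z < 1 \<Longrightarrow> 1 + cnj \<zeta> * z \<noteq> 0"
    "norm z < 1 \<Longrightarrow> (\<phi> has_field_derivative (1 - (norm \<zeta>)^2) / (1 + cnj \<zeta> * z)\<^sup>2) (at z)"
proof -
  have nz: "1 + cnj \<zeta> * z \<noteq> 0" if "norm z < 1" for z
  proof -
    have "norm (cnj \<zeta> * z) < 1" using \<zeta> that by (intro norm_mult_less_1) auto
    then show ?thesis by (metis add_eq_0_iff norm_minus_cancel norm_one less_irrefl)
  qed
  then show "norm z < 1 \<Longrightarrow> 1 + cnj \<zeta> * z \<noteq> 0" .
  have n1: "1 - of_real ((norm \<zeta>)^2) \<noteq> (0::complex)"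
    using \<zeta> by (metis eq_iff_diff_eq_0 norm_ge_zero of_real_eq_1_iff power_one power2_eq_iff_nonneg zero_le_one less_irrefl)
  have eq: "\<phi> = Moebius_function 0 (- \<zeta>)" by (auto simp: \<phi>_def Moebius_function_def)
  show "norm z < 1 \<Longrightarrow> norm (\<phi> z) < 1"
    unfolding eq using \<zeta> by (intro Moebius_function_norm_lt_1) auto
  show "inj_on \<phi> (ball 0 1)"
  proof (rule inj_onI)
    fix x y assume x: "x \<in> ball 0 1" and y: "y \<in> ball 0 1" and "\<phi> x = \<phi> y"
    then have "(x + \<zeta>) * (1 + cnj \<zeta> * y) = (y + \<zeta>) * (1 + cnj \<zeta> * x)"
      using nz[of x] nz[of y] by (simp add: \<phi>_def frac_eq_eq)
    then have "(x - y) * (1 - \<zeta> * cnj \<zeta>) = 0" by (simp add: algebra_simps)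
    then show "x = y" using n1 unfolding complex_norm_square by simp
  qed
  show "(\<phi> has_field_derivative (1 - (norm \<zeta>)^2) / (1 + cnj \<zeta> * z)\<^sup>2) (at z)" if "norm z < 1"
  proof -
    have "(\<phi> has_field_derivative (1 * (1 + cnj \<zeta> * z) - (z + \<zeta>) * cnj \<zeta>) / ((1 + cnj \<zeta> * z) * (1 + cnj \<zeta> * z))) (at z)"
      unfolding \<phi>_def using nz[OF that] by (auto intro!: derivative_eq_intros)
    moreover have "1 * (1 + cnj \<zeta> * z) - (z + \<zeta>) * cnj \<zeta> = 1 - of_real ((norm \<zeta>)^2)"
      unfolding complex_norm_square by (simp add: algebra_simps)
    ultimately have "(\<phi> has_field_derivative (1 - of_real ((norm \<zeta>)^2)) / ((1 + cnj \<zeta> * z) * (1 + cnj \<zeta> * z))) (at z)"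
      by (simp only:)
    then show ?thesis by (simp add: power2_eq_square)
  qed
qed

text \<open>
  The Koebe transform of \<open>h + cnj g\<close> has \<open>H = (h \<circ> \<phi> - h \<zeta>) / c\<close> and \<open>G = (g \<circ> \<phi> - g \<zeta>) / cnj c\<close>; the
  conjugate makes \<open>H + cnj G\<close> an affine image of \<open>f \<circ> \<phi>\<close>. Both Wirtinger derivatives are multiplied by
  factors of the same modulus \<open>|\<phi>' / c|\<close>, so the quasiregularity inequality is preserved.
\<close>

lemma S_H_qr_linear_invariance:
  fixes h g :: "complex \<Rightarrow> complex"
  assumes F: "(h, g) \<in> S_H_qr K" and \<zeta>: "norm \<zeta> < 1"
  obtains H G where "(H, G) \<in> S_H_qr K"
    "deriv (deriv H) 0 = (1 - (norm \<zeta>)^2) * (deriv (deriv h) \<zeta> / deriv h \<zeta>) - 2 * cnj \<zeta>"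
proof -
  let ?D = "ball (0::complex) 1" and ?f = "harmonic_map (h, g)"
  have hol: "h holomorphic_on ?D" "g holomorphic_on ?D" and h0: "h 0 = 0" "g 0 = 0" "deriv h 0 = 1"
    and inj: "inj_on ?f ?D"
    and J: "\<And>z. z \<in> ?D \<Longrightarrow> 0 < Jac (h,g) z" and L: "\<And>z. z \<in> ?D \<Longrightarrow> (Lam (h,g) z)\<^sup>2 \<le> K * Jac (h,g) z"
    using F by (auto simp: S_H_qr_def S_H_def)
  define \<phi> where "\<phi> z = (z + \<zeta>) / (1 + cnj \<zeta> * z)" for z
  define \<phi>' where "\<phi>' z = (1 - (norm \<zeta>)^2) / (1 + cnj \<zeta> * z)\<^sup>2" for z
  note dis = disc_automorphism[OF \<zeta>, folded \<phi>_def, folded \<phi>'_def]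
  have \<phi>D: "\<phi> z \<in> ?D" if "z \<in> ?D" for z using dis(1)[of z] that by simp
  have \<zeta>D: "\<zeta> \<in> ?D" using \<zeta> by simp
  have hnz: "deriv h z \<noteq> 0" if "z \<in> ?D" for z
    using J[OF that] by (auto simp: Jac_def f_z_def)
  have lt1: "(norm \<zeta>)^2 < 1" using \<zeta> by (simp add: power_less_one_iff abs_square_less_1)
  have t0: "1 - of_real ((norm \<zeta>)^2) \<noteq> (0::complex)"
    using lt1 by (metis eq_iff_diff_eq_0 less_irrefl of_real_eq_1_iff)
  define c where "c = (1 - of_real ((norm \<zeta>)^2)) * deriv h \<zeta>"
  have c: "c \<noteq> 0" using t0 hnz[OF \<zeta>D] by (simp add: c_def)
  define H where "H z = (h (\<phi> z) - h \<zeta>) / c" for z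
  define G where "G z = (g (\<phi> z) - g \<zeta>) / cnj c" for z
  have dH: "(H has_field_derivative deriv h (\<phi> z) * \<phi>' z / c) (at z)" if z: "z \<in> ?D" for z
  proof -
    have "(h has_field_derivative deriv h (\<phi> z)) (at (\<phi> z))" using hol(1) \<phi>D[OF z] by (intro holomorphic_derivI) auto
    from DERIV_chain2[OF this dis(4)[of z]] z c show ?thesis
      unfolding H_def by (auto intro!: derivative_eq_intros)
  qed
  have dG: "(G has_field_derivative deriv g (\<phi> z) * \<phi>' z / cnj c) (at z)" if z: "z \<in> ?D" for z
  proof -
    have "(g has_field_derivative deriv g (\<phi> z)) (at (\<phi> z))" using hol(2) \<phi>D[OF z] by (intro holomorphic_derivI) auto
    from DERIV_chain2[OF this dis(4)[of z]] z c show ?thesis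
      unfolding G_def by (auto intro!: derivative_eq_intros)
  qed
  have dH': "deriv H z = deriv h (\<phi> z) * \<phi>' z / c" if "z \<in> ?D" for z using dH[OF that] by (rule DERIV_imp_deriv)
  have dG': "deriv G z = deriv g (\<phi> z) * \<phi>' z / cnj c" if "z \<in> ?D" for z using dG[OF that] by (rule DERIV_imp_deriv)
  have \<phi>0: "\<phi> 0 = \<zeta>" "\<phi>' 0 = 1 - of_real ((norm \<zeta>)^2)" by (simp_all add: \<phi>_def \<phi>'_def)
  have \<phi>'nz: "\<phi>' z \<noteq> 0" if "z \<in> ?D" for z using t0 dis(3)[of z] that by (auto simp: \<phi>'_def)
  have fHG: "harmonic_map (H, G) z = (?f (\<phi> z) - ?f \<zeta>) / c" for z
    by (simp add: harmonic_map_def H_def G_def add_divide_distrib diff_divide_distrib)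
  have "(H, G) \<in> S_H_qr K"
  proof -
    have "H holomorphic_on ?D" "G holomorphic_on ?D"
      unfolding holomorphic_on_open[OF open_ball] using dH dG by blast+
    moreover have "inj_on (harmonic_map (H, G)) ?D"
    proof (rule inj_onI)
      fix x y assume x: "x \<in> ?D" and y: "y \<in> ?D" and "harmonic_map (H, G) x = harmonic_map (H, G) y"
      then have "?f (\<phi> x) = ?f (\<phi> y)" using c by (simp add: fHG)
      then have "\<phi> x = \<phi> y" using inj_onD[OF inj] \<phi>D x y by blast
      then show "x = y" using inj_onD[OF dis(2)] x y by blast
    qed
    moreover have "0 < Jac (H, G) z \<and> (Lam (H, G) z)\<^sup>2 \<le> K * Jac (H, G) z" if z: "z \<in> ?D" for z
    proof -
      define s where "s = norm (\<phi>' z) / norm c"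
      have s: "s > 0" using c \<phi>'nz[OF z] by (simp add: s_def)
      have n: "norm (f_z (H,G) z) = s * norm (f_z (h,g) (\<phi> z))" "norm (f_zbar (H,G) z) = s * norm (f_zbar (h,g) (\<phi> z))"
        by (simp_all add: f_z_def f_zbar_def dH'[OF z] dG'[OF z] norm_mult norm_divide s_def)
      have Jeq: "Jac (H,G) z = s\<^sup>2 * Jac (h,g) (\<phi> z)"
        unfolding Jac_def n by (simp add: power_mult_distrib algebra_simps)
      have Leq: "(Lam (H,G) z)\<^sup>2 = s\<^sup>2 * (Lam (h,g) (\<phi> z))\<^sup>2"
        unfolding Lam_def n by (simp add: power_mult_distrib flip: distrib_left)
      have "s\<^sup>2 * (Lam (h,g) (\<phi> z))\<^sup>2 \<le> s\<^sup>2 * (K * Jac (h,g) (\<phi> z))" using L[OF \<phi>D[OF z]] by (intro mult_left_mono) auto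
      then show ?thesis using J[OF \<phi>D[OF z]] s unfolding Jeq Leq by (simp add: mult_ac)
    qed
    moreover have "H 0 = 0" "G 0 = 0" by (simp_all add: H_def G_def \<phi>0)
    moreover have "deriv H 0 = 1" using c by (simp add: dH' \<phi>0 c_def mult.commute)
    ultimately show ?thesis by (simp add: S_H_qr_def S_H_def)
  qed
  moreover have "deriv (deriv H) 0 = (1 - (norm \<zeta>)^2) * (deriv (deriv h) \<zeta> / deriv h \<zeta>) - 2 * cnj \<zeta>"
  proof -
    have h': "deriv h holomorphic_on ?D" using hol by (intro holomorphic_deriv) auto
    have 1: "((\<lambda>z. deriv h (\<phi> z)) has_field_derivative deriv (deriv h) \<zeta> * \<phi>' 0) (at 0)"
      using holomorphic_derivI[OF h' _ \<zeta>D] by (intro DERIV_chain2[OF _ dis(4)]) (auto simp: \<phi>0)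
    have 2: "(\<phi>' has_field_derivative - 2 * cnj \<zeta> * \<phi>' 0) (at 0)"
      unfolding \<phi>'_def by (auto intro!: derivative_eq_intros)
    have "((\<lambda>z. deriv h (\<phi> z) * \<phi>' z / c) has_field_derivative
        (deriv (deriv h) \<zeta> * \<phi>' 0 * \<phi>' 0 + deriv h \<zeta> * (- 2 * cnj \<zeta> * \<phi>' 0)) / c) (at 0)"
      using DERIV_cdivide[OF DERIV_mult[OF 1 2], of c] by (simp add: \<phi>0(1) mult_ac add_ac)
    then have "(deriv H has_field_derivative
        (deriv (deriv h) \<zeta> * \<phi>' 0 * \<phi>' 0 + deriv h \<zeta> * (- 2 * cnj \<zeta> * \<phi>' 0)) / c) (at 0)"
      by (rule has_field_derivative_transform_within_open[where S="?D"]) (auto simp: dH')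
    then have "deriv (deriv H) 0 = (deriv (deriv h) \<zeta> * \<phi>' 0 * \<phi>' 0 + deriv h \<zeta> * (- 2 * cnj \<zeta> * \<phi>' 0)) / c"
      by (rule DERIV_imp_deriv)
    also have "c = \<phi>' 0 * deriv h \<zeta>" by (simp add: c_def \<phi>0)
    also have "(deriv (deriv h) \<zeta> * \<phi>' 0 * \<phi>' 0 + deriv h \<zeta> * (- 2 * cnj \<zeta> * \<phi>' 0)) / (\<phi>' 0 * deriv h \<zeta>)
       = \<phi>' 0 * (deriv (deriv h) \<zeta> / deriv h \<zeta>) - 2 * cnj \<zeta>"
      using hnz[OF \<zeta>D] \<phi>'nz[of 0] by (simp add: field_simps)
    finally show ?thesis by (simp add: \<phi>0)
  qed
  ultimately show ?thesis using that by blast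
qed

text \<open>
  By linear invariance \<open>|(1 - t^2) e h''/h' - 2t| \<le> 2 \<gamma>\<close> at the point \<open>t e\<close> of the radius in direction e.
  So \<open>log |h'|\<close> grows along the radius at most at the rate \<open>(2 \<gamma> + 2 t) / (1 - t^2)\<close>, the derivative of
  \<open>- (\<gamma> + 1) log (1 - t) + (\<gamma> - 1) log (1 + t)\<close>.
\<close>

lemma S_H_qr_distortion:
  assumes K: "K \<ge> 1" and F: "(h, g) \<in> S_H_qr K" and z: "norm z < 1"
  shows "norm (deriv h z) \<le> 2 powr (gamma_star K - 1) * (1 - norm z) powr (- (gamma_star K + 1))"
proof -
  define \<gamma> where "\<gamma> = gamma_star K"
  have \<gamma>: "\<gamma> \<ge> 2" unfolding \<gamma>_def by (rule gamma_star_ge_2[OF K])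
  let ?D = "ball (0::complex) 1"
  have hol: "h holomorphic_on ?D" and h0: "deriv h 0 = 1" and J: "\<And>z. z \<in> ?D \<Longrightarrow> 0 < Jac (h,g) z"
    using F by (auto simp: S_H_qr_def S_H_def)
  have hnz: "deriv h z \<noteq> 0" if "z \<in> ?D" for z using J[OF that] by (auto simp: Jac_def f_z_def)
  have hol': "deriv h holomorphic_on ?D" using hol by (intro holomorphic_deriv) auto
  obtain L where L: "L holomorphic_on ?D" "\<And>z. z \<in> ?D \<Longrightarrow> exp (L z) = deriv h z"
    using holomorphic_logarithm_exists[of ?D "deriv h" 0] hol' hnz by auto
  have dL: "(L has_field_derivative deriv (deriv h) y / deriv h y) (at y)" if y: "y \<in> ?D" for y
  proof -
    have 1: "(L has_field_derivative deriv L y) (at y)" using L(1) y by (intro holomorphic_derivI) auto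
    have "((\<lambda>y. exp (L y)) has_field_derivative exp (L y) * deriv L y) (at y)"
      using DERIV_chain2[OF DERIV_exp 1] .
    then have "(deriv h has_field_derivative exp (L y) * deriv L y) (at y)"
      by (rule has_field_derivative_transform_within_open[where S="?D"]) (use y L in auto)
    then have "deriv (deriv h) y = deriv h y * deriv L y" using L(2)[OF y] DERIV_imp_deriv by metis
    then show ?thesis using 1 hnz[OF y] by simp
  qed
  define e where "e = (if z = 0 then 1 else sgn z)"
  define r where "r = norm z"
  have e: "norm e = 1" by (simp add: e_def norm_sgn)
  have ze: "z = of_real r * e" by (auto simp: e_def r_def sgn_eq)
  have r: "0 \<le> r" "r < 1" using z by (auto simp: r_def)
  have te: "of_real t * e \<in> ?D" "norm (of_real t * e) = t" if "t \<in> {0..r}" for t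
    using that r e by (auto simp: norm_mult)
  define v where "v t = - (\<gamma> + 1) * ln (1 - t) + (\<gamma> - 1) * ln (1 + t) - Re (L (of_real t * e))" for t
  have "v 0 \<le> v r"
  proof (rule DERIV_nonneg_imp_nondecreasing[OF r(1)])
    fix t assume t: "0 \<le> t" "t \<le> r"
    then have t': "t \<in> {0..r}" by simp
    let ?l = "deriv (deriv h) (of_real t * e) / deriv h (of_real t * e)"
    \<comment> \<open>The chain rule along the radius gives the derivative of \<open>log |h'|\<close>, the real part of L.\<close>
    have "((\<lambda>t. of_real t * e) has_vector_derivative e) (at t)"
      unfolding has_vector_derivative_def by (auto intro!: derivative_eq_intros simp: scaleR_conv_of_real)
    then have "((\<lambda>t. L (of_real t * e)) has_vector_derivative e * ?l) (at t)"
      using field_vector_diff_chain_at[of "\<lambda>t. of_real t * e" e t L ?l] dL[OF te(1)[OF t']]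
      by (simp add: o_def)
    then have "((\<lambda>t. Re (L (of_real t * e))) has_vector_derivative Re (e * ?l)) (at t)"
      by (rule bounded_linear.has_vector_derivative[OF bounded_linear_Re])
    then have 1: "((\<lambda>t. Re (L (of_real t * e))) has_field_derivative Re (e * ?l)) (at t)"
      by (simp add: has_real_derivative_iff_has_vector_derivative)
    have 2: "(v has_field_derivative (\<gamma> + 1) / (1 - t) + (\<gamma> - 1) / (1 + t) - Re (e * ?l)) (at t)"
    proof -
      have "((\<lambda>t. - (\<gamma> + 1) * ln (1 - t) + (\<gamma> - 1) * ln (1 + t)) has_field_derivative
          - (\<gamma> + 1) * (- 1 / (1 - t)) + (\<gamma> - 1) * (1 / (1 + t))) (at t)"
        using t r by (auto intro!: derivative_eq_intros)
      moreover have "- (\<gamma> + 1) * (- 1 / (1 - t)) + (\<gamma> - 1) * (1 / (1 + t)) = (\<gamma> + 1) / (1 - t) + (\<gamma> - 1) / (1 + t)"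
      proof -
        have "- a * (- 1 / b) = a / b" for a b :: real by simp
        then show ?thesis by (simp only: times_divide_eq_right mult_1_right)
      qed
      ultimately have "((\<lambda>t. - (\<gamma> + 1) * ln (1 - t) + (\<gamma> - 1) * ln (1 + t)) has_field_derivative
          (\<gamma> + 1) / (1 - t) + (\<gamma> - 1) / (1 + t)) (at t)" by (simp only:)
      from DERIV_diff[OF this 1] show ?thesis unfolding v_def .
    qed
    obtain H G where HG: "(H, G) \<in> S_H_qr K" "deriv (deriv H) 0 = (1 - (norm (of_real t * e))\<^sup>2) * ?l - 2 * cnj (of_real t * e)"
      using S_H_qr_linear_invariance[OF F, of "of_real t * e"] te[OF t'] by auto
    have "norm (deriv (deriv H) 0) \<le> 2 * \<gamma>"
      using f_zz_le_gamma_star[OF K HG(1)] by (simp add: f_zz_def \<gamma>_def)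
    moreover have "e * cnj e = 1" using e by (simp add: complex_norm_square[symmetric])
    then have "e * deriv (deriv H) 0 = of_real (1 - t\<^sup>2) * (e * ?l) - of_real (2 * t)"
      unfolding HG(2) te(2)[OF t'] by (simp add: algebra_simps)
    then have "norm (of_real (1 - t\<^sup>2) * (e * ?l) - of_real (2 * t)) = norm (deriv (deriv H) 0)"
      using e by (metis mult_1 norm_mult)
    moreover have "Re (of_real (1 - t\<^sup>2) * (e * ?l) - of_real (2 * t)) = (1 - t\<^sup>2) * Re (e * ?l) - 2 * t"
    proof -
      have "Re (of_real a * w - of_real b) = a * Re w - b" for a b w by simp
      then show ?thesis .
    qed
    moreover note complex_Re_le_cmod[of "of_real (1 - t\<^sup>2) * (e * ?l) - of_real (2 * t)"]
    ultimately have 3: "(1 - t\<^sup>2) * Re (e * ?l) - 2 * t \<le> 2 * \<gamma>" by linarith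
    have pos: "1 - t > 0" "1 + t > 0" using t r by auto
    have "(\<gamma> + 1) / (1 - t) + (\<gamma> - 1) / (1 + t) = (2 * \<gamma> + 2 * t) / (1 - t\<^sup>2)"
      using pos by (simp add: power2_eq_square add_frac_eq algebra_simps)
    moreover have "1 - t\<^sup>2 > 0" using mult_pos_pos[OF pos] by (simp add: power2_eq_square algebra_simps)
    then have "Re (e * ?l) \<le> (2 * \<gamma> + 2 * t) / (1 - t\<^sup>2)" using 3 by (simp add: pos_le_divide_eq mult.commute)
    ultimately show "\<exists>y. (v has_real_derivative y) (at t) \<and> 0 \<le> y" using 2 by (intro exI conjI) auto
  qed
  moreover have "v 0 = 0"
  proof -
    have "exp (Re (L 0)) = 1" using L(2)[of 0] h0 by (metis norm_exp_eq_Re centre_in_ball norm_one zero_less_one)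
    then show ?thesis by (simp add: v_def)
  qed
  ultimately have "Re (L z) \<le> - (\<gamma> + 1) * ln (1 - r) + (\<gamma> - 1) * ln (1 + r)" by (simp add: v_def ze[symmetric])
  also have "\<dots> \<le> - (\<gamma> + 1) * ln (1 - r) + (\<gamma> - 1) * ln 2"
    using r \<gamma> by (intro add_left_mono mult_left_mono) auto
  finally have "exp (Re (L z)) \<le> exp (- (\<gamma> + 1) * ln (1 - r) + (\<gamma> - 1) * ln 2)" by simp
  moreover have "norm (deriv h z) = exp (Re (L z))" using L(2)[of z] z by (metis norm_exp_eq_Re mem_ball_0)
  moreover have "exp (- (\<gamma> + 1) * ln (1 - r) + (\<gamma> - 1) * ln 2) = 2 powr (\<gamma> - 1) * (1 - r) powr (- (\<gamma> + 1))"
    using r by (simp add: powr_def exp_add[symmetric] algebra_simps)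
  ultimately have "norm (deriv h z) \<le> 2 powr (\<gamma> - 1) * (1 - r) powr (- (\<gamma> + 1))" by linarith
  then show ?thesis unfolding \<gamma>_def r_def .
qed

lemma S_H_qr_growth:
  assumes K: "K \<ge> 1" and F: "(h, g) \<in> S_H_qr K" and z: "norm z < 1"
  shows "norm (harmonic_map (h, g) z) \<le> 2 powr gamma_star K / gamma_star K * (1 - norm z) powr (- gamma_star K)"
proof -
  define \<gamma> where "\<gamma> = gamma_star K"
  have \<gamma>: "\<gamma> \<ge> 2" unfolding \<gamma>_def by (rule gamma_star_ge_2[OF K])
  let ?f = "harmonic_map (h, g)"
  have qc: "qc_map K ?f (deriv h) (\<lambda>z. cnj (deriv g z)) (ball 0 1)" by (rule S_H_qr_qc_map[OF F])
  then have C: "C1_wirtinger ?f (deriv h) (\<lambda>z. cnj (deriv g z)) (ball 0 1)" by (simp add: qc_map_def)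
  have f0: "?f 0 = 0" using F by (simp add: S_H_qr_def S_H_def harmonic_map_def)
  define e where "e = (if z = 0 then 1 else sgn z)"
  define r where "r = norm z"
  have e: "norm e = 1" by (simp add: e_def norm_sgn)
  have ze: "z = of_real r * e" by (auto simp: e_def r_def sgn_eq)
  have r: "0 \<le> r" "r < 1" using z by (auto simp: r_def)
  have te: "of_real t * e \<in> ball 0 1" "norm (of_real t * e) = t" if "t \<in> {0..r}" for t
    using that r e by (auto simp: norm_mult)
  let ?b = "\<lambda>t. 2 powr \<gamma> * (1 - t) powr (- (\<gamma> + 1))"
  have hi: "(?b has_integral 2 powr \<gamma> / \<gamma> * (1 - r) powr (- \<gamma>) - 2 powr \<gamma> / \<gamma> * (1 - 0) powr (- \<gamma>)) {0..r}"
  proof (rule fundamental_theorem_of_calculus[OF r(1)])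
    fix t assume "t \<in> {0..r}"
    then have "t < 1" using r by auto
    then show "((\<lambda>t. 2 powr \<gamma> / \<gamma> * (1 - t) powr (- \<gamma>)) has_vector_derivative ?b t) (at t within {0..r})"
      unfolding has_real_derivative_iff_has_vector_derivative[symmetric]
      using \<gamma> by (auto intro!: derivative_eq_intros)
  qed
  let ?L = "\<lambda>z. norm (deriv h z) + norm (cnj (deriv g z))"
  have "norm (?f (of_real r * e) - ?f (of_real 0 * e)) \<le> integral {0..r} (\<lambda>t. ?L (of_real t * e) * norm e)"
    by (rule C1_wirtinger_path_le[OF C r(1)])
       (use r in \<open>auto simp: te has_vector_derivative_def scaleR_conv_of_real intro!: derivative_eq_intros continuous_intros simp del: mem_ball\<close>)
  also have "\<dots> \<le> integral {0..r} ?b"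
  proof (rule integral_le)
    have cL: "continuous_on (ball 0 1) ?L"
    proof (intro continuous_on_add continuous_on_norm)
      show "continuous_on (ball 0 1) (deriv h)" "continuous_on (ball 0 1) (\<lambda>z. cnj (deriv g z))"
        using C unfolding C1_wirtinger_def by blast+
    qed
    have "continuous_on {0..r} (\<lambda>t. ?L (of_real t * e))"
      by (rule continuous_on_compose2[OF cL]) (use r in \<open>auto intro!: continuous_intros simp: te simp del: mem_ball\<close>)
    then show "(\<lambda>t. ?L (of_real t * e) * norm e) integrable_on {0..r}"
      by (intro integrable_continuous_interval continuous_on_mult continuous_on_const)
    show "?b integrable_on {0..r}" using hi by blast
    fix t assume t: "t \<in> {0..r}"
    have "norm (cnj (deriv g (of_real t * e))) \<le> norm (deriv h (of_real t * e))"
      using qc te(1)[OF t] unfolding qc_map_def by (meson less_imp_le)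
    then have "?L (of_real t * e) \<le> 2 * norm (deriv h (of_real t * e))" by simp
    also have "\<dots> \<le> 2 * (2 powr (\<gamma> - 1) * (1 - t) powr (- (\<gamma> + 1)))"
      using S_H_qr_distortion[OF K F, of "of_real t * e"] te[OF t] by (simp add: \<gamma>_def)
    also have "\<dots> = ?b t" by (simp add: powr_diff)
    finally show "?L (of_real t * e) * norm e \<le> ?b t" using e by simp
  qed
  also have "\<dots> \<le> 2 powr \<gamma> / \<gamma> * (1 - r) powr (- \<gamma>)" using integral_unique[OF hi] \<gamma> by simp
  finally have "norm (?f (of_real r * e)) \<le> 2 powr \<gamma> / \<gamma> * (1 - r) powr (- \<gamma>)" using f0 by simp
  then show ?thesis unfolding ze[symmetric] unfolding \<gamma>_def r_def .
qed

section \<open>Integral means\<close>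

text \<open>
  Along a radius \<open>|f|^(p/2)\<close> changes at most at the rate \<open>(p/2) |f|^(p/2-1) (|A| + |B|)\<close>. With the exponent
  p/2, the square of the function is the integrand of the mean of order p, and the square of this rate
  is the density of the weighted area.
\<close>

lemma radial_power_increment_le:
  fixes p :: real
  assumes f: "qc_map K f A B (ball 0 1)" and f0: "f 0 = 0" and ab: "0 < a" "a < b" "b < 1"
  shows "(norm (f (of_real b * cis \<theta>)) powr (p / 2) - norm (f (of_real a * cis \<theta>)) powr (p / 2))\<^sup>2 \<le>
     (b - a) * (p\<^sup>2 / 4 * integral {a..b} (\<lambda>t. (norm (A (of_real t * cis \<theta>)) + norm (B (of_real t * cis \<theta>)))^2
         * norm (f (of_real t * cis \<theta>)) powr (p - 2)))"
proof -
  let ?\<gamma> = "\<lambda>t. of_real t * cis \<theta>"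
  let ?L = "\<lambda>t. norm (A (?\<gamma> t)) + norm (B (?\<gamma> t))"
  let ?n = "\<lambda>t. norm (f (?\<gamma> t))"
  have C: "C1_wirtinger f A B (ball 0 1)" and inj: "inj_on f (ball 0 1)" using f by (auto simp: qc_map_def)
  have g1: "?\<gamma> t \<in> ball 0 1" if "t \<in> {a..b}" for t using that ab by (simp add: norm_mult)
  have nz: "f (?\<gamma> t) \<noteq> 0" if t: "t \<in> {a..b}" for t
  proof
    assume "f (?\<gamma> t) = 0"
    then have "?\<gamma> t = 0" using inj_onD[OF inj, of "?\<gamma> t" 0] g1[OF t] f0 by simp
    then show False using t ab by simp
  qed
  have cA: "continuous_on (ball 0 1) A" and cB: "continuous_on (ball 0 1) B"
    and derf: "\<And>z. z \<in> ball 0 1 \<Longrightarrow> (f has_derivative (\<lambda>v. A z * v + B z * cnj v)) (at z)"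
    using C by (auto simp: C1_wirtinger_def)
  have c\<gamma>: "continuous_on {a..b} ?\<gamma>" by (intro continuous_intros)
  have im: "?\<gamma> ` {a..b} \<subseteq> ball 0 1" using g1 by blast
  note cs = continuous_on_compose2[OF cA c\<gamma> im] continuous_on_compose2[OF cB c\<gamma> im]
    continuous_on_compose2[OF C1_wirtinger_cont[OF C] c\<gamma> im]
  let ?D = "\<lambda>t. A (?\<gamma> t) * cis \<theta> + B (?\<gamma> t) * cnj (cis \<theta>)"
  have nD: "norm (?D t) \<le> ?L t" for t
    using norm_triangle_ineq[of "A (?\<gamma> t) * cis \<theta>" "B (?\<gamma> t) * cnj (cis \<theta>)"] by (simp add: norm_mult)
  let ?u' = "\<lambda>t. inner (?D t) (sgn (f (?\<gamma> t))) * (p / 2 * ?n t powr (p / 2 - 1))"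
  have du: "((\<lambda>t. ?n t powr (p / 2)) has_vector_derivative ?u' t) (at t within {a..b})" if t: "t \<in> {a..b}" for t
  proof -
    have "(?\<gamma> has_derivative (\<lambda>s. of_real s * cis \<theta>)) (at t)" by (auto intro!: derivative_eq_intros)
    from has_derivative_compose[OF this derf[OF g1[OF t]]]
    have "((\<lambda>t. f (?\<gamma> t)) has_derivative (\<lambda>s. s *\<^sub>R ?D t)) (at t)"
      by (simp add: scaleR_conv_of_real algebra_simps)
    moreover have "(norm has_derivative (\<lambda>h. inner h (sgn (f (?\<gamma> t))))) (at (f (?\<gamma> t)))"
      using GDERIV_norm[OF nz[OF t]] by (simp add: gderiv_def)
    ultimately have "(?n has_derivative (\<lambda>s. inner (s *\<^sub>R ?D t) (sgn (f (?\<gamma> t))))) (at t)"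
      by (rule has_derivative_compose)
    then have dn: "(?n has_real_derivative inner (?D t) (sgn (f (?\<gamma> t)))) (at t)"
      by (rule has_derivative_imp_has_field_derivative) simp
    have dp: "((\<lambda>x. x powr (p / 2)) has_real_derivative p / 2 * ?n t powr (p / 2 - 1)) (at (?n t))"
      using nz[OF t] by (intro has_real_derivative_powr) simp
    have "((\<lambda>t. ?n t powr (p / 2)) has_real_derivative (p / 2 * ?n t powr (p / 2 - 1)) * inner (?D t) (sgn (f (?\<gamma> t)))) (at t)"
      by (rule DERIV_chain2[OF dp dn])
    then show ?thesis
      by (simp add: has_real_derivative_iff_has_vector_derivative mult.commute has_vector_derivative_at_within)
  qed
  let ?v = "\<lambda>t. \<bar>p\<bar> / 2 * (?n t powr (p / 2 - 1) * ?L t)"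
  have cv: "continuous_on {a..b} ?v" using nz by (intro continuous_intros cs) auto
  have hi: "(?u' has_integral (?n b powr (p / 2) - ?n a powr (p / 2))) {a..b}"
    using du ab by (intro fundamental_theorem_of_calculus) auto
  have "norm (integral {a..b} ?u') \<le> integral {a..b} ?v"
  proof (rule integral_norm_bound_integral)
    show "?u' integrable_on {a..b}" using hi by blast
    show "?v integrable_on {a..b}" by (intro integrable_continuous_interval cv)
    fix t
    have "\<bar>inner (?D t) (sgn (f (?\<gamma> t)))\<bar> \<le> norm (?D t) * norm (sgn (f (?\<gamma> t)))" by (rule Cauchy_Schwarz_ineq2)
    also have "\<dots> \<le> ?L t * 1" using nD by (intro mult_mono) (auto simp: norm_sgn)
    finally have "\<bar>inner (?D t) (sgn (f (?\<gamma> t)))\<bar> * (\<bar>p\<bar> / 2 * ?n t powr (p / 2 - 1)) \<le> ?L t * (\<bar>p\<bar> / 2 * ?n t powr (p / 2 - 1))"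
      by (intro mult_right_mono) auto
    then show "norm (?u' t) \<le> ?v t" by (simp add: abs_mult mult_ac)
  qed
  then have "\<bar>?n b powr (p / 2) - ?n a powr (p / 2)\<bar> \<le> \<bar>integral {a..b} ?v\<bar>"
    unfolding integral_unique[OF hi] real_norm_def by (rule order_trans[OF _ abs_ge_self])
  then have "(?n b powr (p / 2) - ?n a powr (p / 2))\<^sup>2 \<le> (integral {a..b} ?v)\<^sup>2"
    by (simp only: abs_le_square_iff)
  also have "\<dots> \<le> (b - a) * integral {a..b} (\<lambda>t. (?v t)\<^sup>2)"
    using ab(2) by (rule integral_square_le[OF _ cv])
  also have "integral {a..b} (\<lambda>t. (?v t)\<^sup>2) = integral {a..b} (\<lambda>t. p\<^sup>2 / 4 * ((?L t)\<^sup>2 * ?n t powr (p - 2)))"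
  proof (rule integral_cong)
    fix t assume "t \<in> {a..b}"
    have "(?n t powr (p / 2 - 1))\<^sup>2 = ?n t powr (p - 2)"
      by (simp add: power2_eq_square powr_add[symmetric])
    then show "(?v t)\<^sup>2 = p\<^sup>2 / 4 * ((?L t)\<^sup>2 * ?n t powr (p - 2))"
      by (simp add: power_mult_distrib power_divide mult_ac)
  qed
  also have "\<dots> = p\<^sup>2 / 4 * integral {a..b} (\<lambda>t. (?L t)\<^sup>2 * ?n t powr (p - 2))" by (rule integral_mult_right)
  finally show ?thesis .
qed

text \<open>
  For \<open>x = |f|^(p/2)\<close> at radius \<open>a\<close> and y at radius b, the inequality
  \<open>y^2 \<le> (1 + \<epsilon>) x^2 + (1 + 1/\<epsilon>) (y - x)^2\<close> is integrated over the angle: the increment contributes a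
  weighted area, and the freedom in \<epsilon> allows a factor in front of the old mean as close to 1 as desired.
\<close>

lemma integral_mean_step:
  fixes p :: real
  assumes f: "qc_map K f A B (ball 0 1)" and K: "K \<ge> 0" and f0: "f 0 = 0" and ab: "1/2 \<le> a" "a < b" "b < 1"
    and p: "p > 0" and e: "\<epsilon> > 0" and M: "\<And>z. norm z \<le> b \<Longrightarrow> norm (f z) < M"
  shows "integral {0..2*pi} (\<lambda>\<theta>. norm (f (of_real b * cis \<theta>)) powr p) \<le>
     (1 + \<epsilon>) * integral {0..2*pi} (\<lambda>\<theta>. norm (f (of_real a * cis \<theta>)) powr p)
     + (1 + 1 / \<epsilon>) * (p * pi * K * (b - a) * M powr p)"
proof -
  let ?X = "{z. a \<le> dist 0 z \<and> dist 0 z \<le> b}"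
  let ?W = "\<lambda>z. (norm (A z) + norm (B z))^2 * norm (f z) powr (p - 2)"
  have C: "C1_wirtinger f A B (ball 0 1)" and inj: "inj_on f (ball 0 1)" using f by (auto simp: qc_map_def)
  have X: "?X \<subseteq> ball 0 1" using ab by auto
  have a0: "0 \<le> a" using ab by simp
  have nz: "f z \<noteq> 0" if "z \<in> ?X" for z
  proof
    assume "f z = 0"
    then have "z = 0" using inj_onD[OF inj, of z 0] that X f0 ab by auto
    then show False using that ab by simp
  qed
  have cA: "continuous_on ?X A" and cB: "continuous_on ?X B"
    by (rule continuous_on_subset[OF _ X]; use C in \<open>simp add: C1_wirtinger_def\<close>)+
  have cf: "continuous_on ?X f" by (rule continuous_on_subset[OF C1_wirtinger_cont[OF C] X])
  have cW: "continuous_on ?X ?W" using nz by (intro continuous_intros cA cB cf) auto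
  have cp: "continuous_on ?X (\<lambda>z. norm (f z) powr p)" using nz by (intro continuous_intros cf) auto
  have cT: "continuous_on T (\<lambda>\<theta>. norm (f (of_real r * cis \<theta>)) powr p)" if "r \<in> {a..b}" for r T
    using continuous_on_circle[OF cp a0 that] by simp
  define Q where "Q \<theta> = integral {a..b} (\<lambda>t. ?W (of_real t * cis \<theta>))" for \<theta>
  have c2: "continuous_on (cbox (a, 0) (b, 2 * pi)) (\<lambda>(t,\<theta>). ?W (of_real t * cis \<theta>))"
    unfolding cbox_Pair_eq unfolding cbox_interval using continuous_on_polar[OF cW a0, of "{0..2*pi}"] by simp
  have c2': "continuous_on ({0..2*pi} \<times> cbox a b) (\<lambda>(\<theta>,t). ?W (of_real t * cis \<theta>))"
    using continuous_on_swap_args[OF continuous_on_polar[OF cW a0, of "{0..2*pi}"]] by (simp add: cbox_interval)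
  have cQ: "continuous_on {0..2*pi} Q"
    using integral_continuous_on_param[OF c2'] unfolding Q_def by (simp add: cbox_interval)
  let ?R = "(1 + 1 / \<epsilon>) * ((b - a) * (p\<^sup>2 / 4))"
  have pw: "norm (f (of_real b * cis \<theta>)) powr p \<le> (1 + \<epsilon>) * norm (f (of_real a * cis \<theta>)) powr p + ?R * Q \<theta>" for \<theta>
  proof -
    define x where "x = norm (f (of_real a * cis \<theta>)) powr (p / 2)"
    define y where "y = norm (f (of_real b * cis \<theta>)) powr (p / 2)"
    have x2: "x\<^sup>2 = norm (f (of_real a * cis \<theta>)) powr p" and y2: "y\<^sup>2 = norm (f (of_real b * cis \<theta>)) powr p"
      by (simp_all add: x_def y_def power2_eq_square powr_add[symmetric])
    have "(y - x)\<^sup>2 \<le> (b - a) * (p\<^sup>2 / 4 * Q \<theta>)"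
      unfolding x_def y_def Q_def using ab by (intro radial_power_increment_le[OF f f0]) auto
    then have "(1 + 1 / \<epsilon>) * (y - x)\<^sup>2 \<le> (1 + 1 / \<epsilon>) * ((b - a) * (p\<^sup>2 / 4 * Q \<theta>))"
      using e by (intro mult_left_mono) auto
    moreover have "y\<^sup>2 \<le> (1 + \<epsilon>) * x\<^sup>2 + (1 + 1 / \<epsilon>) * (y - x)\<^sup>2"
    proof -
      have "(1 + \<epsilon>) * x\<^sup>2 + (1 + 1 / \<epsilon>) * (y - x)\<^sup>2 - y\<^sup>2 = (\<epsilon> * x - (y - x))\<^sup>2 / \<epsilon>"
        using e by (simp add: field_simps power2_eq_square)
      moreover have "(\<epsilon> * x - (y - x))\<^sup>2 / \<epsilon> \<ge> 0" using e by simp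
      ultimately show ?thesis by linarith
    qed
    moreover have "(1 + 1 / \<epsilon>) * ((b - a) * (p\<^sup>2 / 4 * Q \<theta>)) = ?R * Q \<theta>" by (simp only: mult.assoc)
    ultimately show ?thesis unfolding x2 y2 by linarith
  qed
  have "integral {0..2*pi} (\<lambda>\<theta>. norm (f (of_real b * cis \<theta>)) powr p) \<le>
        integral {0..2*pi} (\<lambda>\<theta>. (1 + \<epsilon>) * norm (f (of_real a * cis \<theta>)) powr p + ?R * Q \<theta>)"
    using ab by (intro integral_le pw integrable_continuous_interval continuous_on_add continuous_on_mult continuous_on_const cT cQ) auto
  also have "\<dots> = (1 + \<epsilon>) * integral {0..2*pi} (\<lambda>\<theta>. norm (f (of_real a * cis \<theta>)) powr p) + ?R * integral {0..2*pi} Q"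
    using ab by (subst integral_add) (auto intro!: integrable_continuous_interval continuous_on_mult continuous_on_const cT cQ)
  also have "?R * integral {0..2*pi} Q \<le> ?R * (2 * (K * (2 * pi * M powr p / p)))"
  proof (rule mult_left_mono)
    have "integral {0..2*pi} Q = integral {a..b} (\<lambda>t. integral {0..2*pi} (\<lambda>\<theta>. ?W (of_real t * cis \<theta>)))"
      unfolding Q_def using integral_swap_continuous[OF c2] by (simp add: cbox_interval)
    also have "\<dots> \<le> integral {a..b} (\<lambda>t. 2 * (t * integral {0..2*pi} (\<lambda>\<theta>. ?W (of_real t * cis \<theta>))))"
    proof (rule integral_le)
      have cI: "continuous_on {a..b} (\<lambda>t. integral {0..2*pi} (\<lambda>\<theta>. ?W (of_real t * cis \<theta>)))"
        using continuous_on_circle_integral[OF cW a0] by simp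
      then show "(\<lambda>t. integral {0..2*pi} (\<lambda>\<theta>. ?W (of_real t * cis \<theta>))) integrable_on {a..b}"
        "(\<lambda>t. 2 * (t * integral {0..2*pi} (\<lambda>\<theta>. ?W (of_real t * cis \<theta>)))) integrable_on {a..b}"
        by (intro integrable_continuous_interval continuous_on_mult continuous_on_const continuous_on_id; simp)+
      fix t assume t: "t \<in> {a..b}"
      have "0 \<le> integral {0..2*pi} (\<lambda>\<theta>. ?W (of_real t * cis \<theta>))"
        using continuous_on_circle[OF cW a0 t] by (intro integral_nonneg integrable_continuous_interval) auto
      then have "1 * integral {0..2*pi} (\<lambda>\<theta>. ?W (of_real t * cis \<theta>)) \<le> (2 * t) * integral {0..2*pi} (\<lambda>\<theta>. ?W (of_real t * cis \<theta>))"
        using t ab by (intro mult_right_mono) auto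
      then show "integral {0..2*pi} (\<lambda>\<theta>. ?W (of_real t * cis \<theta>)) \<le> 2 * (t * integral {0..2*pi} (\<lambda>\<theta>. ?W (of_real t * cis \<theta>)))"
        by (simp add: mult.assoc)
    qed
    also have "\<dots> = 2 * integral {a..b} (\<lambda>t. t * integral {0..2*pi} (\<lambda>\<theta>. ?W (of_real t * cis \<theta>)))"
      by (rule integral_mult_right)
    also have "integral {a..b} (\<lambda>t. t * integral {0..2*pi} (\<lambda>\<theta>. ?W (of_real t * cis \<theta>))) \<le> K * (2 * pi * M powr p / p)"
      using qc_map_polar_weighted_area_le[OF _ ab(2) f, where c=0 and p=p and M=M] ab nz M p K by auto
    finally show "integral {0..2*pi} Q \<le> 2 * (K * (2 * pi * M powr p / p))" by simp
    show "0 \<le> ?R" using e ab by auto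
  qed
  also have "?R * (2 * (K * (2 * pi * M powr p / p))) = (1 + 1 / \<epsilon>) * (p * pi * K * (b - a) * M powr p)"
    using p by (simp add: field_simps power2_eq_square)
  finally show ?thesis by simp
qed

text \<open>
  The step from \<open>2r - 1\<close> to r is iterated, with \<open>1 + \<epsilon> = 2^(\<beta>/2)\<close> for \<open>\<beta> = \<gamma> p - 1\<close>. The bound
  \<open>C (1 - r)^(-\<beta>)\<close> itself grows by \<open>2^\<beta>\<close> in such a step, which leaves room for the new term
  once C is large. The constant depends on K and p only, as the coefficient bound requires.
\<close>

lemma S_H_qr_integral_mean:
  assumes K: "K \<ge> 1" and p: "p > 1 / gamma_star K"
  shows "\<exists>C>0. \<forall>h g. (h, g) \<in> S_H_qr K \<longrightarrow> (\<forall>r. 1/2 \<le> r \<longrightarrow> r < 1 \<longrightarrow>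
     integral {0..2*pi} (\<lambda>\<theta>. norm (harmonic_map (h, g) (of_real r * cis \<theta>)) powr p)
       \<le> C * (1 - r) powr (1 - gamma_star K * p))"
proof -
  define \<gamma> where "\<gamma> = gamma_star K"
  have \<gamma>: "\<gamma> \<ge> 2" unfolding \<gamma>_def by (rule gamma_star_ge_2[OF K])
  define \<beta> where "\<beta> = \<gamma> * p - 1"
  have p\<gamma>: "p > 1 / \<gamma>" using p by (simp add: \<gamma>_def)
  then have \<beta>: "\<beta> > 0" using \<gamma> by (simp add: \<beta>_def field_simps)
  have p0: "p > 0" using p\<gamma> \<gamma> by (meson divide_pos_pos less_trans zero_less_one order_less_le_trans zero_less_numeral)
  define c where "c = 2 powr \<gamma> / \<gamma>"
  have c: "c > 0" using \<gamma> by (simp add: c_def)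
  define q where "q = 2 powr (\<beta> / 2)"
  have q: "q > 1" using \<beta> by (simp add: q_def)
  define C' where "C' = (1 + 1 / (q - 1)) * (p * pi * K * (2 * c) powr p)"
  define C0 where "C0 = 2 * pi * (c * (1/4) powr (- \<gamma>)) powr p"
  define C where "C = max C0 (C' / (1 - 1 / q))"
  have C0: "C0 > 0" using c by (simp add: C0_def)
  have C: "C \<ge> C0" "C / q + C' \<le> C"
  proof -
    have "C \<ge> C' / (1 - 1 / q)" by (simp add: C_def)
    moreover have "1 - 1 / q > 0" using q by simp
    ultimately have "C' \<le> C * (1 - 1 / q)" by (simp add: pos_divide_le_eq)
    then show "C / q + C' \<le> C" by (simp add: algebra_simps)
  qed (simp add: C_def)
  have "integral {0..2*pi} (\<lambda>\<theta>. norm (harmonic_map (h, g) (of_real r * cis \<theta>)) powr p) \<le> C * (1 - r) powr (- \<beta>)"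
    if F: "(h, g) \<in> S_H_qr K" and r: "1/2 \<le> r" "r < 1" for h g r
  proof -
    let ?f = "harmonic_map (h, g)"
    let ?I = "\<lambda>r. integral {0..2*pi} (\<lambda>\<theta>. norm (?f (of_real r * cis \<theta>)) powr p)"
    have qc: "qc_map K ?f (deriv h) (\<lambda>z. cnj (deriv g z)) (ball 0 1)" by (rule S_H_qr_qc_map[OF F])
    then have cont: "continuous_on (ball 0 1) ?f" by (auto simp: qc_map_def intro: C1_wirtinger_cont)
    have f0: "?f 0 = 0" using F by (simp add: S_H_qr_def S_H_def harmonic_map_def)
    have gr: "norm (?f z) \<le> c * (1 - norm z) powr (- \<gamma>)" if "norm z < 1" for z
      using S_H_qr_growth[OF K F that] by (simp add: c_def \<gamma>_def)
    have gr': "norm (?f z) \<le> c * (1 - b) powr (- \<gamma>)" if "norm z \<le> b" "b < 1" for z b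
    proof -
      have "(1 - norm z) powr (- \<gamma>) \<le> (1 - b) powr (- \<gamma>)" using that \<gamma> by (intro powr_mono2') auto
      then show ?thesis using gr[of z] that c by (smt (verit) mult_left_mono)
    qed
    have base: "?I r \<le> C * (1 - r) powr (- \<beta>)" if r: "1/2 \<le> r" "r \<le> 3/4" for r
    proof -
      have "?I r \<le> integral {0..2*pi} (\<lambda>\<theta>. (c * (1/4) powr (- \<gamma>)) powr p)"
      proof (rule integral_le)
        have "continuous_on {0..2*pi} (\<lambda>\<theta>. ?f (of_real r * cis \<theta>))"
          by (rule continuous_on_compose2[OF cont]) (use r in \<open>auto simp: norm_mult cis_conv_exp intro!: continuous_intros\<close>)
        then show "(\<lambda>\<theta>. norm (?f (of_real r * cis \<theta>)) powr p) integrable_on {0..2*pi}"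
          using p0 by (intro integrable_continuous_interval continuous_on_powr' continuous_on_norm continuous_on_const) auto
        show "norm (?f (of_real r * cis \<theta>)) powr p \<le> (c * (1/4) powr (- \<gamma>)) powr p" for \<theta>
          using gr'[of "of_real r * cis \<theta>" "3/4"] r p0 by (intro powr_mono2) (auto simp: norm_mult)
      qed (rule integrable_const_ivl)
      also have "\<dots> = C0" by (simp add: C0_def)
      also have "\<dots> \<le> C * 1" using C by simp
      also have "\<dots> \<le> C * (1 - r) powr (- \<beta>)"
      proof (rule mult_left_mono)
        have "1 powr (- \<beta>) \<le> (1 - r) powr (- \<beta>)" using r \<beta> by (intro powr_mono2') auto
        then show "1 \<le> (1 - r) powr (- \<beta>)" by simp
        show "0 \<le> C" using C C0 by simp
      qed
      finally show ?thesis .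
    qed
    \<comment> \<open>The natural number k bounds how often \<open>1 - r\<close> can be doubled before the radius drops to 3/4.\<close>
    have "?I r \<le> C * (1 - r) powr (- \<beta>)" if "1/2 \<le> r" "r < 1" "(1/2)^k \<le> 4 * (1 - r)" for k r
      using that
    proof (induction k arbitrary: r)
      case 0
      then show ?case using base[of r] by simp
    next
      case (Suc k)
      show ?case
      proof (cases "r \<le> 3/4")
        case True
        then show ?thesis using base[of r] Suc by simp
      next
        case False
        define a where "a = 2 * r - 1"
        have a: "1/2 \<le> a" "a < r" "r < 1" "r - a = 1 - r" "1 - a = 2 * (1 - r)" using False Suc.prems by (auto simp: a_def)
        have IH: "?I a \<le> C * (1 - a) powr (- \<beta>)" using Suc.prems a by (intro Suc.IH) auto
        define M where "M = 2 * c * (1 - r) powr (- \<gamma>)"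
        have Mb: "norm (?f z) < M" if "norm z \<le> r" for z
        proof -
          have "0 < c * (1 - r) powr (- \<gamma>)" using c a by simp
          then show ?thesis using gr'[OF that a(3)] by (simp add: M_def)
        qed
        have Mp: "(1 - r) * M powr p = (2 * c) powr p * (1 - r) powr (- \<beta>)"
        proof -
          have "M powr p = (2 * c) powr p * (1 - r) powr (- (\<gamma> * p))"
            using c a by (simp add: M_def powr_mult powr_powr)
          moreover have "(1 - r) powr (- \<beta>) = (1 - r) powr (1 + - (\<gamma> * p))" by (simp add: \<beta>_def)
          then have "(1 - r) powr (- \<beta>) = (1 - r) * (1 - r) powr (- (\<gamma> * p))"
            using a by (simp only: powr_add) simp
          ultimately show ?thesis by simp
        qed
        have "?I r \<le> (1 + (q - 1)) * ?I a + (1 + 1 / (q - 1)) * (p * pi * K * (r - a) * M powr p)"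
          using K q by (intro integral_mean_step[OF qc _ f0 a(1,2,3) p0 _ Mb]) auto
        also have "\<dots> = q * ?I a + (1 + 1 / (q - 1)) * (p * pi * K * ((1 - r) * M powr p))"
          using a(4) by (simp add: mult.assoc)
        also have "\<dots> = q * ?I a + C' * (1 - r) powr (- \<beta>)" unfolding Mp C'_def by (simp add: mult_ac)
        also have "\<dots> \<le> q * (C * (1 - a) powr (- \<beta>)) + C' * (1 - r) powr (- \<beta>)"
          using IH q by (intro add_right_mono mult_left_mono) auto
        also have "(1 - a) powr (- \<beta>) = (1 - r) powr (- \<beta>) / (q * q)"
        proof -
          have qq: "q * q = 2 powr \<beta>" by (simp add: q_def powr_add[symmetric])
          show ?thesis unfolding a(5) qq using a by (subst powr_mult) (auto simp: powr_minus field_simps)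
        qed
        also have "q * (C * ((1 - r) powr (- \<beta>) / (q * q))) + C' * (1 - r) powr (- \<beta>) = (C / q + C') * (1 - r) powr (- \<beta>)"
          using q by (simp add: field_simps)
        also have "\<dots> \<le> C * (1 - r) powr (- \<beta>)" using C by (intro mult_right_mono) auto
        finally show ?thesis .
      qed
    qed
    moreover obtain k where "(1/2)^k < 4 * (1 - r)"
      using real_arch_pow_inv[of "4 * (1 - r)" "1/2"] r by auto
    ultimately show ?thesis using r less_imp_le by blast
  qed
  then show ?thesis using C0 C(1) by (intro exI[of _ C]) (auto simp: \<beta>_def \<gamma>_def)
qed

lemma S_H_qr_M_p_bigo:
  assumes K: "K \<ge> 1" and F: "f \<in> S_H_qr K" and p: "p > 1 / gamma_star K"
  shows "(\<lambda>r. M_p p r (harmonic_map f)) \<in> O[at_left 1](\<lambda>r. 1 / (1 - r) powr (gamma_star K - 1 / p))"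
proof -
  obtain h g where f: "f = (h, g)" by (cases f)
  have \<gamma>: "gamma_star K \<ge> 2" by (rule gamma_star_ge_2[OF K])
  then have p0: "p > 0" using p by (meson divide_pos_pos less_trans zero_less_one order_less_le_trans zero_less_numeral)
  obtain C where C: "C > 0" "\<And>r. 1/2 \<le> r \<Longrightarrow> r < 1 \<Longrightarrow>
     integral {0..2*pi} (\<lambda>\<theta>. norm (harmonic_map (h, g) (of_real r * cis \<theta>)) powr p) \<le> C * (1 - r) powr (1 - gamma_star K * p)"
    using S_H_qr_integral_mean[OF K p] F f by metis
  have bd: "M_p p r (harmonic_map f) \<le> (C / (2 * pi)) powr (1 / p) * (1 / (1 - r) powr (gamma_star K - 1 / p))"
    if r: "1/2 \<le> r" "r < 1" for r
  proof -
    let ?I = "integral {0..2*pi} (\<lambda>\<theta>. norm (harmonic_map f (of_real r * cis \<theta>)) powr p)"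
    have M: "M_p p r (harmonic_map f) = (1 / (2 * pi) * ?I) powr (1 / p)" by (simp add: M_p_def cis_conv_exp)
    have I0: "0 \<le> ?I" by (cases "(\<lambda>\<theta>. norm (harmonic_map f (of_real r * cis \<theta>)) powr p) integrable_on {0..2*pi}")
      (auto intro: integral_nonneg simp: not_integrable_integral)
    have "1 / (2 * pi) * ?I \<le> 1 / (2 * pi) * (C * (1 - r) powr (1 - gamma_star K * p))"
      using C(2)[OF r] f by (intro mult_left_mono) auto
    then have "M_p p r (harmonic_map f) \<le> (1 / (2 * pi) * (C * (1 - r) powr (1 - gamma_star K * p))) powr (1 / p)"
      unfolding M using p0 I0 by (intro powr_mono2) auto
    also have "\<dots> = (C / (2 * pi) * (1 - r) powr (1 - gamma_star K * p)) powr (1 / p)" by simp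
    also have "\<dots> = (C / (2 * pi)) powr (1 / p) * (1 - r) powr ((1 - gamma_star K * p) / p)"
      using C(1) by (subst powr_mult) (auto simp: powr_powr)
    also have "(1 - gamma_star K * p) / p = - (gamma_star K - 1 / p)" using p0 by (simp add: field_simps)
    also have "(1 - r) powr (- (gamma_star K - 1 / p)) = 1 / (1 - r) powr (gamma_star K - 1 / p)"
      by (simp add: powr_minus inverse_eq_divide del: minus_diff_eq)
    finally show ?thesis .
  qed
  have "eventually (\<lambda>r. r \<in> {1/2<..<1}) (at_left (1::real))"
    by (rule eventually_at_leftI[of "1/2"]) auto
  then have "eventually (\<lambda>r. norm (M_p p r (harmonic_map f)) \<le> (C / (2 * pi)) powr (1 / p) * norm (1 / (1 - r) powr (gamma_star K - 1 / p))) (at_left 1)"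
  proof eventually_elim
    case (elim r)
    have "0 \<le> M_p p r (harmonic_map f)" by (simp add: M_p_def)
    then show ?case using bd[of r] elim by simp
  qed
  then show ?thesis by (rule bigoI)
qed

section \<open>Taylor coefficients\<close>

lemma circle_mean_value:
  assumes f: "f holomorphic_on ball 0 1" and r: "0 < r" "r < 1"
  shows "((\<lambda>t. f (of_real r * cis t)) has_integral 2 * of_real pi * f 0) {0..2*pi}"
proof -
  have "((\<lambda>u. f u / (u - 0) ^ Suc 0) has_contour_integral ((2 * pi * \<i>) / (fact 0) * (deriv ^^ 0) f 0)) (circlepath 0 r)"
    using r f by (intro Cauchy_has_contour_integral_higher_derivative_circlepath)
      (auto intro!: holomorphic_on_imp_continuous_on intro: holomorphic_on_subset)
  then have "((\<lambda>t. f (of_real r * cis t) / (of_real r * cis t) * of_real r * \<i> * cis t) has_integral (2 * of_real pi * \<i> * f 0)) {0..2*pi}"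
    unfolding circlepath_def by (subst (asm) has_contour_integral_part_circlepath_iff) auto
  from has_integral_mult_right[OF this, of "- \<i>"]
  show ?thesis using r by (simp add: field_simps)
qed

text \<open>
  On the circle \<open>cnj z = r^2 / z\<close>, so \<open>cnj g / z^n\<close> is a multiple of the conjugate of \<open>g z^n\<close>, whose mean
  value is its value 0 at the origin; only h contributes.
\<close>

lemma harmonic_coefficient_integral:
  assumes h: "h holomorphic_on ball 0 1" and g: "g holomorphic_on ball 0 1" and r: "0 < r" "r < 1" and n: "n > 0"
  shows "((\<lambda>t. harmonic_map (h, g) (of_real r * cis t) / (of_real r * cis t) ^ n) has_integral
           2 * of_real pi * ((deriv ^^ n) h 0 / fact n)) {0..2*pi}"
proof -
  have "((\<lambda>u. h u / (u - 0) ^ Suc n) has_contour_integral ((2 * pi * \<i>) / (fact n) * (deriv ^^ n) h 0)) (circlepath 0 r)"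
    using r h by (intro Cauchy_has_contour_integral_higher_derivative_circlepath)
      (auto intro!: holomorphic_on_imp_continuous_on intro: holomorphic_on_subset)
  then have "((\<lambda>t. h (of_real r * cis t) / (of_real r * cis t) ^ Suc n * of_real r * \<i> * cis t) has_integral (2 * of_real pi * \<i> / fact n * (deriv ^^ n) h 0)) {0..2*pi}"
    unfolding circlepath_def by (subst (asm) has_contour_integral_part_circlepath_iff) auto
  from has_integral_mult_right[OF this, of "- \<i>"]
  have 1: "((\<lambda>t. h (of_real r * cis t) / (of_real r * cis t) ^ n) has_integral 2 * of_real pi * ((deriv ^^ n) h 0 / fact n)) {0..2*pi}"
    using r by (simp add: field_simps)
  have "((\<lambda>t. g (of_real r * cis t) * (of_real r * cis t) ^ n) has_integral 2 * of_real pi * (g 0 * 0 ^ n)) {0..2*pi}"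
    by (rule circle_mean_value[OF _ r]) (intro holomorphic_intros g)
  then have g0: "((\<lambda>t. g (of_real r * cis t) * (of_real r * cis t) ^ n) has_integral 0) {0..2*pi}"
    using n by (simp add: zero_power)
  have gi: "((\<lambda>t. cnj (g (of_real r * cis t) * (of_real r * cis t) ^ n)) has_integral cnj 0) {0..2*pi}"
    using has_integral_linear[OF g0 bounded_linear_cnj] by (simp only: o_def)
  have eq: "1 / of_real r ^ (2 * n) * cnj (g (of_real r * cis t) * (of_real r * cis t) ^ n) =
       cnj (g (of_real r * cis t)) / (of_real r * cis t) ^ n" for t
  proof -
    have "cnj (cis t) ^ n * cis t ^ n = 1" by (simp add: power_mult_distrib[symmetric] cis_mult cis_cnj)
    then have "cnj (cis t) ^ n = 1 / cis t ^ n" by (simp add: field_simps)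
    moreover have "(of_real r :: complex) ^ (2 * n) = of_real r ^ n * of_real r ^ n" by (simp add: mult_2 power_add)
    ultimately show ?thesis using r by (simp add: power_mult_distrib del: cis_cnj)
  qed
  have 2: "((\<lambda>t. cnj (g (of_real r * cis t)) / (of_real r * cis t) ^ n) has_integral 0) {0..2*pi}"
    using has_integral_mult_right[OF gi, of "1 / of_real r ^ (2 * n)"] unfolding eq by simp
  show ?thesis using has_integral_add[OF 1 2] by (simp add: harmonic_map_def add_divide_distrib)
qed

lemma one_minus_inverse_power_ge:
  assumes "n \<ge> 2" shows "exp (- 2) \<le> (1 - 1 / real n) ^ n"
proof -
  define x where "x = 1 / real n"
  have x: "0 \<le> x" "x \<le> 1/2" "real n * x = 1" using assms by (auto simp: x_def field_simps)
  have "- x - 2 * x\<^sup>2 \<le> ln (1 - x)" using x by (intro ln_one_minus_pos_lower_bound) auto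
  moreover have "x\<^sup>2 \<le> x * (1/2)" unfolding power2_eq_square using x by (intro mult_left_mono) auto
  ultimately have "- 2 * x \<le> ln (1 - x)" by linarith
  then have "real n * (- 2 * x) \<le> real n * ln (1 - x)" by (intro mult_left_mono) auto
  then have "- 2 \<le> real n * ln (1 - x)" using x(3) by (simp add: algebra_simps)
  then have "exp (- 2) \<le> exp (real n * ln (1 - x))" by simp
  also have "\<dots> = (1 - x) ^ n" using x by (subst exp_of_nat_mult) auto
  finally show ?thesis by (simp add: x_def)
qed

text \<open>
  On the circle of radius \<open>r = 1 - 1/n\<close> the factor \<open>r^(-n)\<close> of Cauchy's formula is at most \<open>exp 2\<close>, and the
  mean of order 1 is of order \<open>(1 - r)^(1 - \<gamma>) = n^(\<gamma> - 1)\<close>.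
\<close>

lemma S_H_qr_coefficient_bound:
  assumes K: "K \<ge> 1"
  shows "\<exists>C::real. \<forall>h g. (h, g) \<in> S_H_qr K \<longrightarrow>
    (\<forall>n\<ge>2. norm ((deriv ^^ n) h 0 / fact n) \<le> C * real n powr (gamma_star K - 1))"
proof -
  define \<gamma> where "\<gamma> = gamma_star K"
  have \<gamma>: "\<gamma> \<ge> 2" unfolding \<gamma>_def by (rule gamma_star_ge_2[OF K])
  have "1 > 1 / gamma_star K" using \<gamma> by (simp add: \<gamma>_def)
  from S_H_qr_integral_mean[OF K this] obtain C where C: "C > 0"
    "\<And>h g r. (h, g) \<in> S_H_qr K \<Longrightarrow> 1/2 \<le> r \<Longrightarrow> r < 1 \<Longrightarrow>
     integral {0..2*pi} (\<lambda>\<theta>. norm (harmonic_map (h, g) (of_real r * cis \<theta>)) powr 1) \<le> C * (1 - r) powr (1 - \<gamma> * 1)"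
    unfolding \<gamma>_def by metis
  have "norm ((deriv ^^ n) h 0 / fact n) \<le> C * exp 2 / (2 * pi) * real n powr (\<gamma> - 1)"
    if F: "(h, g) \<in> S_H_qr K" and n: "n \<ge> 2" for h g n
  proof -
    let ?f = "harmonic_map (h, g)" and ?a = "(deriv ^^ n) h 0 / fact n"
    have hol: "h holomorphic_on ball 0 1" "g holomorphic_on ball 0 1" using F by (auto simp: S_H_qr_def S_H_def)
    define r where "r = 1 - 1 / real n"
    have r: "1/2 \<le> r" "r < 1" using n by (auto simp: r_def field_simps)
    have cont: "continuous_on (ball 0 1) ?f" using S_H_qr_qc_map[OF F] by (auto simp: qc_map_def intro: C1_wirtinger_cont)
    have cc: "continuous_on {0..2*pi} (\<lambda>t. ?f (of_real r * cis t))"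
      by (rule continuous_on_compose2[OF cont]) (use r in \<open>auto simp: norm_mult cis_conv_exp intro!: continuous_intros\<close>)
    have hi: "((\<lambda>t. ?f (of_real r * cis t) / (of_real r * cis t) ^ n) has_integral 2 * of_real pi * ?a) {0..2*pi}"
      using r n by (intro harmonic_coefficient_integral hol) auto
    have "norm (2 * of_real pi * ?a) = norm (integral {0..2*pi} (\<lambda>t. ?f (of_real r * cis t) / (of_real r * cis t) ^ n))"
      using integral_unique[OF hi] by simp
    also have "\<dots> \<le> integral {0..2*pi} (\<lambda>t. 1 / r ^ n * (norm (?f (of_real r * cis t)) powr 1))"
    proof (rule integral_norm_bound_integral)
      show "(\<lambda>t. ?f (of_real r * cis t) / (of_real r * cis t) ^ n) integrable_on {0..2*pi}" using hi by blast
      show "(\<lambda>t. 1 / r ^ n * (norm (?f (of_real r * cis t)) powr 1)) integrable_on {0..2*pi}"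
        by (simp, intro integrable_continuous_interval continuous_on_divide continuous_on_norm cc continuous_on_const) (use r in auto)
      show "norm (?f (of_real r * cis t) / (of_real r * cis t) ^ n) \<le> 1 / r ^ n * (norm (?f (of_real r * cis t)) powr 1)" for t
        using r by (simp add: norm_divide norm_power norm_mult)
    qed
    also have "\<dots> = 1 / r ^ n * integral {0..2*pi} (\<lambda>t. norm (?f (of_real r * cis t)) powr 1)" by (rule integral_mult_right)
    also have "\<dots> \<le> exp 2 * (C * (1 - r) powr (1 - \<gamma> * 1))"
    proof (rule mult_mono)
      have "exp (- 2) \<le> r ^ n" unfolding r_def by (rule one_minus_inverse_power_ge[OF n])
      then have "1 / r ^ n \<le> 1 / exp (- 2)" by (intro divide_left_mono) (use r in auto)
      then show "1 / r ^ n \<le> exp 2" by (simp add: exp_minus inverse_eq_divide)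
      show "integral {0..2*pi} (\<lambda>t. norm (?f (of_real r * cis t)) powr 1) \<le> C * (1 - r) powr (1 - \<gamma> * 1)" by (rule C(2)[OF F r])
      show "0 \<le> integral {0..2*pi} (\<lambda>t. norm (?f (of_real r * cis t)) powr 1)"
        by (simp, intro integral_nonneg integrable_continuous_interval continuous_on_norm cc) auto
    qed simp
    also have "(1 - r) powr (1 - \<gamma> * 1) = real n powr (\<gamma> - 1)"
    proof -
      have "(1 / real n) powr (1 - \<gamma>) = real n powr - (1 - \<gamma>)"
        using n by (simp add: powr_divide powr_minus inverse_eq_divide del: minus_diff_eq)
      then show ?thesis by (simp add: r_def)
    qed
    also have "norm (2 * of_real pi * ?a) = 2 * pi * norm ?a" by (subst norm_mult) simp
    finally have "2 * pi * norm ?a \<le> exp 2 * (C * real n powr (\<gamma> - 1))" .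
    then show ?thesis by (simp add: field_simps)
  qed
  then show ?thesis unfolding \<gamma>_def by blast
qed

lemma coefficient_of_normalized_series:
  fixes a :: "nat \<Rightarrow> complex"
  assumes "\<forall>z\<in>ball 0 1. (\<lambda>n. a (n + 2) * z ^ (n + 2)) sums (h z - z)" and n: "n \<ge> 2"
  shows "(deriv ^^ n) h 0 / fact n = a n"
proof -
  define c where "c k = (if k = 0 then 0 else if k = 1 then 1 else a k)" for k :: nat
  have "(\<lambda>k. fps_nth (Abs_fps c) k * z ^ k) sums h z" if z: "z \<in> ball 0 1" for z
  proof -
    have "(\<lambda>n. c (n + 2) * z ^ (n + 2)) sums (h z - z)" using assms(1) z by (simp add: c_def)
    then have "(\<lambda>n. c n * z ^ n) sums (h z - z + (\<Sum>i<2. c i * z ^ i))"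
      by (rule iffD1[OF sums_iff_shift])
    then show ?thesis by (simp add: c_def numeral_2_eq_2)
  qed
  moreover have "eventually (\<lambda>z. z \<in> ball 0 1) (nhds (0::complex))" by (intro eventually_nhds_in_open) auto
  ultimately have "eventually (\<lambda>z. (\<lambda>k. fps_nth (Abs_fps c) k * z ^ k) sums h z) (nhds 0)"
    by (auto elim: eventually_mono)
  then have "h has_fps_expansion Abs_fps c" by (rule has_fps_expansionI)
  from fps_nth_fps_expansion[OF this, of n] show ?thesis using n by (simp add: c_def)
qed

section \<open>The area theorem and Bieberbach's inequality\<close>

text \<open>
  Outside the closed disc of radius M, the image of the punctured disc of radius r is open, and it is
  relatively closed because \<open>G\<close> tends to infinity at 0 and is bounded by M on the circle. That exterior
  is connected, so it is covered by this image, and injectivity keeps the values at all other points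
  out of it.
\<close>

lemma bounded_by_inner_circle:
  fixes G :: "complex \<Rightarrow> complex"
  assumes cont: "continuous_on (ball 0 1 - {0}) G" and inj: "inj_on G (ball 0 1 - {0})"
    and pole: "\<And>B. \<exists>\<delta>>0. \<forall>z. 0 < norm z \<longrightarrow> norm z < \<delta> \<longrightarrow> norm (G z) > B"
    and r: "0 < r" "r < 1" and M: "\<And>z. norm z = r \<Longrightarrow> norm (G z) \<le> M"
    and z0: "r < norm z0" "norm z0 < 1"
  shows "norm (G z0) \<le> M"
proof (rule ccontr)
  assume z0M: "\<not> norm (G z0) \<le> M"
  define V where "V = - cball (0::complex) M"
  define P where "P = ball (0::complex) r - {0}"
  have P1: "P \<subseteq> ball 0 1 - {0}" using r by (auto simp: P_def)
  have "connected V" unfolding V_def by (rule connected_complement_bounded_convex) auto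
  moreover have openP: "open (G ` P)"
    by (rule invariance_of_domain) (auto simp: P_def intro!: continuous_on_subset[OF cont] inj_on_subset[OF inj] P1[unfolded P_def])
  moreover have "open (V - G ` P)"
    unfolding open_contains_ball
  proof
    fix w assume w: "w \<in> V - G ` P"
    obtain \<delta> where \<delta>: "\<delta> > 0" "\<And>z. 0 < norm z \<Longrightarrow> norm z < \<delta> \<Longrightarrow> norm (G z) > norm w + 1"
      using pole[of "norm w + 1"] by blast
    define A where "A = cball (0::complex) r - ball 0 \<delta>"
    have A1: "A \<subseteq> ball 0 1 - {0}" using r \<delta> by (auto simp: A_def)
    have "compact (G ` A)"
      unfolding A_def by (intro compact_continuous_image compact_diff continuous_on_subset[OF cont] A1[unfolded A_def]) auto
    moreover have "w \<notin> G ` A"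
    proof
      assume "w \<in> G ` A"
      then obtain z where z: "z \<in> A" "w = G z" by auto
      show False
      proof (cases "norm z = r")
        case True
        then show False using M[of z] z w by (simp add: V_def)
      next
        case False
        then have "z \<in> P" using z \<delta> by (auto simp: A_def P_def)
        then show False using z w by blast
      qed
    qed
    ultimately have "open (V - G ` A)" "w \<in> V - G ` A"
      using w by (auto simp: V_def compact_imp_closed intro!: open_Diff)
    then obtain e where e: "e > 0" "ball w e \<subseteq> V - G ` A" by (meson open_contains_ball)
    have "ball w (min e 1) \<subseteq> V - G ` P"
    proof
      fix y assume y: "y \<in> ball w (min e 1)"
      then have y1: "y \<in> V - G ` A" using e by auto
      have "norm y \<le> norm w + 1" using y norm_triangle_ineq[of w "y - w"] by (simp add: dist_norm norm_minus_commute)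
      then have "y \<notin> G ` P" using y1 \<delta>(2) by (auto simp: P_def A_def) (smt (verit) image_eqI DiffI mem_ball_0 mem_cball_0)
      then show "y \<in> V - G ` P" using y1 by auto
    qed
    then show "\<exists>e>0. ball w e \<subseteq> V - G ` P" using e by (intro exI[of _ "min e 1"]) auto
  qed
  moreover have "G ` P \<inter> (V - G ` P) \<inter> V = {}" "V \<subseteq> G ` P \<union> (V - G ` P)" by auto
  ultimately have "G ` P \<inter> V = {} \<or> (V - G ` P) \<inter> V = {}" by (rule connectedD)
  moreover have "G z0 \<in> (V - G ` P) \<inter> V"
  proof -
    have "G z0 \<notin> G ` P"
    proof
      assume "G z0 \<in> G ` P"
      then obtain y where y: "y \<in> P" "G z0 = G y" by auto
      have "z0 \<noteq> 0" using z0(1) r(1) by auto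
      then have "z0 = y" using inj_onD[OF inj y(2)] subsetD[OF P1 y(1)] z0 r by auto
      then show False using y z0 by (simp add: P_def)
    qed
    then show ?thesis using z0M by (simp add: V_def)
  qed
  moreover have "G ` P \<inter> V \<noteq> {}"
  proof -
    obtain \<delta> where \<delta>: "\<delta> > 0" "\<And>z. 0 < norm z \<Longrightarrow> norm z < \<delta> \<Longrightarrow> norm (G z) > M" using pole[of M] by blast
    define z where "z = complex_of_real (min \<delta> r / 2)"
    have z: "0 < norm z" "norm z < \<delta>" "norm z < r" using \<delta> r by (auto simp: z_def)
    then have "G z \<in> G ` P \<inter> V" using \<delta>(2)[of z] by (auto simp: P_def V_def)
    then show ?thesis by blast
  qed
  ultimately show False by blast
qed

lemma complex_Re_of_real_mult: "Re (of_real a * w) = a * Re w"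
  by simp

text \<open>
  With \<open>u = 1/z^2\<close>, the term \<open>|E|^2\<close> in the expansion of \<open>|-u + b + E|^2\<close> is dropped. As \<open>cnj u\<close> equals
  \<open>z^2 / \<rho>^4\<close> on the circle, the mixed terms are the real part of a holomorphic function \<Phi> that vanishes
  at 0, and their mean is 0.
\<close>

lemma circle_mean_square_ge:
  fixes b :: complex
  assumes E: "E holomorphic_on ball 0 1" "E 0 = 0" and r: "0 < \<rho>" "\<rho> < 1"
  shows "2 * pi * (1 / \<rho>^4 + (norm b)^2) \<le>
    integral {0..2*pi} (\<lambda>t. (norm (- 1 / (of_real \<rho> * cis t)\<^sup>2 + b + E (of_real \<rho> * cis t)))\<^sup>2)"
proof -
  define \<Phi> where "\<Phi> z = - 2 * b * z\<^sup>2 / of_real (\<rho>^4) - 2 * z\<^sup>2 * E z / of_real (\<rho>^4) + 2 * cnj b * E z" for z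
  let ?z = "\<lambda>t. of_real \<rho> * cis t"
  have hol: "\<Phi> holomorphic_on ball 0 1" unfolding \<Phi>_def using r by (intro holomorphic_intros E) auto
  have "((\<lambda>t. \<Phi> (?z t)) has_integral 2 * of_real pi * \<Phi> 0) {0..2*pi}" by (rule circle_mean_value[OF hol r])
  then have "((\<lambda>t. \<Phi> (?z t)) has_integral 0) {0..2*pi}" by (simp add: \<Phi>_def E(2))
  from has_integral_linear[OF this bounded_linear_Re]
  have "((\<lambda>t. Re (\<Phi> (?z t))) has_integral 0) {0..2*pi}" by (simp add: o_def)
  then have hi: "((\<lambda>t. (1 / \<rho>^4 + (norm b)^2) + Re (\<Phi> (?z t))) has_integral 2 * pi * (1 / \<rho>^4 + (norm b)^2) + 0) {0..2*pi}"
    using has_integral_const_real[of "1 / \<rho>^4 + (norm b)^2" 0 "2*pi"] by (intro has_integral_add) auto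
  have "continuous_on (ball 0 1) E" by (rule holomorphic_on_imp_continuous_on[OF E(1)])
  then have cE: "continuous_on {0..2*pi} (\<lambda>t. E (?z t))"
    by (rule continuous_on_compose2) (use r in \<open>auto simp: norm_mult cis_conv_exp intro!: continuous_intros\<close>)
  have cz: "continuous_on {0..2*pi} ?z" unfolding cis_conv_exp by (intro continuous_intros)
  have "2 * pi * (1 / \<rho>^4 + (norm b)^2) = integral {0..2*pi} (\<lambda>t. (1 / \<rho>^4 + (norm b)^2) + Re (\<Phi> (?z t)))"
    using integral_unique[OF hi] by simp
  also have "\<dots> \<le> integral {0..2*pi} (\<lambda>t. (norm (- 1 / (?z t)\<^sup>2 + b + E (?z t)))\<^sup>2)"
  proof (rule integral_le)
    show "(\<lambda>t. (1 / \<rho>^4 + (norm b)^2) + Re (\<Phi> (?z t))) integrable_on {0..2*pi}" using hi by blast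
    show "(\<lambda>t. (norm (- 1 / (?z t)\<^sup>2 + b + E (?z t)))\<^sup>2) integrable_on {0..2*pi}"
      using r by (intro integrable_continuous_interval continuous_intros cE cz) auto
    fix t
    define z where "z = ?z t"
    define e where "e = E z"
    define u where "u = 1 / z\<^sup>2"
    have nz: "norm z = \<rho>" "z \<noteq> 0" using r by (auto simp: z_def norm_mult)
    have zz: "z * cnj z = of_real (\<rho>\<^sup>2)" using nz complex_norm_square[of z] by simp
    have cu: "cnj u = z\<^sup>2 / of_real (\<rho>^4)"
    proof -
      have "z\<^sup>2 * (cnj z)\<^sup>2 = of_real (\<rho>^4)"
        unfolding power_mult_distrib[symmetric] zz by (simp flip: power_mult)
      then show ?thesis using nz r by (simp add: u_def field_simps)
    qed
    have nu: "(norm u)\<^sup>2 = 1 / \<rho>^4" using nz by (simp add: u_def norm_divide norm_power power_divide flip: power_mult)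
    have "(norm (- u + b + e))\<^sup>2 = (norm u)\<^sup>2 + (norm b)^2 + (norm e)\<^sup>2 + 2 * Re (- b * cnj u - cnj u * e + cnj b * e)"
      unfolding cmod_power2 by (simp add: power2_eq_square algebra_simps)
    also have "\<dots> \<ge> (norm u)\<^sup>2 + (norm b)^2 + Re (\<Phi> z)"
    proof -
      have "\<Phi> z = of_real 2 * (- b * cnj u - cnj u * e + cnj b * e)"
        unfolding \<Phi>_def cu e_def by (simp add: algebra_simps)
      then have "Re (\<Phi> z) = 2 * Re (- b * cnj u - cnj u * e + cnj b * e)" 
        by (simp only: complex_Re_of_real_mult)
      then show ?thesis by simp
    qed
    finally show "(1 / \<rho>^4 + (norm b)^2) + Re (\<Phi> (?z t)) \<le> (norm (- 1 / (?z t)\<^sup>2 + b + E (?z t)))\<^sup>2"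
      unfolding nu by (simp add: z_def u_def e_def)
  qed
  finally show ?thesis .
qed

text \<open>
  The circle of radius r is mapped by \<open>1/z + b z\<close> to an ellipse, which the real-linear map
  \<open>w \<mapsto> w - b r^2 (cnj w)\<close> turns into a circle of radius at most \<open>1/r\<close>. Composed with this map, F sends the
  annulus between the radii r and R into a disc whose radius exceeds \<open>1/r\<close> only by a term of order
  \<open>r^3\<close>. The right-hand side compares the area of that disc, divided by \<open>pi\<close>, with the area of the image
  on the left. An undistorted disc around the ellipse would have too much area by a quantity that does
  not vanish as r tends to 0.
\<close>

lemma area_theorem_inequality:
  fixes F N :: "complex \<Rightarrow> complex" and b :: complex
  assumes N: "N holomorphic_on ball 0 1" and F: "\<And>z. F z = 1 / z + b * z + z^3 * N z"
    and inj: "inj_on F (ball 0 1 - {0})"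
    and N0: "\<And>z. norm z \<le> 1/2 \<Longrightarrow> norm (N z) \<le> C" and C: "C \<ge> 0"
    and r: "0 < r" "r < 1/2" "norm b * r\<^sup>2 < 1" and R: "1/2 < R" "R < 1"
  shows "(1 - (norm b)^2 * r^4) * (1 / r\<^sup>2 - 1 / R\<^sup>2 + (norm b)^2 * (R\<^sup>2 - r\<^sup>2)) \<le> (1 / r + (2 * C + 1) * r^3)\<^sup>2"
proof -
  let ?U = "ball (0::complex) 1 - {0}"
  define E where "E z = 3 * z\<^sup>2 * N z + z^3 * deriv N z" for z
  define F' where "F' z = - 1 / z\<^sup>2 + b + E z" for z
  define c where "c = b * of_real (r\<^sup>2)"
  define G where "G z = F z - c * cnj (F z)" for z
  have nc: "norm c = norm b * r\<^sup>2" using r by (simp add: c_def norm_mult norm_power)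
  then have nc1: "norm c < 1" using r by simp
  have E: "E holomorphic_on ball 0 1" "E 0 = 0"
    unfolding E_def by (intro holomorphic_intros N holomorphic_deriv) auto
  have dF: "(F has_field_derivative F' z) (at z)" if z: "z \<in> ?U" for z
  proof -
    have "(N has_field_derivative deriv N z) (at z)" using N z by (intro holomorphic_derivI) auto
    then have "((\<lambda>z. 1 / z + b * z + z^3 * N z) has_field_derivative F' z) (at z)"
      unfolding F'_def E_def using z by (auto intro!: derivative_eq_intros simp: power2_eq_square algebra_simps)
    then show ?thesis by (simp only: F[abs_def])
  qed
  have cF': "continuous_on ?U F'"
    unfolding F'_def by (intro continuous_intros continuous_on_subset[OF holomorphic_on_imp_continuous_on[OF E(1)]]) auto
  have CG: "C1_wirtinger G F' (\<lambda>z. - c * cnj (F' z)) ?U"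
    unfolding C1_wirtinger_def
  proof (intro conjI ballI)
    show "open ?U" by (intro open_Diff) auto
    show "continuous_on ?U F'" "continuous_on ?U (\<lambda>z. - c * cnj (F' z))" by (intro continuous_intros cF')+
    fix z assume "z \<in> ?U"
    then have 1: "(F has_derivative (\<lambda>v. F' z * v)) (at z)" using dF by (simp add: has_field_derivative_def)
    then have "((\<lambda>z. F z - c * cnj (F z)) has_derivative (\<lambda>v. F' z * v - c * cnj (F' z * v))) (at z)"
      by (intro has_derivative_diff has_derivative_mult_right has_derivative_cnj)
    then show "(G has_derivative (\<lambda>v. F' z * v + - c * cnj (F' z) * cnj v)) (at z)"
      by (simp add: G_def[abs_def] mult.assoc)
  qed
  have injG: "inj_on G ?U"
  proof (rule inj_onI)
    fix x y assume x: "x \<in> ?U" and y: "y \<in> ?U" and "G x = G y"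
    then have "F x - F y = c * cnj (F x - F y)" by (simp add: G_def algebra_simps)
    then have "norm (F x - F y) = norm c * norm (F x - F y)" by (metis complex_mod_cnj norm_mult)
    then have "norm (F x - F y) = 0" using nc1 by (auto simp: mult_cancel_right1)
    then show "x = y" using inj_onD[OF inj _ x y] by simp
  qed
  have Gge: "norm (G z) \<ge> (1 - norm c) * norm (F z)" for z
    using norm_triangle_ineq2[of "F z" "c * cnj (F z)"] by (simp add: G_def norm_mult algebra_simps)
  have pole: "\<exists>\<delta>>0. \<forall>z. 0 < norm z \<longrightarrow> norm z < \<delta> \<longrightarrow> norm (G z) > B" for B
  proof -
    have "continuous_on (ball 0 1) (\<lambda>z. 1 + b * z\<^sup>2 + z^4 * N z)"
      by (intro continuous_intros holomorphic_on_imp_continuous_on N)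
    then have "continuous (at 0) (\<lambda>z. 1 + b * z\<^sup>2 + z^4 * N z)" by (simp add: continuous_on_eq_continuous_at)
    then obtain \<delta> where \<delta>: "\<delta> > 0" "\<And>z. dist z 0 < \<delta> \<Longrightarrow> dist (1 + b * z\<^sup>2 + z^4 * N z) (1 + b * 0\<^sup>2 + 0^4 * N 0) < 1/2"
      unfolding continuous_at_eps_delta by (metis half_gt_zero_iff zero_less_one)
    define d where "d = (1 - norm c) / (2 * (\<bar>B\<bar> + 1))"
    have d: "d > 0" using nc1 by (simp add: d_def)
    have "norm (G z) > B" if z: "0 < norm z" "norm z < min \<delta> d" for z
    proof -
      have "norm (1 + b * z\<^sup>2 + z^4 * N z) \<ge> 1/2"
      proof -
        have "norm (b * z\<^sup>2 + z^4 * N z) < 1/2" using \<delta>(2)[of z] z by (simp add: dist_norm add.assoc)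
        then show ?thesis using norm_diff_ineq[of 1 "b * z\<^sup>2 + z^4 * N z"] by (simp add: add.assoc)
      qed
      moreover have "F z = (1 + b * z\<^sup>2 + z^4 * N z) / z"
        using z by (simp add: F field_simps power2_eq_square power3_eq_cube power4_eq_xxxx)
      ultimately have "norm (F z) \<ge> 1/2 / norm z" by (simp only: norm_divide) (intro divide_right_mono, auto)
      then have "(1 - norm c) * (1/2 / norm z) \<le> norm (G z)"
        using Gge[of z] nc1 mult_left_mono[of "1/2 / norm z" "norm (F z)" "1 - norm c"] by linarith
      moreover have "\<bar>B\<bar> + 1 < (1 - norm c) * (1/2 / norm z)"
      proof -
        have "norm z * (2 * (\<bar>B\<bar> + 1)) < 1 - norm c" using z unfolding d_def by (simp add: pos_less_divide_eq)
        then show ?thesis using z by (simp add: field_simps)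
      qed
      ultimately show ?thesis by linarith
    qed
    then show ?thesis using \<delta> d by (intro exI[of _ "min \<delta> d"]) auto
  qed
  define M where "M = 1 / r + 2 * C * r^3"
  have circ: "norm (G z) \<le> M" if z: "norm z = r" for z
  proof -
    have z0: "z \<noteq> 0" using z r by auto
    \<comment> \<open>The real-linear map sends the main part \<open>1/z + b z\<close> to \<open>(1 - |c|^2) / z\<close>.\<close>
    define e where "e = z^3 * N z"
    have zz: "z * cnj z = of_real (r\<^sup>2)" using z complex_norm_square[of z] by simp
    have r2: "of_real (r\<^sup>2) \<noteq> (0::complex)" using r by simp
    have cz: "cnj z = of_real (r\<^sup>2) / z" using zz z0 by (simp add: field_simps)
    have "G z = (1 / z + b * z) - c * (1 / cnj z + cnj b * cnj z) + (e - c * cnj e)"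
      by (simp add: G_def F e_def algebra_simps)
    also have "(1 / z + b * z) - c * (1 / cnj z + cnj b * cnj z) = (1 - of_real ((norm c)^2)) / z"
    proof -
      have "c * (1 / cnj z) = b * z" using z0 r2 by (simp add: cz c_def)
      moreover have "c * (cnj b * cnj z) = c * cnj c / z" by (simp add: cz c_def mult_ac)
      ultimately show ?thesis unfolding complex_norm_square by (simp add: algebra_simps diff_divide_distrib)
    qed
    finally have "norm (G z) \<le> norm ((1 - of_real ((norm c)^2)) / z) + norm (e - c * cnj e)"
      using norm_triangle_ineq by metis
    also have "norm ((1 - of_real ((norm c)^2)) / z) \<le> 1 / r"
    proof -
      have "(norm c)^2 \<le> 1" using nc1 by (simp add: power_le_one)
      then have "\<bar>1 - (norm c)^2\<bar> \<le> 1" by simp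
      moreover have "1 - of_real ((norm c)^2) = complex_of_real (1 - (norm c)^2)" by simp
      ultimately have "norm (1 - of_real ((norm c)^2) :: complex) \<le> 1" by (simp only: norm_of_real)
      then show ?thesis using z r by (simp add: norm_divide divide_right_mono)
    qed
    also have "norm (e - c * cnj e) \<le> norm e + norm c * norm e"
      using norm_triangle_ineq4[of e "c * cnj e"] by (simp add: norm_mult)
    also have "\<dots> \<le> 2 * norm e" using nc1 mult_right_mono[of "norm c" 1 "norm e"] by simp
    also have "norm e \<le> r^3 * C" unfolding e_def norm_mult norm_power z using N0[of z] z r by (intro mult_left_mono) auto
    finally show ?thesis by (simp add: M_def mult_ac)
  qed
  have bd: "norm (G z) \<le> M" if "r < norm z" "norm z < 1" for z
    using bounded_by_inner_circle[OF C1_wirtinger_cont[OF CG] injG pole _ _ circ that] r by auto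
  let ?M = "1 / r + (2 * C + 1) * r^3"
  have MM: "M < ?M" using r by (simp add: M_def algebra_simps)
  have rR: "r < R" using r R by linarith
  define k where "k = 1 - (norm c)^2"
  have k: "k > 0" using nc1 by (simp add: k_def power_less_one_iff abs_square_less_1)
  have J: "\<bar>(norm (F' z))\<^sup>2 - (norm (- c * cnj (F' z)))\<^sup>2\<bar> = k * (norm (F' z))\<^sup>2" for z
  proof -
    have "(norm (F' z))\<^sup>2 - (norm (- c * cnj (F' z)))\<^sup>2 = k * (norm (F' z))\<^sup>2"
      by (simp add: norm_mult power_mult_distrib k_def algebra_simps)
    then show ?thesis using k by simp
  qed
  have area: "integral {r..R} (\<lambda>\<rho>. integral {0..2*pi} (\<lambda>\<theta>. \<rho> * (k * (norm (F' (of_real \<rho> * cis \<theta>)))^2))) \<le> pi * ?M\<^sup>2"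
  proof -
    have "integral {r..R} (\<lambda>\<rho>. integral {0..2*pi} (\<lambda>\<theta>. \<rho> *
         \<bar>(norm (F' (0 + of_real \<rho> * cis \<theta>)))^2 - (norm (- c * cnj (F' (0 + of_real \<rho> * cis \<theta>))))\<^sup>2\<bar>)) \<le> pi * ?M\<^sup>2"
    proof (rule polar_area_le[OF r(1) rR CG])
      show "inj_on G {z. r < dist 0 z \<and> dist 0 z < R}" by (rule inj_on_subset[OF injG]) (use r R in auto)
      show "G z \<in> ball 0 ?M" if "r < dist 0 z" "dist 0 z < R" for z using bd[of z] that R MM by auto
    qed (use r R in auto)
    then show ?thesis unfolding J by simp
  qed
  let ?l = "\<lambda>\<rho>. 2 * pi * k * (\<rho> powi (-3) + (norm b)^2 * \<rho>)"
  have li: "(?l has_integral (2 * pi * k * (- (R powi (-2)) / 2 + (norm b)^2 * R\<^sup>2 / 2) - 2 * pi * k * (- (r powi (-2)) / 2 + (norm b)^2 * r\<^sup>2 / 2))) {r..R}"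
  proof (rule fundamental_theorem_of_calculus)
    fix x assume "x \<in> {r..R}"
    then have "x \<noteq> 0" using r by auto
    then show "((\<lambda>x. 2 * pi * k * (- (x powi (-2)) / 2 + (norm b)^2 * x\<^sup>2 / 2)) has_vector_derivative ?l x) (at x within {r..R})"
      unfolding has_real_derivative_iff_has_vector_derivative[symmetric]
      by (auto intro!: derivative_eq_intros)
  qed (use rR in auto)
  have "integral {r..R} ?l \<le> integral {r..R} (\<lambda>\<rho>. integral {0..2*pi} (\<lambda>\<theta>. \<rho> * (k * (norm (F' (of_real \<rho> * cis \<theta>)))^2)))"
  proof (rule integral_le)
    show "?l integrable_on {r..R}" using li by blast
    have "continuous_on {z. r \<le> dist 0 z \<and> dist 0 z \<le> R} (\<lambda>z. (norm (F' z))\<^sup>2)"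
      using r R by (intro continuous_intros continuous_on_subset[OF cF']) auto
    from continuous_on_circle_integral[OF this]
    have "continuous_on {r..R} (\<lambda>\<rho>. integral {0..2*pi} (\<lambda>\<theta>. (norm (F' (of_real \<rho> * cis \<theta>)))^2))" using r by simp
    then show "(\<lambda>\<rho>. integral {0..2*pi} (\<lambda>\<theta>. \<rho> * (k * (norm (F' (of_real \<rho> * cis \<theta>)))^2))) integrable_on {r..R}"
      by (simp, intro integrable_continuous_interval continuous_on_mult continuous_on_id continuous_on_const)
    fix \<rho> assume \<rho>: "\<rho> \<in> {r..R}"
    have "\<rho> * (k * (2 * pi * (1 / \<rho>^4 + (norm b)^2))) \<le> \<rho> * (k * integral {0..2*pi} (\<lambda>t. (norm (F' (of_real \<rho> * cis t)))\<^sup>2))"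
      unfolding F'_def using \<rho> r R k by (intro mult_left_mono circle_mean_square_ge[OF E]) auto
    moreover have "?l \<rho> = \<rho> * (k * (2 * pi * (1 / \<rho>^4 + (norm b)^2)))"
      using \<rho> r by (simp add: power_int_minus field_simps power3_eq_cube power4_eq_xxxx)
    ultimately show "?l \<rho> \<le> integral {0..2*pi} (\<lambda>\<theta>. \<rho> * (k * (norm (F' (of_real \<rho> * cis \<theta>)))^2))"
      by (simp only: integral_mult_right)
  qed
  also note area
  finally have "integral {r..R} ?l \<le> pi * ?M\<^sup>2" .
  moreover have "integral {r..R} ?l = pi * (k * (1 / r\<^sup>2 - 1 / R\<^sup>2 + (norm b)^2 * (R\<^sup>2 - r\<^sup>2)))"
    using integral_unique[OF li] by (simp add: power_int_minus inverse_eq_divide algebra_simps)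
  ultimately have "pi * (k * (1 / r\<^sup>2 - 1 / R\<^sup>2 + (norm b)^2 * (R\<^sup>2 - r\<^sup>2))) \<le> pi * ?M\<^sup>2" by linarith
  then have "k * (1 / r\<^sup>2 - 1 / R\<^sup>2 + (norm b)^2 * (R\<^sup>2 - r\<^sup>2)) \<le> ?M\<^sup>2"
    by (simp only: mult_le_cancel_left_pos pi_gt_zero)
  moreover have "k = 1 - (norm b)^2 * r^4" by (simp add: k_def nc power_mult_distrib flip: power_mult)
  ultimately show ?thesis by simp
qed

text \<open>
  In the preceding inequality the terms \<open>1 / r^2\<close> cancel; letting r tend to 0 leaves
  \<open>|b|^2 R^2 \<le> 1 / R^2\<close>, and then R tends to 1.
\<close>

lemma area_theorem:
  fixes F N :: "complex \<Rightarrow> complex" and b :: complex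
  assumes N: "N holomorphic_on ball 0 1" and F: "\<And>z. F z = 1 / z + b * z + z^3 * N z"
    and inj: "inj_on F (ball 0 1 - {0})"
  shows "norm b \<le> 1"
proof -
  have "continuous_on (cball 0 (1/2)) N"
    by (rule continuous_on_subset[OF holomorphic_on_imp_continuous_on[OF N]]) auto
  then have "compact (N ` cball 0 (1/2))" by (rule compact_continuous_image) simp
  then have "bounded (N ` cball 0 (1/2))" by (rule compact_imp_bounded)
  then obtain C where C: "C > 0" "\<And>z. norm z \<le> 1/2 \<Longrightarrow> norm (N z) \<le> C"
    unfolding bounded_pos by auto
  define \<beta> where "\<beta> = norm b"
  have \<beta>0: "0 \<le> \<beta>" by (simp add: \<beta>_def)
  have main: "\<beta>\<^sup>2 * R^4 \<le> 1" if R: "1/2 < R" "R < 1" for R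
  proof -
    define D where "D = 2 * C + 1"
    \<comment> \<open>The error terms of the inequality; they vanish as r tends to 0.\<close>
    define A where "A r = \<beta>\<^sup>2 * r^2 + \<beta>\<^sup>2 * r^2 + \<beta>\<^sup>2 * r^4 * (\<beta>\<^sup>2 * (R\<^sup>2 - r\<^sup>2) - 1 / R\<^sup>2) + 2 * D * r^2 + D\<^sup>2 * r^6" for r
    have "eventually (\<lambda>r. r \<in> {0<..<min (1/2) (1 / (\<beta> + 1))}) (at_right (0::real))"
      using \<beta>0 by (intro eventually_at_right_real) auto
    then have ev: "eventually (\<lambda>r. \<beta>\<^sup>2 * R\<^sup>2 - 1 / R\<^sup>2 \<le> A r) (at_right 0)"
    proof eventually_elim
      case (elim r)
      then have r: "0 < r" "r < 1/2" "r < 1 / (\<beta> + 1)" by auto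
      have "r * (\<beta> + 1) < 1" using r(3) \<beta>0 by (simp add: pos_less_divide_eq)
      then have "\<beta> * r < 1" using r by (simp add: algebra_simps)
      moreover have "\<beta> * r\<^sup>2 \<le> \<beta> * r" using r \<beta>0 by (intro mult_left_mono) (auto simp: power2_eq_square)
      ultimately have br: "norm b * r\<^sup>2 < 1" by (simp add: \<beta>_def)
      have "(1 - \<beta>\<^sup>2 * r^4) * (1 / r\<^sup>2 - 1 / R\<^sup>2 + \<beta>\<^sup>2 * (R\<^sup>2 - r\<^sup>2)) \<le> (1 / r + D * r^3)\<^sup>2"
        using area_theorem_inequality[OF N F inj C(2) _ r(1,2) br R] C(1) by (simp add: \<beta>_def D_def)
      moreover have "(1 / r + D * r^3)\<^sup>2 = 1 / r\<^sup>2 + 2 * D * r^2 + D\<^sup>2 * r^6"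
        using r by (simp add: power2_eq_square field_simps power_numeral_reduce)
      moreover have "(1 - \<beta>\<^sup>2 * r^4) * (1 / r\<^sup>2 - 1 / R\<^sup>2 + \<beta>\<^sup>2 * (R\<^sup>2 - r\<^sup>2)) =
         1 / r\<^sup>2 + (\<beta>\<^sup>2 * R\<^sup>2 - 1 / R\<^sup>2) - \<beta>\<^sup>2 * r\<^sup>2 - \<beta>\<^sup>2 * r^2 - \<beta>\<^sup>2 * r^4 * (\<beta>\<^sup>2 * (R\<^sup>2 - r\<^sup>2) - 1 / R\<^sup>2)"
      proof -
        have "\<beta>\<^sup>2 * r^4 * (1 / r\<^sup>2) = \<beta>\<^sup>2 * r\<^sup>2" using r by (simp add: power2_eq_square power4_eq_xxxx)
        then show ?thesis by (simp add: algebra_simps)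
      qed
      ultimately show ?case by (simp add: A_def)
    qed
    have "(A \<longlongrightarrow> A 0) (at_right 0)"
      unfolding A_def by (intro tendsto_intros)
    then have "\<beta>\<^sup>2 * R\<^sup>2 - 1 / R\<^sup>2 \<le> A 0"
      by (rule tendsto_lowerbound[OF _ ev]) simp
    then have "\<beta>\<^sup>2 * R\<^sup>2 \<le> 1 / R\<^sup>2" by (simp add: A_def)
    then have "\<beta>\<^sup>2 * R\<^sup>2 * R\<^sup>2 \<le> 1" using R by (simp add: pos_le_divide_eq)
    then show ?thesis by (simp add: power2_eq_square power4_eq_xxxx mult_ac)
  qed
  have "((\<lambda>R. \<beta>\<^sup>2 * R^4) \<longlongrightarrow> \<beta>\<^sup>2 * 1^4) (at_left (1::real))" by (intro tendsto_intros)
  moreover have "eventually (\<lambda>R. \<beta>\<^sup>2 * R^4 \<le> 1) (at_left (1::real))"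
    by (rule eventually_at_leftI[of "1/2"]) (auto intro: main)
  ultimately have "\<beta>\<^sup>2 * 1^4 \<le> 1" by (intro tendsto_upperbound) auto
  then show ?thesis using \<beta>0 by (simp add: \<beta>_def power_le_one_iff abs_square_le_1)
qed

text \<open>
  The area theorem is applied to the odd function \<open>F = 1 / sqrt (f(z^2)) = 1/z + b z + ...\<close>, with
  \<open>b = - f''(0) / 4\<close>. It is injective: \<open>F(z)\<close> determines \<open>f(z^2)\<close>, hence \<open>z^2\<close>, and the sign of z is
  recovered from that of F.
\<close>

lemma bieberbach_second_coefficient:
  assumes f: "f holomorphic_on ball 0 1" and inj: "inj_on f (ball 0 1)" and f0: "f 0 = 0" and f1: "deriv f 0 = 1"
  shows "norm (deriv (deriv f) 0) \<le> 4"
proof -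
  let ?D = "ball (0::complex) 1"
  define k where "k z = (if z = 0 then 1 else f z / z)" for z
  have k: "k holomorphic_on ?D"
  proof -
    have "(\<lambda>z. if z = 0 then deriv f 0 else (f z - f 0) / (z - 0)) = k" by (auto simp: fun_eq_iff k_def f0 f1)
    then show ?thesis using pole_lemma_open[OF f open_ball, of 0] by simp
  qed
  have fk: "f z = z * k z" for z by (simp add: k_def f0)
  have knz: "k z \<noteq> 0" if z: "z \<in> ?D" for z
  proof (cases "z = 0")
    case False
    then have "f z \<noteq> f 0" using inj_onD[OF inj, of z 0] z by auto
    then show ?thesis using False f0 by (simp add: k_def)
  qed (simp add: k_def)
  obtain L where L: "L holomorphic_on ?D" "\<And>z. z \<in> ?D \<Longrightarrow> exp (L z) = k z"
    using holomorphic_logarithm_exists[of ?D k 0] k knz by auto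
  define M where "M z = exp (- (L z - L 0) / 2)" for z
  have M: "M holomorphic_on ?D" unfolding M_def by (intro holomorphic_intros L) auto
  have M0: "M 0 = 1" by (simp add: M_def)
  have Mnz: "M z \<noteq> 0" for z by (simp add: M_def)
  have M2: "(M z)\<^sup>2 * k z = 1" if z: "z \<in> ?D" for z
  proof -
    have "exp (L 0) = 1" using L(2)[of 0] by (simp add: k_def)
    moreover have "(M z)\<^sup>2 = exp (L 0) / exp (L z)"
    proof -
      have "- (L z - L 0) / 2 + - (L z - L 0) / 2 = L 0 - L z" by (simp add: field_simps)
      then show ?thesis unfolding M_def power2_eq_square exp_add[symmetric] by (simp only: exp_diff)
    qed
    ultimately show ?thesis using L(2)[OF z] knz[OF z] by simp
  qed
  define b where "b = deriv M 0"
  define N1 where "N1 z = (if z = 0 then b else (M z - 1) / z)" for z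
  have N1: "N1 holomorphic_on ?D"
  proof -
    have "(\<lambda>z. if z = 0 then deriv M 0 else (M z - M 0) / (z - 0)) = N1" by (auto simp: fun_eq_iff N1_def M0 b_def)
    then show ?thesis using pole_lemma_open[OF M open_ball, of 0] by simp
  qed
  define N2 where "N2 z = (if z = 0 then deriv N1 0 else (N1 z - b) / z)" for z
  have N2: "N2 holomorphic_on ?D"
  proof -
    have "(\<lambda>z. if z = 0 then deriv N1 0 else (N1 z - N1 0) / (z - 0)) = N2" by (auto simp: fun_eq_iff N2_def N1_def)
    then show ?thesis using pole_lemma_open[OF N1 open_ball, of 0] by simp
  qed
  have Mexp: "M z = 1 + b * z + z\<^sup>2 * N2 z" for z
    by (cases "z = 0") (simp_all add: N2_def N1_def M0 power2_eq_square field_simps)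
  define F where "F z = 1 / z + b * z + z^3 * N2 (z\<^sup>2)" for z
  have sq: "z\<^sup>2 \<in> ?D" if "z \<in> ?D" for z :: complex
    using that by (simp add: norm_power power_less_one_iff abs_square_less_1)
  have "norm b \<le> 1"
  proof (rule area_theorem)
    show "(\<lambda>z. N2 (z\<^sup>2)) holomorphic_on ?D"
      using sq by (intro holomorphic_on_compose_gen[OF _ N2, unfolded o_def] holomorphic_intros) auto
    show "F z = 1 / z + b * z + z^3 * N2 (z\<^sup>2)" for z by (simp add: F_def)
    have FM: "F z = M (z\<^sup>2) / z" if "z \<noteq> 0" for z
      using that by (simp add: F_def Mexp field_simps power2_eq_square power3_eq_cube)
    have Ff: "(F z)\<^sup>2 * f (z\<^sup>2) = 1" if "z \<in> ?D - {0}" for z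
    proof -
      have "(F z)\<^sup>2 * f (z\<^sup>2) = (M (z\<^sup>2))\<^sup>2 * k (z\<^sup>2)"
        using that by (simp add: FM fk power_divide)
      then show ?thesis using M2[OF sq[of z]] that by simp
    qed
    show "inj_on F (?D - {0})"
    proof (rule inj_onI)
      fix x y assume x: "x \<in> ?D - {0}" and y: "y \<in> ?D - {0}" and eq: "F x = F y"
      have "F y \<noteq> 0" using y Mnz FM by auto
      then have "f (x\<^sup>2) = f (y\<^sup>2)" using Ff[OF x] Ff[OF y] eq by (metis mult_left_cancel power_not_zero)
      then have "x\<^sup>2 = y\<^sup>2" using inj_onD[OF inj] sq x y by blast
      then have "x = y \<or> x = - y" by (simp add: power2_eq_iff)
      moreover have "x \<noteq> - y"
      proof
        assume "x = - y"
        then have "F x = - F y" using y by (simp add: FM)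
        then show False using eq \<open>F y \<noteq> 0\<close> by simp
      qed
      ultimately show "x = y" by simp
    qed
  qed
  moreover have "deriv (deriv f) 0 = - 4 * b"
  proof -
    have k': "(k has_field_derivative deriv k z) (at z)" if "z \<in> ?D" for z using k that by (intro holomorphic_derivI) auto
    have k'': "(deriv k has_field_derivative deriv (deriv k) 0) (at 0)"
      using holomorphic_derivI[OF holomorphic_deriv[OF k open_ball] open_ball] by simp
    have d1: "deriv f z = k z + z * deriv k z" if "z \<in> ?D" for z
    proof (rule DERIV_imp_deriv)
      have "((\<lambda>z. z * k z) has_field_derivative k z + z * deriv k z) (at z)"
        using k'[OF that] by (auto intro!: derivative_eq_intros)
      then show "(f has_field_derivative k z + z * deriv k z) (at z)" by (simp only: fk[abs_def])
    qed
    have "((\<lambda>z. k z + z * deriv k z) has_field_derivative deriv k 0 + deriv k 0) (at 0)"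
      using DERIV_add[OF k'[of 0] DERIV_mult[OF DERIV_ident k'']] by simp
    then have "(deriv f has_field_derivative deriv k 0 + deriv k 0) (at 0)"
      by (rule has_field_derivative_transform_within_open[where S="?D"]) (auto simp: d1)
    then have 1: "deriv (deriv f) 0 = 2 * deriv k 0" by (simp add: DERIV_imp_deriv)
    have "(M has_field_derivative b) (at 0)" unfolding b_def using M by (intro holomorphic_derivI) auto
    then have "((\<lambda>z. (M z)\<^sup>2 * k z) has_field_derivative 2 * b + deriv k 0) (at 0)"
    proof -
      have "k 0 = 1" by (simp add: k_def)
      then show ?thesis using \<open>(M has_field_derivative b) (at 0)\<close> k'[of 0]
        by (auto intro!: derivative_eq_intros simp: M0)
    qed
    moreover have "((\<lambda>z. (M z)\<^sup>2 * k z) has_field_derivative 0) (at 0)"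
      by (rule has_field_derivative_transform_within_open[where S="?D", OF DERIV_const[of 1]]) (auto simp: M2)
    ultimately have "2 * b + deriv k 0 = 0" by (rule DERIV_unique)
    then have "deriv k 0 = - (2 * b)" by (simp add: eq_neg_iff_add_eq_0 add.commute)
    then show ?thesis using 1 by simp
  qed
  ultimately show ?thesis by (simp add: norm_mult)
qed

text \<open>
  For K = 1 the inequality \<open>(|h'| + |g'|)^2 \<le> |h'|^2 - |g'|^2\<close> forces \<open>g' = 0\<close>, so the class reduces to
  the normalized univalent functions.
\<close>

lemma gamma_star_1: "gamma_star 1 = 2"
proof (rule antisym)
  have "norm (f_zz F 0) / 2 \<le> 2" if "F \<in> S_H_qr 1" for F
  proof -
    obtain h g where F: "F = (h, g)" by (cases F)
    let ?D = "ball (0::complex) 1"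
    have hol: "h holomorphic_on ?D" "g holomorphic_on ?D" and h0: "h 0 = 0" "g 0 = 0" "deriv h 0 = 1"
      and inj: "inj_on (harmonic_map (h, g)) ?D"
      and J: "\<And>z. z \<in> ?D \<Longrightarrow> 0 < Jac (h,g) z" and L: "\<And>z. z \<in> ?D \<Longrightarrow> (Lam (h,g) z)\<^sup>2 \<le> 1 * Jac (h,g) z"
      using that unfolding F by (auto simp: S_H_qr_def S_H_def)
    have g': "deriv g z = 0" if z: "z \<in> ?D" for z
    proof -
      define x where "x = norm (deriv h z)"
      define y where "y = norm (deriv g z)"
      have "0 < x\<^sup>2 - y\<^sup>2" using J[OF z] by (simp add: Jac_def f_z_def f_zbar_def x_def y_def)
      then have "x \<noteq> 0" by (auto simp: not_less)
      then have "x > 0" "y \<ge> 0" by (auto simp: x_def y_def)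
      moreover have "(x + y)\<^sup>2 \<le> x\<^sup>2 - y\<^sup>2" using L[OF z] by (simp add: Lam_def Jac_def f_z_def f_zbar_def x_def y_def)
      then have "y * (x + y) \<le> 0" by (simp add: power2_eq_square algebra_simps)
      ultimately have "y = 0" by (smt (verit) mult_pos_pos)
      then show ?thesis by (simp add: y_def)
    qed
    have "\<exists>c. \<forall>z\<in>?D. g z = c"
    proof (rule has_field_derivative_zero_constant)
      show "(g has_field_derivative 0) (at z within ?D)" if "z \<in> ?D" for z
        using holomorphic_derivI[OF hol(2) open_ball that] g'[OF that] by (simp add: has_field_derivative_at_within)
    qed simp
    then have "g z = 0" if "z \<in> ?D" for z using that h0 by (metis centre_in_ball zero_less_one)
    then have "inj_on h ?D" using inj by (simp add: inj_on_def harmonic_map_def)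
    then show ?thesis using bieberbach_second_coefficient[OF hol(1) _ h0(1,3)] by (simp add: F f_zz_def)
  qed
  then show "gamma_star 1 \<le> 2"
    unfolding gamma_star_def using koebe_in_S_H_qr(1)[of 1] by (intro cSUP_least) auto
  show "2 \<le> gamma_star 1" by (rule gamma_star_ge_2) simp
qed

section \<open>Integral means and coefficients of harmonic quasiregular univalent maps\<close>

theorem theorem2p6:
  fixes K :: real
  assumes "K \<ge> 1"
  shows "(\<forall>f\<in>S_H_qr K. \<forall>p>1 / gamma_star K.
            (\<lambda>r. M_p p r (harmonic_map f))
              \<in> O[at_left 1](\<lambda>r. 1 / (1 - r) powr (gamma_star K - 1 / p))) \<and>
         (\<exists>C::real. \<forall>h g. \<forall>a b :: nat \<Rightarrow> complex.
            (h, g) \<in> S_H_qr K \<longrightarrow>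
            (\<forall>z\<in>unit_disc. (\<lambda>n. a (n + 2) * z ^ (n + 2)) sums (h z - z)) \<longrightarrow>
            (\<forall>z\<in>unit_disc. (\<lambda>n. b (n + 1) * z ^ (n + 1)) sums g z) \<longrightarrow>
            (\<forall>n\<ge>2. norm (a n) \<le> C * real n powr (gamma_star K - 1))) \<and>
         (K = 1 \<longrightarrow> gamma_star K - 1 = 1)"
proof (intro conjI ballI allI impI)
  show "(\<lambda>r. M_p p r (harmonic_map f)) \<in> O[at_left 1](\<lambda>r. 1 / (1 - r) powr (gamma_star K - 1 / p))"
    if "f \<in> S_H_qr K" "p > 1 / gamma_star K" for f p
    using S_H_qr_M_p_bigo[OF assms that] .
  obtain C where C: "\<And>h g n. (h, g) \<in> S_H_qr K \<Longrightarrow> n \<ge> 2 \<Longrightarrow>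
      norm ((deriv ^^ n) h 0 / fact n) \<le> C * real n powr (gamma_star K - 1)"
    using S_H_qr_coefficient_bound[OF assms] by blast
  show "\<exists>C::real. \<forall>h g. \<forall>a b :: nat \<Rightarrow> complex.
            (h, g) \<in> S_H_qr K \<longrightarrow>
            (\<forall>z\<in>unit_disc. (\<lambda>n. a (n + 2) * z ^ (n + 2)) sums (h z - z)) \<longrightarrow>
            (\<forall>z\<in>unit_disc. (\<lambda>n. b (n + 1) * z ^ (n + 1)) sums g z) \<longrightarrow>
            (\<forall>n\<ge>2. norm (a n) \<le> C * real n powr (gamma_star K - 1))"
  proof (intro exI[of _ C] allI impI)
    fix h g and a b :: "nat \<Rightarrow> complex" and n :: nat
    assume F: "(h, g) \<in> S_H_qr K" and n: "2 \<le> n"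
      and sums: "\<forall>z\<in>unit_disc. (\<lambda>n. a (n + 2) * z ^ (n + 2)) sums (h z - z)"
    from C[OF F n] show "norm (a n) \<le> C * real n powr (gamma_star K - 1)"
      by (simp only: coefficient_of_normalized_series[OF sums n])
  qed
  show "gamma_star K - 1 = 1" if "K = 1" using gamma_star_1 that by simp
qed
end
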